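(* Let $\alpha>0$ and let $T_\alpha\colon[0,1]\to[0,1]$ be the Manneville–Pomeau map, and let $\lambda$ be Lebesgue measure, $\lambda_d$ its $d$-fold product on $[0,1]^d$. Then: (1) $\lambda_2$-a.e. pair $(x,y)\in[0,1]^2$ is $\tfrac13$-Li-Yorke for $T_\alpha$; (2) for $d\ge 3$: (i) if $\alpha\le\frac{d-1}{d-2}$ and $\delta<\frac{1}{2(d-2)}$, then $\lambda_d$-a.e. $d$-tuple is $\delta$-Li-Yorke for $T_\alpha$; (ii) if $\alpha>\frac{d-1}{d-2}$ and $\varepsilon>0$, then $\lambda_d$-a.e. $d$-tuple is not $\varepsilon$-separated; in particular $\lambda_d$-a.e. $d$-tuple is not Li-Yorke.
   Context: The Manneville–Pomeau map is $T_\alpha(x)=x(1+2^\alpha x^\alpha)$ for $x\in[0,\tfrac12)$ and $T_\alpha(x)=2x-1$ for $x\in[\tfrac12,1]$. With $\rho(x,y)=|x-y|$: a $d$-tuple $(x_1,\dots,x_d)$ is proximal if $\liminf_{n}\max_{i,j}\rho(T_\alpha^n x_i,T_\alpha^n x_j)=0$; it is $\delta$-separated if $\limsup_n\min_{i\ne j}\rho(T_\alpha^n x_i,T_\alpha^n x_j)>\delta$; separated if $\delta$-separated for some $\delta>0$; Li-Yorke if proximal and separated; $\delta$-Li-Yorke if proximal and $\delta$-separated. *)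

theory Defs
  imports "HOL-Analysis.Analysis" "HOL-Probability.Probability"
begin

definition MP :: "real \<Rightarrow> real \<Rightarrow> real" where
  "MP \<alpha> x = (if x < 1/2 then x * (1 + 2 powr \<alpha> * x powr \<alpha>) else 2 * x - 1)"

definition lambda_d :: "nat \<Rightarrow> (nat \<Rightarrow> real) measure" where
  "lambda_d d = PiM {..<d} (\<lambda>_. restrict_space lborel {0..1})"

definition proximal :: "(real \<Rightarrow> real) \<Rightarrow> nat \<Rightarrow> (nat \<Rightarrow> real) \<Rightarrow> bool" where
  "proximal T d x \<longleftrightarrow>
     liminf (\<lambda>n. ereal (Max {\<bar>(T ^^ n) (x i) - (T ^^ n) (x j)\<bar> | i j. i < d \<and> j < d})) = 0"

definition delta_separated :: "(real \<Rightarrow> real) \<Rightarrow> nat \<Rightarrow> real \<Rightarrow> (nat \<Rightarrow> real) \<Rightarrow> bool" where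
  "delta_separated T d \<delta> x \<longleftrightarrow>
     limsup (\<lambda>n. ereal (Min {\<bar>(T ^^ n) (x i) - (T ^^ n) (x j)\<bar> | i j. i < d \<and> j < d \<and> i \<noteq> j}))
       > ereal \<delta>"

definition separated :: "(real \<Rightarrow> real) \<Rightarrow> nat \<Rightarrow> (nat \<Rightarrow> real) \<Rightarrow> bool" where
  "separated T d x \<longleftrightarrow> (\<exists>\<delta>>0. delta_separated T d \<delta> x)"

definition li_yorke :: "(real \<Rightarrow> real) \<Rightarrow> nat \<Rightarrow> (nat \<Rightarrow> real) \<Rightarrow> bool" where
  "li_yorke T d x \<longleftrightarrow> proximal T d x \<and> separated T d x"

definition delta_li_yorke :: "(real \<Rightarrow> real) \<Rightarrow> nat \<Rightarrow> real \<Rightarrow> (nat \<Rightarrow> real) \<Rightarrow> bool" where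
  "delta_li_yorke T d \<delta> x \<longleftrightarrow> proximal T d x \<and> delta_separated T d \<delta> x"

end

theory Submission
  imports Defs "HOL-Real_Asymp.Real_Asymp"
begin

text \<open>
  The transfer operator \<open>P\<close> preserves the cone of decreasing densities \<open>f\<close> for which
  \<open>x powr (1 + \<alpha>) * f x\<close> increases; there \<open>f\<close> is comparable to \<open>f 1\<close> away from 0, which replaces
  bounded distortion. With \<open>u n = (P ^^ n) 1 1\<close>, a point is in a given subset of \<open>[1/2, 1]\<close> at
  time \<open>n\<close> with probability of order \<open>u n\<close>, and decomposing at the last visit to \<open>[1/2, 1]\<close> gives an
  approximate renewal equation for \<open>u\<close> with excursion tails \<open>a k\<close> of order \<open>k powr (- 1 / \<alpha>)\<close>.

  A tuple is separated at time \<open>n\<close> only if at most one of its points is near 0, an event of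
  probability of order \<open>u n ^ (d - 1)\<close>. For \<open>\<alpha> > (d - 1) / (d - 2)\<close> the pointwise bound
  \<open>u n = O(n powr (1 / \<alpha> - 1))\<close> makes this summable. Otherwise the series diverges, and a second
  moment argument shows that with positive probability infinitely often \<open>d - 1\<close> points are in
  prescribed subintervals of \<open>[1/2, 1]\<close> and the last one is near 0. The map is exact, hence its
  products are ergodic, so this probability is 1. Proximality is the same argument with all points
  near 0: the densities decrease, so \<open>[0, \<eta>]\<close> is occupied with probability at least \<open>\<eta>\<close> at any time.
\<close>

section \<open>Renewal sequences\<close>

text \<open>The points of a tuple are independent and \<open>u n\<close> is of order
  \<open>n powr (1 / \<alpha> - 1)\<close> (for \<alpha> > 1, and from below on average only), so
  the series of \<open>u n ^ (d - 1)\<close> is critical when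
  \<open>(d - 1) * (1 - 1 / \<alpha>) = 1\<close>, that is at \<alpha> = (d - 1) / (d - 2). The two
  sides of this threshold need different information. Divergence follows from the averages of
  \<open>u\<close>, hence from the tails of the excursions. Convergence needs a pointwise bound, and
  for \<open>1 / \<alpha> < 1 / 2\<close> tails cannot give it: a single excursion length might
  carry too much mass. It is the explicit size of \<open>a k - a (k + 1)\<close> that excludes this.
  Since densities are comparable to constants without being constant, every renewal relation is a
  pair of inequalities, and arguments by generating functions or exact asymptotics are replaced by
  averaging and induction, which tolerate constants.\<close>

lemma sum_powr_upper:
  fixes \<beta> :: real
  assumes "0 < \<beta>" "\<beta> < 1"
  shows "(\<Sum>k<N. real (Suc k) powr - \<beta>) \<le> real N powr (1 - \<beta>) / (1 - \<beta>)"
proof (induction N)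
  case 0
  then show ?case by simp
next
  case (Suc N)
  have step: "(1 - \<beta>) * real (Suc N) powr - \<beta> \<le> real (Suc N) powr (1 - \<beta>) - real N powr (1 - \<beta>)"
  proof (cases "N = 0")
    case True
    then show ?thesis using assms by simp
  next
    case False
    have "\<exists>z>real N. z < real (Suc N) \<and> real (Suc N) powr (1 - \<beta>) - real N powr (1 - \<beta>)
        = (real (Suc N) - real N) * ((1 - \<beta>) * z powr (1 - \<beta> - 1))"
      using False by (intro MVT2 DERIV_powr[THEN DERIV_cong])
        (auto intro!: derivative_eq_intros simp: powr_diff powr_minus field_simps)
    then obtain z where z: "real N < z" "z < real (Suc N)"
      "real (Suc N) powr (1 - \<beta>) - real N powr (1 - \<beta>) = (1 - \<beta>) * z powr - \<beta>"
      by auto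
    have "real (Suc N) powr - \<beta> \<le> z powr - \<beta>"
      using z False assms by (intro powr_mono2') auto
    then show ?thesis using z assms by simp
  qed
  have "(\<Sum>k<Suc N. real (Suc k) powr - \<beta>) \<le> real N powr (1 - \<beta>) / (1 - \<beta>) + real (Suc N) powr - \<beta>"
    using Suc by simp
  also have "real (Suc N) powr - \<beta> \<le> (real (Suc N) powr (1 - \<beta>) - real N powr (1 - \<beta>)) / (1 - \<beta>)"
    using step assms by (subst pos_le_divide_eq) (auto simp: mult.commute)
  also have "real N powr (1 - \<beta>) / (1 - \<beta>) + \<dots> = real (Suc N) powr (1 - \<beta>) / (1 - \<beta>)"
    by (simp add: diff_divide_distrib)
  finally show ?case by simp
qed

text \<open>A convolution summed over time, with \<open>s = t - 1 - i\<close>. The shift by 1 occurs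
  because mass that leaves \<open>[1/2, 1]\<close> at time \<open>i\<close> begins its excursion at
  time \<open>i + 1\<close>.\<close>

lemma sum_triangle_swap:
  fixes f :: "nat \<Rightarrow> nat \<Rightarrow> 'a :: comm_monoid_add"
  shows "(\<Sum>t\<le>n. \<Sum>i<t. f i (t - 1 - i)) = (\<Sum>i<n. \<Sum>s<n - i. f i s)"
proof (induction n)
  case 0
  then show ?case by simp
next
  case (Suc n)
  have "(\<Sum>i<Suc n. \<Sum>s<Suc n - i. f i s) = (\<Sum>i<Suc n. (\<Sum>s<n - i. f i s) + f i (n - i))"
    by (intro sum.cong refl) (simp add: Suc_diff_le)
  also have "\<dots> = (\<Sum>i<n. \<Sum>s<n - i. f i s) + (\<Sum>i<Suc n. f i (n - i))"
    by (simp add: sum.distrib add_ac)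
  finally show ?case using Suc by simp
qed

lemma divide_powr_diff_one:
  fixes x c p :: real
  assumes "0 < x" "0 < c"
  shows "(x / c) powr (p - 1) = c powr (1 - p) * x powr (p - 1)"
  using assms by (simp add: powr_divide powr_diff field_simps)

text \<open>Intended reading: \<open>u n\<close> is the level of the density on
  \<open>[1/2, 1]\<close> at time \<open>n\<close>, \<open>a k\<close> the tail of the excursion
  lengths, \<open>\<phi> t k\<close> the mass that at time \<open>t\<close> needs \<open>k\<close>
  more steps to reach \<open>[1/2, 1]\<close>. The hypothesis \<open>b_upper\<close> concerns single
  lengths: for \<beta> < 1/2 the tail bounds alone would admit a length \<open>n\<close> of
  probability of order \<open>n powr - \<beta>\<close>, which exceeds the desired
  \<open>n powr (\<beta> - 1)\<close>.\<close>

locale renewal_bound =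
  fixes \<beta> C0 C1 C2 C3 C4 c1 :: real
    and u a :: "nat \<Rightarrow> real" and \<phi> :: "nat \<Rightarrow> nat \<Rightarrow> real"
  assumes beta: "0 < \<beta>" "\<beta> < 1"
    and cpos: "0 < C0" "0 < C1" "0 < C2" "0 < C3" "0 < C4" "0 < c1"
    and u_nonneg: "\<And>n. 0 \<le> u n"
    and renewal: "\<And>t. (\<Sum>i<t. u i * a (t - 1 - i)) \<le> C0"
    and a_lower: "\<And>k. c1 * real (Suc k) powr - \<beta> \<le> a k"
    and a_upper: "\<And>k. a k \<le> C1 * real (Suc k) powr - \<beta>"
    and a_dec: "\<And>k. a (Suc k) \<le> a k"
    and b_upper: "\<And>k. a k - a (Suc k) \<le> C2 * real (Suc k) powr (- 1 - \<beta>)"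
    and phi_0: "\<And>k. \<phi> 0 k \<le> a k - a (Suc k)"
    and phi_nonneg: "\<And>t k. 0 \<le> \<phi> t k"
    and phi_Suc: "\<And>t k. \<phi> (Suc t) k \<le> \<phi> t (Suc k) + C3 * u t * (a k - a (Suc k))"
    and u_split: "\<And>n t. t \<le> n \<Longrightarrow> u n \<le> C4 * (\<Sum>k\<le>n - t. \<phi> t k * u (n - t - k))"
begin

abbreviation (input) "b k \<equiv> a k - a (Suc k)"

lemma a_pos: "0 < a k"
  by (rule less_le_trans[OF _ a_lower]) (use cpos in simp)

lemma a_antimono: "i \<le> j \<Longrightarrow> a j \<le> a i"
  using a_dec by (simp add: lift_Suc_antimono_le)

text \<open>As \<open>a\<close> decreases, its least value \<open>a (N - 1)\<close> can be pulled
  out of the convolution in \<open>renewal\<close>.\<close>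

lemma sum_u_upper: "(\<Sum>i<N. u i) \<le> C0 / c1 * real N powr \<beta>"
proof (cases "N = 0")
  case False
  have "(\<Sum>i<N. u i) * a (N - 1) \<le> (\<Sum>i<N. u i * a (N - 1 - i))"
    unfolding sum_distrib_right
    by (intro sum_mono mult_left_mono a_antimono u_nonneg) auto
  also have "\<dots> \<le> C0" by (rule renewal)
  finally have 1: "(\<Sum>i<N. u i) * a (N - 1) \<le> C0" .
  have "(\<Sum>i<N. u i) * (c1 * real N powr - \<beta>) \<le> (\<Sum>i<N. u i) * a (N - 1)"
    using a_lower[of "N - 1"] False by (intro mult_left_mono sum_nonneg u_nonneg) auto
  with 1 have "(\<Sum>i<N. u i) * (c1 * real N powr - \<beta>) \<le> C0" by linarith
  then show ?thesis using cpos False by (simp add: field_simps powr_minus)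
qed simp

text \<open>Unrolls \<open>phi_Suc\<close>. The term with index \<open>i\<close> is the mass that
  left \<open>[1/2, 1]\<close> for the last time at time \<open>i\<close>; the first term is the
  mass that has not been there.\<close>

lemma phi_upper: "\<phi> t k \<le> b (t + k) + C3 * (\<Sum>i<t. u i * b (t - 1 - i + k))"
proof (induction t arbitrary: k)
  case 0
  then show ?case using phi_0 by simp
next
  case (Suc t)
  have "\<phi> (Suc t) k \<le> \<phi> t (Suc k) + C3 * u t * b k" by (rule phi_Suc)
  also have "\<dots> \<le> b (t + Suc k) + C3 * (\<Sum>i<t. u i * b (t - 1 - i + Suc k)) + C3 * u t * b k"
    using Suc[of "Suc k"] by simp
  also have "(\<Sum>i<t. u i * b (t - 1 - i + Suc k)) = (\<Sum>i<t. u i * b (Suc t - 1 - i + k))"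
    by (intro sum.cong refl) (auto simp: Suc_diff_Suc)
  finally show ?case by (simp add: algebra_simps)
qed

lemma sum_b: "(\<Sum>s<n. b (s + k)) \<le> a k"
proof -
  have "(\<Sum>s<n. b (s + k)) = a k - a (n + k)" by (induction n) auto
  then show ?thesis using a_pos[of "n + k"] by simp
qed

text \<open>For a fixed start \<open>i\<close> the terms \<open>b (s + k)\<close> telescope when
  summed over time and leave at most the tail \<open>a k\<close>.\<close>

lemma sum_phi_time: "(\<Sum>t\<le>n. \<phi> t k) \<le> a k * (1 + C3 * (\<Sum>i<n. u i))"
proof -
  have "(\<Sum>t\<le>n. \<phi> t k) \<le> (\<Sum>t\<le>n. b (t + k)) + C3 * (\<Sum>t\<le>n. \<Sum>i<t. u i * b (t - 1 - i + k))"
    by (subst sum_distrib_left, subst sum.distrib[symmetric], intro sum_mono phi_upper)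
  also have "(\<Sum>t\<le>n. b (t + k)) \<le> a k"
    using sum_b[of k "Suc n"] by (simp add: lessThan_Suc_atMost)
  also have "(\<Sum>t\<le>n. \<Sum>i<t. u i * b (t - 1 - i + k)) = (\<Sum>i<n. \<Sum>s<n - i. u i * b (s + k))"
    by (rule sum_triangle_swap[of "\<lambda>i s. u i * b (s + k)"])
  also have "\<dots> \<le> (\<Sum>i<n. u i * a k)"
    unfolding sum_distrib_left[symmetric] by (intro sum_mono mult_left_mono sum_b u_nonneg)
  finally show ?thesis using cpos by (simp add: sum_distrib_left sum_distrib_right algebra_simps)
qed

text \<open>Averaging: if all \<open>n div 2\<close> candidate times violated the bound, their sum
  would exceed what \<open>sum_phi_time\<close> allows for all times up to \<open>n\<close>
  together.\<close>

lemma exists_good_time: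
  assumes "n \<ge> 2"
  shows "\<exists>t\<in>{1..n div 2}. (\<Sum>k<K. \<phi> t k) \<le>
    3 * C1 * (1 + C3 * C0 / c1) / (1 - \<beta>) * real K powr (1 - \<beta>) * real n powr (\<beta> - 1)"
proof (rule ccontr)
  define X where "X = 3 * C1 * (1 + C3 * C0 / c1) / (1 - \<beta>) * real K powr (1 - \<beta>) * real n powr (\<beta> - 1)"
  assume "\<not> (\<exists>t\<in>{1..n div 2}. (\<Sum>k<K. \<phi> t k) \<le>
    3 * C1 * (1 + C3 * C0 / c1) / (1 - \<beta>) * real K powr (1 - \<beta>) * real n powr (\<beta> - 1))"
  then have "X < (\<Sum>k<K. \<phi> t k)" if "t \<in> {1..n div 2}" for t
    using that by (force simp: X_def not_le)
  moreover have "{1..n div 2} \<noteq> {}" using assms by auto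
  ultimately have "(\<Sum>t\<in>{1..n div 2}. X) < (\<Sum>t\<in>{1..n div 2}. (\<Sum>k<K. \<phi> t k))"
    by (intro sum_strict_mono) auto
  also have "\<dots> \<le> (\<Sum>t\<le>n. (\<Sum>k<K. \<phi> t k))"
    by (intro sum_mono2 sum_nonneg phi_nonneg) auto
  also have "\<dots> = (\<Sum>k<K. \<Sum>t\<le>n. \<phi> t k)" by (rule sum.swap)
  also have "\<dots> \<le> (\<Sum>k<K. a k * (1 + C3 * (\<Sum>i<n. u i)))"
    by (intro sum_mono sum_phi_time)
  also have "\<dots> = (\<Sum>k<K. a k) * (1 + C3 * (\<Sum>i<n. u i))"
    by (simp add: sum_distrib_right)
  also have "\<dots> \<le> (C1 * (real K powr (1 - \<beta>) / (1 - \<beta>))) * ((1 + C3 * C0 / c1) * real n powr \<beta>)"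
  proof (rule mult_mono)
    have "(\<Sum>k<K. a k) \<le> (\<Sum>k<K. C1 * real (Suc k) powr - \<beta>)" by (intro sum_mono a_upper)
    also have "\<dots> \<le> C1 * (real K powr (1 - \<beta>) / (1 - \<beta>))"
      unfolding sum_distrib_left[symmetric]
      using cpos by (intro mult_left_mono sum_powr_upper beta) auto
    finally show "(\<Sum>k<K. a k) \<le> C1 * (real K powr (1 - \<beta>) / (1 - \<beta>))" .
    have "1 \<le> real n powr \<beta>" using assms beta by (intro ge_one_powr_ge_zero) auto
    moreover have "C3 * (\<Sum>i<n. u i) \<le> C3 * (C0 / c1 * real n powr \<beta>)"
      using cpos by (intro mult_left_mono sum_u_upper) auto
    ultimately show "1 + C3 * (\<Sum>i<n. u i) \<le> (1 + C3 * C0 / c1) * real n powr \<beta>"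
      by (simp add: algebra_simps)
    show "0 \<le> 1 + C3 * (\<Sum>i<n. u i)"
      using cpos by (simp add: add_nonneg_nonneg sum_nonneg u_nonneg)
  qed (use cpos beta in auto)
  also have "\<dots> = real n / 3 * X"
  proof -
    have "real n * real n powr (\<beta> - 1) = real n powr \<beta>"
      using assms by (simp add: powr_diff)
    moreover have "real n / 3 * X = C1 * (real K powr (1 - \<beta>) / (1 - \<beta>)) *
        ((1 + C3 * C0 / c1) * (real n * real n powr (\<beta> - 1)))"
    proof -
      define E H where "E = 1 + C3 * C0 / c1" and "H = 1 - \<beta>"
      show ?thesis unfolding X_def E_def[symmetric] H_def[symmetric] by simp
    qed
    ultimately show ?thesis by (simp only:)
  qed
  finally have "real (n div 2) * X < real n / 3 * X" by simp
  \<comment> \<open>Origin of the factor 3 in the bound.\<close>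
  moreover have "n \<le> 3 * (n div 2)" using assms by presburger
  then have "real n / 3 \<le> real (n div 2)" by linarith
  moreover have "0 \<le> X" unfolding X_def using cpos beta by (intro mult_nonneg_nonneg divide_nonneg_pos) auto
  ultimately show False by (meson mult_right_mono not_less)
qed

text \<open>Each excursion involved has length at least \<open>K\<close>, so its probability is at
  most \<open>C2 * real K powr (- 1 - \<beta>)\<close>, while by \<open>sum_u_upper\<close> the
  weights of the possible starts add up to the order of \<open>n powr \<beta>\<close>.\<close>

lemma phi_far:
  assumes "1 \<le> K" "K \<le> k" "t \<le> n" "1 \<le> n"
  shows "\<phi> t k \<le> (1 + C3 * C0 / c1) * C2 * real n powr \<beta> * real K powr (- 1 - \<beta>)"
proof -
  define B where "B = C2 * real K powr (- 1 - \<beta>)"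
  have bB: "b j \<le> B" if "K \<le> j" for j
  proof -
    have "b j \<le> C2 * real (Suc j) powr (- 1 - \<beta>)" by (rule b_upper)
    also have "\<dots> \<le> B" unfolding B_def using assms that cpos beta
      by (intro mult_left_mono powr_mono2') auto
    finally show ?thesis .
  qed
  have B0: "0 \<le> B" using cpos by (simp add: B_def)
  have "\<phi> t k \<le> b (t + k) + C3 * (\<Sum>i<t. u i * b (t - 1 - i + k))" by (rule phi_upper)
  also have "\<dots> \<le> B + C3 * (\<Sum>i<t. u i * B)"
    using assms cpos by (intro add_mono mult_left_mono sum_mono bB u_nonneg) auto
  also have "\<dots> = B * (1 + C3 * (\<Sum>i<t. u i))"
    by (subst sum_distrib_right[symmetric]) (simp add: algebra_simps)
  also have "\<dots> \<le> B * ((1 + C3 * C0 / c1) * real n powr \<beta>)"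
  proof (rule mult_left_mono)
    have "1 \<le> real n powr \<beta>" using assms beta by (intro ge_one_powr_ge_zero) auto
    moreover have "(\<Sum>i<t. u i) \<le> C0 / c1 * real n powr \<beta>"
      by (rule order_trans[OF sum_u_upper])
        (use assms cpos beta in \<open>intro mult_left_mono powr_mono2; simp\<close>)
    then have "C3 * (\<Sum>i<t. u i) \<le> C3 * (C0 / c1 * real n powr \<beta>)"
      using cpos by (intro mult_left_mono) auto
    ultimately show "1 + C3 * (\<Sum>i<t. u i) \<le> (1 + C3 * C0 / c1) * real n powr \<beta>"
      by (simp add: algebra_simps)
  qed (rule B0)
  finally show ?thesis by (simp add: B_def algebra_simps)
qed

text \<open>Split the last excursion at a time \<open>t\<close> of the first half at which a short excursion is
  unlikely: short excursions contribute a small multiple of the inductive bound, long ones are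
  controlled by the tail of the excursion lengths.\<close>

lemma u_upper: "\<exists>M>0. \<forall>n. u n \<le> M * real (Suc n) powr (\<beta> - 1)"
proof -
  define D1 where "D1 = 3 * C1 * (1 + C3 * C0 / c1) / (1 - \<beta>)"
  define D2 where "D2 = (1 + C3 * C0 / c1) * C2"
  have D: "0 < D1" "0 < D2" unfolding D1_def D2_def using cpos beta
    by (auto intro!: mult_pos_pos divide_pos_pos add_pos_pos)
  \<comment> \<open>Chosen so that \<open>C4 * D1 * r * 4 powr (1 - \<beta>) = 1 / 2\<close>: this
    is the share of the inductive bound that the short excursions may contribute. The condition
    \<open>\<delta> powr (1 - \<beta>) \<le> r\<close> then decides which excursions count as short,
    namely those below \<open>\<delta> * n\<close>.\<close>
  define r where "r = 1 / (2 * C4 * D1 * 4 powr (1 - \<beta>))"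
  have r: "0 < r" unfolding r_def using cpos D by simp
  define \<delta> where "\<delta> = min (1/4) (r powr (1 / (1 - \<beta>)))"
  have \<delta>: "0 < \<delta>" "\<delta> \<le> 1/4" using r by (auto simp: \<delta>_def)
  have \<delta>r: "\<delta> powr (1 - \<beta>) \<le> r"
  proof -
    have "\<delta> powr (1 - \<beta>) \<le> (r powr (1 / (1 - \<beta>))) powr (1 - \<beta>)"
      using \<delta> beta by (intro powr_mono2) (auto simp: \<delta>_def)
    also have "\<dots> = r" using r beta by (simp add: powr_powr)
    finally show ?thesis .
  qed
  define D3 where "D3 = D2 * (\<delta> / 2) powr (- 1 - \<beta>) * (C0 / c1) * 4"
  have D3: "0 < D3" unfolding D3_def using D \<delta> cpos by simp
  \<comment> \<open>From \<open>n0\<close> on, \<open>\<delta> * n\<close> is at least 2, so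
    rounding it down to \<open>K\<close> loses at most a factor 2.\<close>
  define n0 where "n0 = nat \<lceil>2 / \<delta>\<rceil> + 2"
  \<comment> \<open>The first summand absorbs the long excursions, by
    \<open>M / 2 + C4 * D3 \<le> M\<close>; the second covers all \<open>n < n0\<close>.\<close>
  define M where "M = 2 * C4 * D3 + (\<Sum>j<n0. u j * real (Suc j) powr (1 - \<beta>))"
  have M0: "0 < M" unfolding M_def using cpos D3 u_nonneg
    by (intro add_pos_nonneg sum_nonneg mult_nonneg_nonneg) auto
  have "u n \<le> M * real (Suc n) powr (\<beta> - 1)" for n
  proof (induction n rule: less_induct)
    case (less n)
    show ?case
    proof (cases "n < n0")
      case True
      have "u n * real (Suc n) powr (1 - \<beta>) \<le> (\<Sum>j<n0. u j * real (Suc j) powr (1 - \<beta>))"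
        using True u_nonneg by (intro member_le_sum[of n _ "\<lambda>j. u j * real (Suc j) powr (1 - \<beta>)"]) auto
      also have "\<dots> \<le> M" unfolding M_def using cpos D3 by simp
      finally have "u n * real (Suc n) powr (1 - \<beta>) * real (Suc n) powr (\<beta> - 1)
          \<le> M * real (Suc n) powr (\<beta> - 1)"
        by (intro mult_right_mono) auto
      then show ?thesis by (simp add: mult.assoc powr_add[symmetric])
    next
      case False
      then have n: "n \<ge> 2" "real n \<ge> 2 / \<delta>" by (auto simp: n0_def) linarith
      define K where "K = nat \<lfloor>\<delta> * real n\<rfloor>"
      have dn: "2 \<le> \<delta> * real n" using n \<delta> by (simp add: field_simps)
      have K: "real K \<le> \<delta> * real n" "\<delta> / 2 * real n \<le> real K" "1 \<le> K"
        using dn by (auto simp: K_def le_nat_floor) linarith+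
      have K4: "real K \<le> real n / 4"
        using K(1) mult_right_mono[OF \<delta>(2), of "real n"] by simp
      obtain t where t: "t \<in> {1..n div 2}"
        and near: "(\<Sum>k<K. \<phi> t k) \<le> D1 * real K powr (1 - \<beta>) * real n powr (\<beta> - 1)"
        using exists_good_time[OF n(1), of K] unfolding D1_def by blast
      have tn: "t \<le> n" "1 \<le> t" "real t \<le> real n / 2" using t by auto
      define W where "W = real (Suc n) powr (\<beta> - 1)"
      \<comment> \<open>Since \<open>t\<close> is at most \<open>n / 2\<close> and \<open>k\<close>
        less than \<open>n / 4\<close>, a quarter of the time remains, which costs the factor
        \<open>4 powr (1 - \<beta>)\<close>.\<close>
      have near_u: "u (n - t - k) \<le> M * 4 powr (1 - \<beta>) * W" if "k < K" for k
      proof -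
        have kn: "real k < real n / 4" using that K4 by simp
        then have r1: "real (n - t - k) = real n - real t - real k" using tn by linarith
        have "real (Suc n) / 4 \<le> real (Suc (n - t - k))" using r1 kn tn by simp
        then have "real (Suc (n - t - k)) powr (\<beta> - 1) \<le> (real (Suc n) / 4) powr (\<beta> - 1)"
          using beta by (intro powr_mono2') auto
        also have "\<dots> = 4 powr (1 - \<beta>) * W"
          by (simp add: W_def divide_powr_diff_one)
        finally have "M * real (Suc (n - t - k)) powr (\<beta> - 1) \<le> M * (4 powr (1 - \<beta>) * W)"
          using M0 by (intro mult_left_mono) auto
        moreover have "n - t - k < n" using tn by auto
        ultimately show ?thesis using less[of "n - t - k"] by (simp add: mult.assoc)
      qed
      have "u n \<le> C4 * (\<Sum>k\<le>n - t. \<phi> t k * u (n - t - k))" by (rule u_split[OF tn(1)])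
      also have "(\<Sum>k\<le>n - t. \<phi> t k * u (n - t - k)) \<le>
          (\<Sum>k\<in>{..<K} \<union> {K..n - t}. \<phi> t k * u (n - t - k))"
        by (intro sum_mono2 mult_nonneg_nonneg phi_nonneg u_nonneg) auto
      also have "\<dots> = (\<Sum>k<K. \<phi> t k * u (n - t - k)) + (\<Sum>k\<in>{K..n - t}. \<phi> t k * u (n - t - k))"
        by (intro sum.union_disjoint) auto
      also have "(\<Sum>k<K. \<phi> t k * u (n - t - k)) \<le> (\<Sum>k<K. \<phi> t k * (M * 4 powr (1 - \<beta>) * W))"
        by (intro sum_mono mult_left_mono near_u phi_nonneg) auto
      also have "\<dots> = (\<Sum>k<K. \<phi> t k) * (M * 4 powr (1 - \<beta>) * W)" by (rule sum_distrib_right[symmetric])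
      also have "\<dots> \<le> (D1 * r) * (M * 4 powr (1 - \<beta>) * W)"
      proof (intro mult_right_mono)
        have "real K powr (1 - \<beta>) * real n powr (\<beta> - 1) \<le> (\<delta> * real n) powr (1 - \<beta>) * real n powr (\<beta> - 1)"
          using K beta by (intro mult_right_mono powr_mono2) auto
        also have "\<dots> = \<delta> powr (1 - \<beta>)"
          using \<delta> n by (simp add: powr_mult mult.assoc powr_add[symmetric])
        also have "\<dots> \<le> r" by (rule \<delta>r)
        finally have "D1 * (real K powr (1 - \<beta>) * real n powr (\<beta> - 1)) \<le> D1 * r"
          using D by (intro mult_left_mono) auto
        then show "(\<Sum>k<K. \<phi> t k) \<le> D1 * r" using near by (simp add: mult.assoc)
      qed (use M0 in \<open>auto simp: W_def\<close>)
      also have "(\<Sum>k\<in>{K..n - t}. \<phi> t k * u (n - t - k))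
          \<le> (\<Sum>k\<in>{K..n - t}. (D2 * real n powr \<beta> * real K powr (- 1 - \<beta>)) * u (n - t - k))"
        using K(3) tn n unfolding D2_def by (intro sum_mono mult_right_mono phi_far u_nonneg) auto
      also have "\<dots> = (D2 * real n powr \<beta> * real K powr (- 1 - \<beta>)) * (\<Sum>k\<in>{K..n - t}. u (n - t - k))"
        by (rule sum_distrib_left[symmetric])
      also have "\<dots> \<le> D3 * W"
      proof -
        have "(\<Sum>k\<in>{K..n - t}. u (n - t - k)) = (\<Sum>j\<in>(\<lambda>k. n - t - k) ` {K..n - t}. u j)"
          by (subst sum.reindex) (auto simp: inj_on_def)
        also have "\<dots> \<le> (\<Sum>j<n. u j)" using tn
          by (intro sum_mono2 u_nonneg) auto
        also have "\<dots> \<le> C0 / c1 * real n powr \<beta>" by (rule sum_u_upper)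
        finally have 1: "(\<Sum>k\<in>{K..n - t}. u (n - t - k)) \<le> C0 / c1 * real n powr \<beta>" .
        have "real K powr (- 1 - \<beta>) \<le> (\<delta> / 2 * real n) powr (- 1 - \<beta>)"
          using K \<delta> n beta by (intro powr_mono2') auto
        also have "\<dots> = (\<delta> / 2) powr (- 1 - \<beta>) * real n powr (- 1 - \<beta>)"
          using \<delta> by (subst powr_mult[symmetric]) auto
        finally have 2: "real K powr (- 1 - \<beta>) \<le> (\<delta> / 2) powr (- 1 - \<beta>) * real n powr (- 1 - \<beta>)" .
        \<comment> \<open>Two factors of order \<open>n powr \<beta>\<close>, for the starts of the
          long excursion and for the visits after it, meet one factor
          \<open>n powr (- 1 - \<beta>)\<close> for its length: together the exponent
          \<open>\<beta> - 1\<close>.\<close>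
        have "(D2 * real n powr \<beta> * real K powr (- 1 - \<beta>)) * (\<Sum>k\<in>{K..n - t}. u (n - t - k))
          \<le> (D2 * real n powr \<beta> * ((\<delta> / 2) powr (- 1 - \<beta>) * real n powr (- 1 - \<beta>))) * (C0 / c1 * real n powr \<beta>)"
          using D 1 2 by (intro mult_mono mult_nonneg_nonneg sum_nonneg u_nonneg) auto
        also have "\<dots> = D3 / 4 * (real n powr \<beta> * real n powr (- 1 - \<beta>) * real n powr \<beta>)"
          by (simp add: D3_def)
        also have "real n powr \<beta> * real n powr (- 1 - \<beta>) * real n powr \<beta> = real n powr (\<beta> - 1)"
          using n by (simp add: powr_add[symmetric] powr_diff powr_minus field_simps)
        also have "real n powr (\<beta> - 1) \<le> (real (Suc n) / 2) powr (\<beta> - 1)"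
          using n beta by (intro powr_mono2') auto
        also have "\<dots> = 2 powr (1 - \<beta>) * W"
          by (simp add: W_def divide_powr_diff_one)
        also have "2 powr (1 - \<beta>) * W \<le> 2 powr 2 * W"
          using beta by (intro mult_right_mono powr_mono) (auto simp: W_def)
        also have "(2::real) powr 2 = 4" by simp
        finally show ?thesis using D3 by (simp add: mult_left_mono)
      qed
      also have "C4 * (D1 * r * (M * 4 powr (1 - \<beta>) * W) + D3 * W) = (M / 2 + C4 * D3) * W"
        using cpos D by (simp add: r_def field_simps)
      also have "\<dots> \<le> M * W"
      proof (rule mult_right_mono)
        have "2 * C4 * D3 \<le> M" unfolding M_def using u_nonneg by (simp add: sum_nonneg)
        then show "M / 2 + C4 * D3 \<le> M" by simp
      qed (simp add: W_def)
      finally show ?thesis using cpos by (simp add: W_def)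
    qed
  qed
  then show ?thesis using M0 by blast
qed

end

text \<open>A pointwise substitute for Hoelder's inequality: above the level \<open>t\<close>, the
  factor \<open>(u / t) ^ (m - 1)\<close> is at least 1.\<close>

lemma le_add_power_divide:
  fixes u t :: real
  assumes "0 < t" "0 \<le> u" "1 \<le> m"
  shows "u \<le> t + u ^ m / t ^ (m - 1)"
proof (cases "u \<le> t")
  case True
  then show ?thesis using assms by (simp add: add_increasing2)
next
  case False
  have "t ^ (m - 1) \<le> u ^ (m - 1)" using False assms by (intro power_mono) auto
  then have "u * t ^ (m - 1) \<le> u * u ^ (m - 1)" using assms by (intro mult_left_mono)
  also have "u * u ^ (m - 1) = u ^ m" using assms by (cases m) auto
  finally have "u \<le> u ^ m / t ^ (m - 1)" using assms by (simp add: field_simps)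
  then show ?thesis using assms by simp
qed

text \<open>Summing \<open>renewal\<close> over time bounds the partial sums of \<open>u\<close>
  from below by a multiple of \<open>N powr p\<close>. If the powers were summable,
  \<open>le_add_power_divide\<close> with a level depending on \<open>N\<close> would make the part
  of the partial sum beyond some \<open>K\<close> at most half of this, and the finitely many terms
  before \<open>K\<close> cannot supply the rest.\<close>

lemma not_summable_power_renewal:
  fixes u a :: "nat \<Rightarrow> real" and \<beta> c C :: real
  assumes "0 < \<beta>" "0 < c" "0 < C" "1 \<le> m" "1 - 1 / real m \<le> \<beta>"
    and u: "\<And>n. 0 \<le> u n" and a: "\<And>k. 0 \<le> a k" "\<And>k. a k \<le> C * real (Suc k) powr - \<beta>"
    and renewal: "\<And>t. 1 \<le> t \<Longrightarrow> c \<le> (\<Sum>i<t. u i * a (t - 1 - i))"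
  shows "\<not> summable (\<lambda>n. u n ^ m)"
proof
  assume summable: "summable (\<lambda>n. u n ^ m)"
  \<comment> \<open>The exponent must be positive and below 1 for \<open>sum_powr_upper\<close>,
    although \<beta> may be 1 or more, and at most \<beta> for the tail bound. The lower bound
    \<open>1 - 1 / m\<close> is equivalent to \<open>(1 - p) * (m - 1) \<le> p\<close>, which is
    where the threshold enters.\<close>
  define p where "p = max (1 - 1 / real m) (min \<beta> (1 / 2))"
  have p: "0 < p" "p < 1" "p \<le> \<beta>" "1 - 1 / real m \<le> p"
    using assms by (auto simp: p_def)
  define c' where "c' = c * (1 - p) / C"
  have c': "0 < c'" using assms p by (simp add: c'_def)
  have lower: "c' * real N powr p \<le> (\<Sum>i<N. u i)" if "1 \<le> N" for N
  proof -
    have "c * real N \<le> (\<Sum>t\<in>{1..N}. \<Sum>i<t. u i * a (t - 1 - i))"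
      using sum_mono[of "{1..N}" "\<lambda>_. c", OF renewal] by (simp add: mult.commute)
    also have "\<dots> \<le> (\<Sum>t\<le>N. \<Sum>i<t. u i * a (t - 1 - i))"
      by (intro sum_mono2 sum_nonneg mult_nonneg_nonneg u a) auto
    also have "\<dots> = (\<Sum>i<N. \<Sum>s<N - i. u i * a s)"
      by (rule sum_triangle_swap[of "\<lambda>i s. u i * a s"])
    also have "\<dots> \<le> (\<Sum>i<N. u i * (\<Sum>s<N. a s))"
      unfolding sum_distrib_left[symmetric] by (intro sum_mono mult_left_mono sum_mono2 u a) auto
    also have "\<dots> = (\<Sum>i<N. u i) * (\<Sum>s<N. a s)" by (rule sum_distrib_right[symmetric])
    also have "\<dots> \<le> (\<Sum>i<N. u i) * (C * (real N powr (1 - p) / (1 - p)))"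
    proof (intro mult_left_mono sum_nonneg u)
      have "(\<Sum>s<N. a s) \<le> (\<Sum>s<N. C * real (Suc s) powr - p)"
      proof (intro sum_mono order_trans[OF a(2)] mult_left_mono)
        show "real (Suc s) powr - \<beta> \<le> real (Suc s) powr - p" for s
          using p by (intro powr_mono) auto
      qed (use assms in auto)
      also have "\<dots> \<le> C * (real N powr (1 - p) / (1 - p))"
        unfolding sum_distrib_left[symmetric] using assms p
        by (intro mult_left_mono sum_powr_upper) auto
      finally show "(\<Sum>s<N. a s) \<le> C * (real N powr (1 - p) / (1 - p))" .
    qed
    also have "real N powr (1 - p) = real N / real N powr p" using that by (simp add: powr_diff)
    finally have "c * real N * ((1 - p) * real N powr p) \<le> (\<Sum>i<N. u i) * C * real N"
      using that p by (simp add: field_simps)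
    then have "c * ((1 - p) * real N powr p) \<le> (\<Sum>i<N. u i) * C" using that by simp
    then show ?thesis using assms by (simp add: c'_def field_simps)
  qed
  define \<epsilon> where "\<epsilon> = c' / 4"
  have \<epsilon>: "0 < \<epsilon>" using c' by (simp add: \<epsilon>_def)
  obtain K where K: "\<And>N. norm (\<Sum>i\<in>{K..<N}. u i ^ m) < \<epsilon> ^ (m - 1) * \<epsilon>"
  proof -
    have "0 < \<epsilon> ^ (m - 1) * \<epsilon>" using \<epsilon> by simp
    with summable have "\<exists>K. \<forall>k\<ge>K. \<forall>n. norm (\<Sum>i\<in>{k..<n}. u i ^ m) < \<epsilon> ^ (m - 1) * \<epsilon>"
      unfolding summable_Cauchy by blast
    then show ?thesis using that by blast
  qed
  have upper: "c' / 2 * real N powr p \<le> (\<Sum>i<K. u i)" if "K \<le> N" "1 \<le> N" for N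
  proof -
    \<comment> \<open>At this level both terms of \<open>le_add_power_divide\<close> sum to at most
      \<open>\<epsilon> * real N powr p\<close>, that is, a quarter of the lower bound each.\<close>
    define t where "t = \<epsilon> * real N powr (p - 1)"
    have t: "0 < t" using \<epsilon> that by (simp add: t_def)
    have "(\<Sum>i\<in>{K..<N}. u i) \<le> (\<Sum>i\<in>{K..<N}. t + u i ^ m / t ^ (m - 1))"
      by (intro sum_mono le_add_power_divide t u assms)
    also have "\<dots> = real (N - K) * t + (\<Sum>i\<in>{K..<N}. u i ^ m) / t ^ (m - 1)"
      by (simp add: sum.distrib sum_divide_distrib)
    also have "\<dots> \<le> real N * t + (\<epsilon> ^ (m - 1) * \<epsilon>) / t ^ (m - 1)"
      using K[of N] t by (intro add_mono mult_right_mono divide_right_mono) auto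
    also have "real N * t = \<epsilon> * real N powr p"
      using that by (simp add: t_def powr_diff)
    also have "(\<epsilon> ^ (m - 1) * \<epsilon>) / t ^ (m - 1) = \<epsilon> * real N powr ((1 - p) * real (m - 1))"
    proof -
      have "(real N powr (p - 1)) ^ (m - 1) = real N powr ((p - 1) * real (m - 1))"
        using that by (simp add: powr_powr[symmetric] powr_realpow)
      also have "\<dots> = inverse (real N powr ((1 - p) * real (m - 1)))"
        by (simp add: powr_minus[symmetric] algebra_simps)
      finally show ?thesis using \<epsilon> by (simp add: t_def power_mult_distrib divide_inverse)
    qed
    also have "real N powr ((1 - p) * real (m - 1)) \<le> real N powr p"
    proof (rule powr_mono)
      have "real m * (1 - 1 / real m) \<le> real m * p" using p by (intro mult_left_mono) auto
      then have "real m - 1 \<le> real m * p" using assms by (simp add: right_diff_distrib)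
      then show "(1 - p) * real (m - 1) \<le> p" using assms by (simp add: of_nat_diff algebra_simps)
    qed (use that in simp)
    finally have "(\<Sum>i\<in>{K..<N}. u i) \<le> c' / 2 * real N powr p"
      using \<epsilon> by (simp add: \<epsilon>_def)
    moreover have "(\<Sum>i<N. u i) = (\<Sum>i<K. u i) + (\<Sum>i\<in>{K..<N}. u i)"
      using sum.atLeastLessThan_concat[of 0 K N u] that by (simp add: lessThan_atLeast0)
    ultimately show ?thesis using lower[OF that(2)] by linarith
  qed
  have "filterlim (\<lambda>N. c' / 2 * real N powr p) at_top sequentially"
    using p c' by real_asymp
  then have "\<forall>\<^sub>F N in sequentially. (\<Sum>i<K. u i) + 1 \<le> c' / 2 * real N powr p"
    unfolding filterlim_at_top by blast
  then have "\<forall>\<^sub>F N in sequentially. (\<Sum>i<K. u i) + 1 \<le> c' / 2 * real N powr p \<and> K \<le> N \<and> 1 \<le> N"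
    using eventually_ge_at_top[of K] eventually_ge_at_top[of 1] by eventually_elim auto
  then obtain N where "(\<Sum>i<K. u i) + 1 \<le> c' / 2 * real N powr p" "K \<le> N" "1 \<le> N"
    by (auto simp: eventually_sequentially)
  with upper[of N] show False by linarith
qed


section \<open>The transfer operator and its invariant cone\<close>

abbreviation unit_measure :: "real measure" where
  "unit_measure \<equiv> restrict_space lborel {0..1}"

lemma prob_space_unit_measure: "prob_space unit_measure"
  by (intro prob_spaceI) (simp add: emeasure_restrict_space)

lemma space_unit_measure [simp]: "space unit_measure = {0..1}"
  by (simp add: space_restrict_space)

text \<open>One class for densities and test functions: it is closed under sums, products and
  composition with the map, and its members are integrable. Values outside \<open>[0, 1]\<close> are
  ignored.\<close>

definition bounded_borel :: "(real \<Rightarrow> real) \<Rightarrow> bool" where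
  "bounded_borel f \<longleftrightarrow> f \<in> borel_measurable unit_measure \<and> (\<exists>B. \<forall>x\<in>{0..1}. \<bar>f x\<bar> \<le> B)"

lemma bounded_borelI:
  assumes "f \<in> borel_measurable unit_measure" "\<And>x. x \<in> {0..1} \<Longrightarrow> \<bar>f x\<bar> \<le> B"
  shows "bounded_borel f"
  using assms unfolding bounded_borel_def by blast

lemma bounded_borel_const [intro, simp]: "bounded_borel (\<lambda>_. c)"
  by (rule bounded_borelI[of _ "\<bar>c\<bar>"]) auto

lemma bounded_borel_add [intro]:
  assumes "bounded_borel f" "bounded_borel g"
  shows "bounded_borel (\<lambda>x. f x + g x)"
proof -
  from assms obtain A B where AB: "\<forall>x\<in>{0..1}. \<bar>f x\<bar> \<le> A" "\<forall>x\<in>{0..1}. \<bar>g x\<bar> \<le> B"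
    by (auto simp: bounded_borel_def)
  have "\<bar>f x + g x\<bar> \<le> A + B" if "x \<in> {0..1}" for x
    using AB[rule_format, OF that] by linarith
  with assms show ?thesis by (intro bounded_borelI[of _ "A + B"]) (auto simp: bounded_borel_def)
qed

lemma bounded_borel_mult [intro]:
  assumes "bounded_borel f" "bounded_borel g"
  shows "bounded_borel (\<lambda>x. f x * g x)"
proof -
  from assms obtain A B where AB: "\<forall>x\<in>{0..1}. \<bar>f x\<bar> \<le> A" "\<forall>x\<in>{0..1}. \<bar>g x\<bar> \<le> B"
    by (auto simp: bounded_borel_def)
  have "\<bar>f x * g x\<bar> \<le> A * B" if "x \<in> {0..1}" for x
    unfolding abs_mult using AB[rule_format, OF that] by (intro mult_mono') auto
  with assms show ?thesis by (intro bounded_borelI[of _ "A * B"]) (auto simp: bounded_borel_def)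
qed

lemma bounded_borel_diff [intro]:
  assumes "bounded_borel f" "bounded_borel g"
  shows "bounded_borel (\<lambda>x. f x - g x)"
  using bounded_borel_add[OF assms(1) bounded_borel_mult[OF bounded_borel_const[of "-1"] assms(2)]] by simp

lemma bounded_borel_indicator [intro]:
  "A \<in> sets borel \<Longrightarrow> bounded_borel (indicator A)"
  by (rule bounded_borelI[of _ 1]) (auto intro!: measurable_restrict_space1 simp: indicator_def)

lemma bounded_borel_integrable: "bounded_borel f \<Longrightarrow> integrable unit_measure f"
proof -
  interpret prob_space unit_measure by (rule prob_space_unit_measure)
  assume "bounded_borel f"
  then obtain B where "f \<in> borel_measurable unit_measure" "\<forall>x\<in>{0..1}. \<bar>f x\<bar> \<le> B"
    by (auto simp: bounded_borel_def)
  then show ?thesis by (intro integrable_const_bound[of _ B]) auto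
qed

lemma bounded_borel_set_integrable:
  assumes "bounded_borel f" "A \<in> sets borel" "A \<subseteq> {0..1}"
  shows "set_integrable lborel A f"
proof -
  have "integrable unit_measure f" by (rule bounded_borel_integrable) fact
  then have "set_integrable lborel {0..1} f"
    by (subst (asm) integrable_restrict_space) (auto simp: set_integrable_def)
  then show ?thesis by (rule set_integrable_subset) (use assms in auto)
qed

lemma integral_unit_measure:
  fixes f :: "real \<Rightarrow> real"
  shows "integral\<^sup>L unit_measure f = (LBINT x. f x * indicator {0..1} x)"
  by (subst integral_restrict_space) (auto simp: mult.commute)

lemma integral_unit_mono:
  assumes "bounded_borel f" "bounded_borel g" "\<And>x. x \<in> {0..1} \<Longrightarrow> f x \<le> g x"
  shows "integral\<^sup>L unit_measure f \<le> integral\<^sup>L unit_measure g"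
  using assms by (intro integral_mono bounded_borel_integrable) auto

lemma integral_unit_const [simp]: "integral\<^sup>L unit_measure (\<lambda>_. c) = (c :: real)"
proof -
  interpret prob_space unit_measure by (rule prob_space_unit_measure)
  show ?thesis using prob_space by simp
qed

lemma measure_unit_full [simp]: "measure unit_measure {0..1} = 1"
  using prob_space.prob_space[OF prob_space_unit_measure] by simp

section \<open>The map, its two branches and its transfer operator\<close>

locale manneville_pomeau =
  fixes \<alpha> :: real
  assumes alpha_pos: "0 < \<alpha>"
begin

abbreviation T :: "real \<Rightarrow> real" where "T \<equiv> MP \<alpha>"

text \<open>The absolute value makes \<open>left\<close> differentiable at 0 from both sides, as required by
  \<open>integral_substitution\<close>.\<close>

definition left :: "real \<Rightarrow> real" where
  "left x = x * (1 + 2 powr \<alpha> * \<bar>x\<bar> powr \<alpha>)"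

definition left' :: "real \<Rightarrow> real" where
  "left' x = 1 + (1 + \<alpha>) * (2 powr \<alpha> * x powr \<alpha>)"

definition L :: "real \<Rightarrow> real" where
  "L = inv_into {0..1/2} left"

lemma T_left: "0 \<le> x \<Longrightarrow> x < 1/2 \<Longrightarrow> T x = left x"
  by (simp add: MP_def left_def)

lemma T_right: "1/2 \<le> x \<Longrightarrow> T x = 2 * x - 1"
  by (simp add: MP_def)

lemma left_0 [simp]: "left 0 = 0" by (simp add: left_def)

lemma left_half: "left (1/2) = 1"
  using powr_mult[of 2 "1/2" \<alpha>] by (simp add: left_def)

lemma left_strict_mono: "0 \<le> x \<Longrightarrow> x < y \<Longrightarrow> left x < left y"
  unfolding left_def using alpha_pos
  by (intro mult_strict_mono') (auto intro!: add_pos_nonneg powr_less_mono2)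

lemma left_mono: "0 \<le> x \<Longrightarrow> x \<le> y \<Longrightarrow> left x \<le> left y"
  using left_strict_mono[of x y] by (cases "x = y") auto

lemma left_inj: "inj_on left {0..1/2}"
  by (rule inj_onI) (metis atLeastAtMost_iff left_strict_mono less_irrefl linorder_neqE_linordered_idom)

lemma left'_ge_1: "1 \<le> left' x"
  using alpha_pos by (simp add: left'_def)

lemma left'_mono: "0 \<le> x \<Longrightarrow> x \<le> y \<Longrightarrow> left' x \<le> left' y"
  using alpha_pos by (auto simp: left'_def intro!: mult_left_mono powr_mono2)

lemma left_deriv:
  assumes "0 \<le> x"
  shows "(left has_real_derivative left' x) (at x)"
proof (cases "x = 0")
  case True
  have "((\<lambda>h. 1 + 2 powr \<alpha> * \<bar>h\<bar> powr \<alpha>) \<longlongrightarrow> 1 + 2 powr \<alpha> * 0) (at 0)"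
    using alpha_pos
    by (intro tendsto_intros tendsto_zero_powrI[where b = \<alpha>])
      (auto intro!: tendsto_rabs_zero tendsto_ident_at)
  then have "((\<lambda>h. (left h - left 0) / (h - 0)) \<longlongrightarrow> 1 + 2 powr \<alpha> * 0) (at 0)"
    by (rule Lim_transform_eventually) (auto simp: left_def eventually_at_filter)
  then show ?thesis using True alpha_pos by (simp add: has_field_derivative_iff left'_def)
next
  case False
  with assms have x: "0 < x" by simp
  have "((\<lambda>x. x * (1 + 2 powr \<alpha> * x powr \<alpha>)) has_real_derivative left' x) (at x)"
    using x by (auto intro!: derivative_eq_intros simp: left'_def powr_diff field_simps)
  then show ?thesis
    by (rule has_field_derivative_transform_within_open[of _ _ _ "{0<..}"])
      (use x in \<open>auto simp: left_def\<close>)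
qed

lemma left_image: "left ` {0..1/2} = {0..1}"
proof
  show "left ` {0..1/2} \<subseteq> {0..1}"
    using left_mono[of 0] left_mono[of _ "1/2"] left_half by auto
  show "{0..1} \<subseteq> left ` {0..1/2}"
  proof
    fix y :: real assume "y \<in> {0..1}"
    then have "\<exists>x\<ge>0. x \<le> 1/2 \<and> left x = y"
      using left_deriv left_half
      by (intro IVT) (auto intro: DERIV_isCont)
    then show "y \<in> left ` {0..1/2}" by auto
  qed
qed

lemma L_range: "y \<in> {0..1} \<Longrightarrow> 0 \<le> L y \<and> L y \<le> 1/2"
  using inv_into_into[of y left "{0..1/2}"] by (simp add: left_image L_def)

lemma left_L: "y \<in> {0..1} \<Longrightarrow> left (L y) = y"
  using f_inv_into_f[of y left "{0..1/2}"] by (simp add: left_image L_def)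

lemma L_left: "x \<in> {0..1/2} \<Longrightarrow> L (left x) = x"
  using left_inj by (simp add: L_def)

lemma L_mono: "0 \<le> x \<Longrightarrow> x \<le> y \<Longrightarrow> y \<le> 1 \<Longrightarrow> L x \<le> L y"
  using left_strict_mono[of "L y" "L x"] L_range[of x] L_range[of y] left_L[of x] left_L[of y]
  by force

lemma L_1 [simp]: "L 1 = 1/2"
  using L_left[of "1/2"] by (simp add: left_half)

lemma L_pos: "0 < y \<Longrightarrow> y \<le> 1 \<Longrightarrow> 0 < L y"
  using L_range[of y] left_L[of y] by (cases "L y = 0") auto

lemma L_le: "y \<in> {0..1} \<Longrightarrow> L y \<le> y"
  using left_L[of y] L_range[of y] mult_left_mono[of 1 "1 + 2 powr \<alpha> * \<bar>L y\<bar> powr \<alpha>" "L y"]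
  by (simp add: left_def)

lemma less_L_iff: "x \<in> {0..1/2} \<Longrightarrow> y \<in> {0..1} \<Longrightarrow> x < L y \<longleftrightarrow> left x < y"
  using left_strict_mono[of x "L y"] left_mono[of "L y" x] L_range[of y] left_L[of y]
  by force

definition PL :: "(real \<Rightarrow> real) \<Rightarrow> real \<Rightarrow> real" where
  "PL f x = f (L x) / left' (L x)"

definition PR :: "(real \<Rightarrow> real) \<Rightarrow> real \<Rightarrow> real" where
  "PR f x = f ((x + 1) / 2) / 2"

definition P :: "(real \<Rightarrow> real) \<Rightarrow> real \<Rightarrow> real" where
  "P f x = PL f x + PR f x"

text \<open>The cone of Liverani, Saussol and Vaienti.\<close>

definition cone :: "(real \<Rightarrow> real) \<Rightarrow> bool" where
  "cone f \<longleftrightarrow> (\<forall>x\<in>{0..1}. 0 \<le> f x) \<and> antimono_on {0..1} f \<and>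
     (\<forall>x y. 0 < x \<longrightarrow> x \<le> y \<longrightarrow> y \<le> 1 \<longrightarrow> x powr (1 + \<alpha>) * f x \<le> y powr (1 + \<alpha>) * f y)"

lemma coneI:
  assumes "\<And>x. 0 \<le> x \<Longrightarrow> x \<le> 1 \<Longrightarrow> 0 \<le> f x"
    "\<And>x y. 0 \<le> x \<Longrightarrow> x \<le> y \<Longrightarrow> y \<le> 1 \<Longrightarrow> f y \<le> f x"
    "\<And>x y. 0 < x \<Longrightarrow> x \<le> y \<Longrightarrow> y \<le> 1 \<Longrightarrow> x powr (1 + \<alpha>) * f x \<le> y powr (1 + \<alpha>) * f y"
  shows "cone f"
  using assms by (auto simp: cone_def monotone_on_def)

lemma coneD:
  assumes "cone f"
  shows "0 \<le> x \<Longrightarrow> x \<le> 1 \<Longrightarrow> 0 \<le> f x"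
    "0 \<le> x \<Longrightarrow> x \<le> y \<Longrightarrow> y \<le> 1 \<Longrightarrow> f y \<le> f x"
    "0 < x \<Longrightarrow> x \<le> y \<Longrightarrow> y \<le> 1 \<Longrightarrow> x powr (1 + \<alpha>) * f x \<le> y powr (1 + \<alpha>) * f y"
  using assms by (auto simp: cone_def monotone_on_def)

lemma cone_const [intro, simp]: "0 \<le> c \<Longrightarrow> cone (\<lambda>_. c)"
  using alpha_pos by (intro coneI) (auto intro!: mult_right_mono powr_mono2)

lemma cone_add: "cone f \<Longrightarrow> cone g \<Longrightarrow> cone (\<lambda>x. f x + g x)"
  unfolding cone_def monotone_on_def distrib_left
  by (intro conjI ballI allI impI add_mono add_nonneg_nonneg) blast+

lemma cone_upper:
  assumes "cone f" "0 < x" "x \<le> 1"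
  shows "f x \<le> x powr (- 1 - \<alpha>) * f 1"
proof -
  have "x powr (- 1 - \<alpha>) * (x powr (1 + \<alpha>) * f x) \<le> x powr (- 1 - \<alpha>) * f 1"
    using coneD(3)[of f x 1] assms by (intro mult_left_mono) auto
  then show ?thesis using assms by (simp add: mult.assoc[symmetric] powr_add[symmetric])
qed

lemma half_powr: "(1/2 :: real) powr (- 1 - \<alpha>) = 2 powr (1 + \<alpha>)"
  using powr_divide[of 1 2 "- 1 - \<alpha>"] powr_minus_divide[of 2 "- 1 - \<alpha>"] by (simp add: add.commute)

lemma cone_upper_half:
  assumes "cone f" "1/2 \<le> x" "x \<le> 1"
  shows "f x \<le> 2 powr (1 + \<alpha>) * f 1"
proof -
  have "f x \<le> f (1/2)" using assms by (intro coneD(2)[OF assms(1)]) auto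
  also have "\<dots> \<le> (1/2) powr (- 1 - \<alpha>) * f 1" by (rule cone_upper[OF assms(1)]) auto
  finally show ?thesis unfolding half_powr .
qed

lemma cone_bounded_borel:
  assumes "cone f"
  shows "bounded_borel f"
proof (rule bounded_borelI[of _ "f 0"])
  have "mono_on {0..1} (\<lambda>x. - f x)"
    using coneD(2)[OF assms] by (auto simp: monotone_on_def)
  then have "(\<lambda>x. - f x) \<in> borel_measurable (restrict_space borel {0..1})"
    by (rule borel_measurable_mono_on_fnc)
  then have "f \<in> borel_measurable (restrict_space borel {0..1})" by simp
  then show "f \<in> borel_measurable unit_measure"
    by (simp cong: measurable_cong_sets add: sets_restrict_space)
qed (use coneD[OF assms] in auto)

text \<open>Factor \<open>x\<close> as \<open>2 * x / (x + 1)\<close> times the preimage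
  \<open>(x + 1) / 2\<close>: the first factor increases, and the second is paired with
  \<open>f\<close> at that preimage.\<close>

lemma cone_PR:
  assumes "cone f"
  shows "cone (PR f)"
proof (rule coneI)
  fix x y :: real assume xy: "0 < x" "x \<le> y" "y \<le> 1"
  have "x powr (1 + \<alpha>) * f ((x + 1) / 2)
    = (2 * x / (x + 1)) powr (1 + \<alpha>) * (((x + 1) / 2) powr (1 + \<alpha>) * f ((x + 1) / 2))"
    using xy by (simp add: powr_mult powr_divide)
  also have "\<dots> \<le> (2 * y / (y + 1)) powr (1 + \<alpha>) * (((y + 1) / 2) powr (1 + \<alpha>) * f ((y + 1) / 2))"
  proof (rule mult_mono)
    show "(2 * x / (x + 1)) powr (1 + \<alpha>) \<le> (2 * y / (y + 1)) powr (1 + \<alpha>)"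
      using xy alpha_pos by (intro powr_mono2) (auto simp: field_simps)
    show "((x + 1) / 2) powr (1 + \<alpha>) * f ((x + 1) / 2) \<le> ((y + 1) / 2) powr (1 + \<alpha>) * f ((y + 1) / 2)"
      using xy by (intro coneD(3)[OF assms]) auto
  qed (use xy coneD(1)[OF assms, of "(x + 1) / 2"] in auto)
  also have "\<dots> = y powr (1 + \<alpha>) * f ((y + 1) / 2)"
    using xy by (simp add: powr_mult powr_divide)
  finally show "x powr (1 + \<alpha>) * PR f x \<le> y powr (1 + \<alpha>) * PR f y" by (simp add: PR_def)
qed (use coneD[OF assms] in \<open>auto simp: PR_def\<close>)

text \<open>With \<open>s = 2 powr \<alpha> * y powr \<alpha>\<close> one has
  \<open>left y = y * (1 + s)\<close> and \<open>left' y = 1 + (1 + \<alpha>) * s\<close>, so this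
  quotient is what the left branch adds to the weighted density. A smaller power of
  \<open>1 + s\<close> would make it decrease near \<open>s = 0\<close>, which explains the exponent
  \<open>1 + \<alpha>\<close> of the cone.\<close>

lemma one_plus_powr_over_linear_mono:
  fixes s t :: real
  assumes "0 \<le> s" "s \<le> t"
  shows "(1 + s) powr (1 + \<alpha>) / (1 + (1 + \<alpha>) * s) \<le> (1 + t) powr (1 + \<alpha>) / (1 + (1 + \<alpha>) * t)"
proof (rule DERIV_nonneg_imp_nondecreasing[OF assms(2)])
  fix x assume "s \<le> x" "x \<le> t"
  then have x: "0 \<le> x" using assms by simp
  have pos: "0 < 1 + (1 + \<alpha>) * x" using x alpha_pos by (intro add_pos_nonneg) auto
  define d where "d = ((1 + \<alpha>) * (1 + x) powr \<alpha> * (1 + (1 + \<alpha>) * x) - (1 + x) powr (1 + \<alpha>) * (1 + \<alpha>)) /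
     (1 + (1 + \<alpha>) * x)\<^sup>2"
  have "((\<lambda>s. (1 + s) powr (1 + \<alpha>) / (1 + (1 + \<alpha>) * s)) has_real_derivative d) (at x)"
    unfolding d_def
  proof (rule DERIV_cong[OF DERIV_divide])
    show "((\<lambda>s. (1 + s) powr (1 + \<alpha>)) has_real_derivative (1 + \<alpha>) * (1 + x) powr (1 + \<alpha> - real 1) * 1) (at x)"
      using x by (intro DERIV_fun_powr) (auto intro!: derivative_eq_intros)
    show "((\<lambda>s. 1 + (1 + \<alpha>) * s) has_real_derivative 1 + \<alpha>) (at x)"
      by (auto intro!: derivative_eq_intros)
  qed (use pos in \<open>auto simp: power2_eq_square\<close>)
  moreover have "0 \<le> d"
  proof -
    have "(1 + x) powr (1 + \<alpha>) * (1 + \<alpha>) = (1 + \<alpha>) * (1 + x) powr \<alpha> * (1 + x)"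
      using x by (simp add: powr_add)
    also have "\<dots> \<le> (1 + \<alpha>) * (1 + x) powr \<alpha> * (1 + (1 + \<alpha>) * x)"
      using x alpha_pos by (intro mult_left_mono) (auto simp: algebra_simps)
    finally show ?thesis by (simp add: d_def)
  qed
  ultimately show "\<exists>y. ((\<lambda>s. (1 + s) powr (1 + \<alpha>) / (1 + (1 + \<alpha>) * s)) has_real_derivative y) (at x) \<and> 0 \<le> y"
    by blast
qed

lemma cone_PL:
  assumes "cone f"
  shows "cone (PL f)"
proof (rule coneI)
  fix x :: real assume "0 \<le> x" "x \<le> 1"
  then show "0 \<le> PL f x" using L_range[of x] left'_ge_1[of "L x"]
    by (auto simp: PL_def intro!: divide_nonneg_nonneg coneD(1)[OF assms])
next
  fix x y :: real assume xy: "0 \<le> x" "x \<le> y" "y \<le> 1"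
  then have "0 \<le> L x" "L x \<le> L y" "L y \<le> 1/2" using L_range L_mono by auto
  then show "PL f y \<le> PL f x" using left'_ge_1[of "L x"]
    by (auto simp: PL_def intro!: frac_le coneD[OF assms] left'_mono)
next
  fix x y :: real assume xy: "0 < x" "x \<le> y" "y \<le> 1"
  have eq: "z powr (1 + \<alpha>) * PL f z = (1 + 2 powr \<alpha> * L z powr \<alpha>) powr (1 + \<alpha>) /
     (1 + (1 + \<alpha>) * (2 powr \<alpha> * L z powr \<alpha>)) * (L z powr (1 + \<alpha>) * f (L z))" if "0 < z" "z \<le> 1" for z
  proof -
    have "z = L z * (1 + 2 powr \<alpha> * L z powr \<alpha>)"
      using left_L[of z] L_range[of z] that by (simp add: left_def)
    then have "z powr (1 + \<alpha>) = L z powr (1 + \<alpha>) * (1 + 2 powr \<alpha> * L z powr \<alpha>) powr (1 + \<alpha>)"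
      by (metis powr_mult)
    then show ?thesis by (simp add: PL_def left'_def)
  qed
  have L: "0 < L x" "L x \<le> L y" "L y \<le> 1/2" using L_range[of y] L_mono L_pos xy by auto
  have "(1 + 2 powr \<alpha> * L x powr \<alpha>) powr (1 + \<alpha>) /
     (1 + (1 + \<alpha>) * (2 powr \<alpha> * L x powr \<alpha>)) * (L x powr (1 + \<alpha>) * f (L x)) \<le>
     (1 + 2 powr \<alpha> * L y powr \<alpha>) powr (1 + \<alpha>) /
     (1 + (1 + \<alpha>) * (2 powr \<alpha> * L y powr \<alpha>)) * (L y powr (1 + \<alpha>) * f (L y))"
  proof (rule mult_mono)
    show "(1 + 2 powr \<alpha> * L x powr \<alpha>) powr (1 + \<alpha>) / (1 + (1 + \<alpha>) * (2 powr \<alpha> * L x powr \<alpha>))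
      \<le> (1 + 2 powr \<alpha> * L y powr \<alpha>) powr (1 + \<alpha>) / (1 + (1 + \<alpha>) * (2 powr \<alpha> * L y powr \<alpha>))"
      using L alpha_pos by (intro one_plus_powr_over_linear_mono mult_left_mono powr_mono2) auto
    show "L x powr (1 + \<alpha>) * f (L x) \<le> L y powr (1 + \<alpha>) * f (L y)"
      using L by (intro coneD(3)[OF assms]) auto
  qed (use L alpha_pos coneD(1)[OF assms, of "L x"] in auto)
  then show "x powr (1 + \<alpha>) * PL f x \<le> y powr (1 + \<alpha>) * PL f y"
    using xy by (simp only: eq)
qed

lemma cone_P: "cone f \<Longrightarrow> cone (P f)"
  unfolding P_def by (intro cone_add cone_PL cone_PR)

lemma cone_PL_iter: "cone f \<Longrightarrow> cone ((PL ^^ n) f)"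
  by (induction n) (auto intro: cone_PL)

lemma cone_P_iter: "cone f \<Longrightarrow> cone ((P ^^ n) f)"
  by (induction n) (auto intro: cone_P)

lemma T_measurable [measurable]: "T \<in> borel_measurable borel"
  unfolding MP_def by measurable

lemma T_range: "x \<in> {0..1} \<Longrightarrow> T x \<in> {0..1}"
proof (cases "x < 1/2")
  case True
  assume "x \<in> {0..1}"
  then have "left x \<in> left ` {0..1/2}" using True by auto
  then show ?thesis using True \<open>x \<in> {0..1}\<close> by (simp add: left_image T_left)
qed (auto simp: T_right)

lemma T_iter_range: "x \<in> {0..1} \<Longrightarrow> (T ^^ n) x \<in> {0..1}"
  by (induction n) (use T_range in auto)

lemma T_measurable_unit [measurable]: "T \<in> measurable unit_measure unit_measure"
  using T_range by (intro measurable_restrict_space3) (auto simp: Pi_iff)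

lemma T_iter_measurable_unit [measurable]: "(T ^^ n) \<in> measurable unit_measure unit_measure"
  by (rule measurable_compose_n) simp

lemma bounded_borel_T:
  assumes "bounded_borel \<theta>"
  shows "bounded_borel (\<lambda>x. \<theta> (T x))"
proof -
  from assms obtain B where "\<theta> \<in> borel_measurable unit_measure" "\<forall>x\<in>{0..1}. \<bar>\<theta> x\<bar> \<le> B"
    by (auto simp: bounded_borel_def)
  then show ?thesis using T_range
    by (intro bounded_borelI[of _ B] measurable_compose[OF T_measurable_unit]) auto
qed

lemma bounded_borel_T_iter: "bounded_borel \<theta> \<Longrightarrow> bounded_borel (\<lambda>x. \<theta> ((T ^^ n) x))"
  by (induction n arbitrary: \<theta>) (auto dest: bounded_borel_T)

lemma integral_PR:
  assumes f: "cone f" and \<theta>: "bounded_borel \<theta>"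
  shows "(\<integral>x. PR f x * \<theta> x \<partial>unit_measure) = (\<integral>x. f x * (indicator {1/2..} x * \<theta> (T x)) \<partial>unit_measure)"
proof -
  define F where "F x = f x * \<theta> (T x)" for x
  have "bounded_borel F" unfolding F_def
    by (intro bounded_borel_mult cone_bounded_borel f bounded_borel_T \<theta>)
  then have "set_integrable lborel {1/2..1} F" by (rule bounded_borel_set_integrable) auto
  then have "(LBINT x. F x * indicator {(0 + 1) / 2..(1 + 1) / 2} x) =
      (LBINT x. F ((x + 1) / 2) * (1/2) * indicator {0..1} x)"
    by (intro integral_substitution(2)[where g = "\<lambda>x. (x + 1) / 2"])
      (auto intro!: derivative_eq_intros)
  also have "\<dots> = (LBINT x. (PR f x * \<theta> x) * indicator {0..1} x)"
  proof (rule Bochner_Integration.integral_cong)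
    show "F ((x + 1) / 2) * (1/2) * indicator {0..1} x = (PR f x * \<theta> x) * indicator {0..1} x" for x
    proof -
      have "(2 * x + 2) / 2 - 1 = x" by (simp add: field_simps)
      then show ?thesis by (simp add: F_def PR_def T_right indicator_def)
    qed
  qed simp
  also have "(LBINT x. F x * indicator {(0 + 1) / 2..(1 + 1) / 2} x) =
    (LBINT x. (f x * (indicator {1/2..} x * \<theta> (T x))) * indicator {0..1} x)"
    by (intro Bochner_Integration.integral_cong) (auto simp: F_def indicator_def)
  finally show ?thesis by (simp add: integral_unit_measure)
qed

text \<open>Substitution along \<open>left\<close>. The point 1/2 lies in the closed domain of
  \<open>left\<close> but is sent to 0 by the right branch, so the integrands agree only almost
  everywhere.\<close>

lemma integral_PL:
  assumes f: "cone f" and \<theta>: "bounded_borel \<theta>"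
  shows "(\<integral>x. PL f x * \<theta> x \<partial>unit_measure) = (\<integral>x. f x * (indicator {..<1/2} x * \<theta> (T x)) \<partial>unit_measure)"
proof -
  define F where "F x = PL f x * \<theta> x" for x
  have "bounded_borel F" unfolding F_def
    by (intro bounded_borel_mult cone_bounded_borel cone_PL f \<theta>)
  then have "set_integrable lborel {left 0..left (1/2)} F" unfolding left_0 left_half
    by (rule bounded_borel_set_integrable) auto
  then have "(LBINT x. F x * indicator {left 0..left (1/2)} x) =
      (LBINT x. F (left x) * left' x * indicator {0..1/2} x)"
  proof (intro integral_substitution(2))
    show "continuous_on {0..1/2} left'" unfolding left'_def
      using alpha_pos by (intro continuous_intros continuous_on_powr') auto
    show "0 \<le> left' x" for x using left'_ge_1[of x] by simp
  qed (auto intro: left_deriv)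
  also have "\<dots> = (LBINT x. (f x * (indicator {..<1/2} x * \<theta> (T x))) * indicator {0..1} x)"
  proof (rule integral_cong_AE)
    have eq: "F (left x) * left' x * indicator {0..1/2} x
      = (f x * (indicator {..<1/2} x * \<theta> (T x))) * indicator {0..1} x" if "x \<noteq> 1/2" for x
      using left'_ge_1[of x] that
      by (auto simp: F_def PL_def L_left T_left indicator_def)
    then show "AE x in lborel. F (left x) * left' x * indicator {0..1/2} x
      = (f x * (indicator {..<1/2} x * \<theta> (T x))) * indicator {0..1} x"
      by (rule eventually_mono[OF AE_lborel_singleton[of "1/2 :: real"]])
    have "set_integrable lborel {0..1} (\<lambda>x. f x * (indicator {..<1/2} x * \<theta> (T x)))"
      by (intro bounded_borel_set_integrable bounded_borel_mult bounded_borel_indicator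
          bounded_borel_T \<theta> cone_bounded_borel[OF f]) auto
    then show m: "(\<lambda>x. (f x * (indicator {..<1/2} x * \<theta> (T x))) * indicator {0..1} x) \<in> borel_measurable lborel"
      by (auto simp: set_integrable_def mult.commute dest: borel_measurable_integrable)
    \<comment> \<open>Measurability of the composition with \<open>left\<close> is inherited from
      the other integrand, from which it differs in a single point.\<close>
    have "(\<lambda>x. F (left x) * left' x * indicator {0..1/2} x) =
      (\<lambda>x. if x = 1/2 then F (left (1/2)) * left' (1/2) else (f x * (indicator {..<1/2} x * \<theta> (T x))) * indicator {0..1} x)"
    proof
      show "F (left x) * left' x * indicator {0..1/2} x =
        (if x = 1/2 then F (left (1/2)) * left' (1/2)
         else (f x * (indicator {..<1/2} x * \<theta> (T x))) * indicator {0..1} x)" for x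
      proof (cases "x = 1/2")
        case True
        show ?thesis unfolding True by simp
      qed (use eq[of x] in auto)
    qed
    also have "\<dots> \<in> borel_measurable lborel" using m by simp
    finally show "(\<lambda>x. F (left x) * left' x * indicator {0..1/2} x) \<in> borel_measurable lborel" .
  qed
  finally show ?thesis by (simp add: integral_unit_measure F_def left_half)
qed

lemma integral_P:
  assumes f: "cone f" and \<theta>: "bounded_borel \<theta>"
  shows "(\<integral>x. P f x * \<theta> x \<partial>unit_measure) = (\<integral>x. f x * \<theta> (T x) \<partial>unit_measure)"
proof -
  have "(\<integral>x. P f x * \<theta> x \<partial>unit_measure) = (\<integral>x. PL f x * \<theta> x + PR f x * \<theta> x \<partial>unit_measure)"
    by (simp add: P_def distrib_right)
  also have "\<dots> = (\<integral>x. PL f x * \<theta> x \<partial>unit_measure) + (\<integral>x. PR f x * \<theta> x \<partial>unit_measure)"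
    by (intro Bochner_Integration.integral_add bounded_borel_integrable bounded_borel_mult
        cone_bounded_borel cone_PL cone_PR f \<theta>)
  also have "\<dots> = (\<integral>x. f x * (indicator {..<1/2} x * \<theta> (T x)) + f x * (indicator {1/2..} x * \<theta> (T x)) \<partial>unit_measure)"
    unfolding integral_PL[OF f \<theta>] integral_PR[OF f \<theta>]
    by (intro Bochner_Integration.integral_add[symmetric] bounded_borel_integrable bounded_borel_mult
        cone_bounded_borel f bounded_borel_T \<theta> bounded_borel_indicator) auto
  also have "\<dots> = (\<integral>x. f x * \<theta> (T x) \<partial>unit_measure)"
    by (intro Bochner_Integration.integral_cong) (auto simp: indicator_def)
  finally show ?thesis .
qed

lemma integral_P_iter:
  assumes "cone f" "bounded_borel \<theta>"
  shows "(\<integral>x. (P ^^ n) f x * \<theta> x \<partial>unit_measure) = (\<integral>x. f x * \<theta> ((T ^^ n) x) \<partial>unit_measure)"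
  using assms
proof (induction n arbitrary: \<theta>)
  case (Suc n)
  have "(\<integral>x. (P ^^ Suc n) f x * \<theta> x \<partial>unit_measure) = (\<integral>x. (P ^^ n) f x * \<theta> (T x) \<partial>unit_measure)"
    using Suc.prems by (simp add: integral_P cone_P_iter)
  also have "\<dots> = (\<integral>x. f x * \<theta> (T ((T ^^ n) x)) \<partial>unit_measure)"
    using Suc.prems by (intro Suc.IH bounded_borel_T)
  finally show ?case by simp
qed simp

end


section \<open>Excursions near the indifferent fixed point\<close>

text \<open>Write the power as \<open>exp (- y)\<close> with \<open>y = p * ln (1 + s)\<close> and
  use \<open>y / (1 + y) \<le> 1 - exp (- y) \<le> y\<close>. The factor 1/2 comes from
  \<open>s / 2 \<le> ln (1 + s)\<close> on \<open>[0, 1]\<close>, the factor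
  \<open>1 / (1 + p)\<close> from \<open>y \<le> p\<close>.\<close>

lemma one_minus_powr_bounds:
  fixes s p :: real
  assumes "0 < s" "s \<le> 1" "0 < p"
  shows "p / (2 * (1 + p)) * s \<le> 1 - (1 + s) powr - p" "1 - (1 + s) powr - p \<le> p * s"
proof -
  define y where "y = p * ln (1 + s)"
  have eq: "(1 + s) powr - p = exp (- y)" using assms by (simp add: powr_def y_def)
  have "ln (1 + s) \<le> s" using assms by (intro ln_add_one_self_le_self) auto
  then have y1: "y \<le> p * s" unfolding y_def using assms by (intro mult_left_mono) auto
  have "s - s\<^sup>2 / 2 \<le> ln (1 + s)"
  proof -
    have "ln (1 + 0) - (0 - 0\<^sup>2 / 2) \<le> ln (1 + s) - (s - s\<^sup>2 / 2)"
    proof (rule DERIV_nonneg_imp_nondecreasing[of 0 s "\<lambda>x. ln (1 + x) - (x - x\<^sup>2 / 2)"])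
      fix x :: real assume "0 \<le> x"
      then have "((\<lambda>x. ln (1 + x) - (x - x\<^sup>2 / 2)) has_real_derivative (1 / (1 + x) - (1 - x))) (at x)"
        "0 \<le> 1 / (1 + x) - (1 - x)"
        by (auto intro!: derivative_eq_intros simp: field_simps)
      then show "\<exists>y. ((\<lambda>x. ln (1 + x) - (x - x\<^sup>2 / 2)) has_real_derivative y) (at x) \<and> 0 \<le> y"
        by blast
    qed (use assms in simp)
    then show ?thesis by simp
  qed
  moreover have "s\<^sup>2 \<le> s" using assms by (simp add: power2_eq_square mult_left_le)
  ultimately have "s / 2 \<le> ln (1 + s)" by simp
  then have y2: "p * (s / 2) \<le> y" unfolding y_def using assms by (intro mult_left_mono) auto
  have y0: "0 \<le> y" using y2 assms by (meson divide_nonneg_pos less_imp_le mult_nonneg_nonneg order_trans zero_less_numeral)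
  have yp: "y \<le> p" using y1 assms by (meson mult_left_le less_imp_le order_trans)
  show "1 - (1 + s) powr - p \<le> p * s"
    using exp_ge_add_one_self[of "- y"] y1 by (simp add: eq)
  have "exp (- y) \<le> 1 / (1 + y)"
    using exp_ge_add_one_self[of y] y0 by (simp add: exp_minus field_simps)
  moreover have "1 - 1 / (1 + y) = y / (1 + y)" using y0 by (simp add: field_simps)
  moreover have "y / (1 + p) \<le> y / (1 + y)" using y0 yp by (intro divide_left_mono) auto
  moreover have "(p * (s / 2)) / (1 + p) \<le> y / (1 + p)" using y2 assms by (intro divide_right_mono) auto
  moreover have "p / (2 * (1 + p)) * s = (p * (s / 2)) / (1 + p)" by simp
  ultimately show "p / (2 * (1 + p)) * s \<le> 1 - (1 + s) powr - p" by (simp add: eq)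
qed

context manneville_pomeau
begin

text \<open>The points of \<open>[a (k + 1), a k)\<close> enter \<open>[1/2, 1]\<close> for the first time at time \<open>k\<close>.\<close>

definition a :: "nat \<Rightarrow> real" where "a k = (L ^^ k) 1"

lemma a_0 [simp]: "a 0 = 1" and a_Suc: "a (Suc k) = L (a k)"
  by (simp_all add: a_def)

lemma a_range: "0 < a k \<and> a k \<le> 1"
proof (induction k)
  case (Suc k)
  then show ?case using L_pos[of "a k"] L_range[of "a k"] by (auto simp: a_Suc)
qed simp

lemma a_pos: "0 < a k"
  using a_range by auto

lemma a_1: "a (Suc 0) = 1/2"
  by (simp add: a_Suc)

lemma a_le_half: "a (Suc k) \<le> 1/2"
  using L_range[of "a k"] a_range[of k] by (auto simp: a_Suc)

lemma left_a: "left (a (Suc k)) = a k"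
  using left_L[of "a k"] a_range[of k] by (auto simp: a_Suc)

lemma a_step: "a k = a (Suc k) * (1 + 2 powr \<alpha> * a (Suc k) powr \<alpha>)"
  using left_a[of k] a_pos[of "Suc k"] by (simp add: left_def)

lemma a_antimono: "i \<le> j \<Longrightarrow> a j \<le> a i"
proof (rule lift_Suc_antimono_le)
  show "a (Suc n) \<le> a n" for n
    using L_le[of "a n"] a_range[of n] by (auto simp: a_Suc)
qed

text \<open>In the coordinate \<open>x powr - \<alpha>\<close> the branch \<open>L\<close> is almost
  a translation: the increment is \<open>q * (1 - (1 + s) powr - \<alpha>)\<close>, where
  \<open>q * s\<close> is the constant \<open>2 powr \<alpha>\<close> and \<open>s \<le> 1\<close>
  because \<open>a (Suc k) \<le> 1 / 2\<close>.\<close>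

lemma a_powr_bounds:
  defines "c \<equiv> 2 powr \<alpha> * (\<alpha> / (2 * (1 + \<alpha>)))"
  shows "1 + c * real k \<le> a k powr - \<alpha>" "a k powr - \<alpha> \<le> 1 + 2 powr \<alpha> * \<alpha> * real k"
proof -
  have "1 + c * real k \<le> a k powr - \<alpha> \<and> a k powr - \<alpha> \<le> 1 + 2 powr \<alpha> * \<alpha> * real k"
  proof (induction k)
    case (Suc k)
    define q where "q = a (Suc k) powr - \<alpha>"
    define s where "s = 2 powr \<alpha> * a (Suc k) powr \<alpha>"
    have s0: "0 < s" using a_pos[of "Suc k"] by (simp add: s_def)
    have "s = (2 * a (Suc k)) powr \<alpha>" using a_pos[of "Suc k"] by (simp add: s_def powr_mult)
    also have "\<dots> \<le> 1 powr \<alpha>" using a_le_half[of k] a_pos[of "Suc k"] alpha_pos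
      by (intro powr_mono2) auto
    finally have s1: "s \<le> 1" by simp
    have qs: "q * s = 2 powr \<alpha>" using a_pos[of "Suc k"] by (simp add: q_def s_def powr_minus)
    have q0: "0 \<le> q" by (simp add: q_def)
    have "a k powr - \<alpha> = q * (1 + s) powr - \<alpha>"
      unfolding q_def s_def using a_step[of k] a_pos[of "Suc k"] by (metis powr_mult)
    then have eq: "q - a k powr - \<alpha> = q * (1 - (1 + s) powr - \<alpha>)" by (simp add: algebra_simps)
    have "q * (\<alpha> / (2 * (1 + \<alpha>)) * s) \<le> q - a k powr - \<alpha>" "q - a k powr - \<alpha> \<le> q * (\<alpha> * s)"
      unfolding eq by (rule mult_left_mono[OF one_minus_powr_bounds(1)[OF s0 s1 alpha_pos] q0]
          mult_left_mono[OF one_minus_powr_bounds(2)[OF s0 s1 alpha_pos] q0])+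
    moreover have "q * (\<alpha> / (2 * (1 + \<alpha>)) * s) = c" "q * (\<alpha> * s) = 2 powr \<alpha> * \<alpha>"
      unfolding c_def qs[symmetric] by simp_all
    ultimately have "c \<le> q - a k powr - \<alpha>" "q - a k powr - \<alpha> \<le> 2 powr \<alpha> * \<alpha>" by simp_all
    then show ?case using Suc by (simp add: q_def algebra_simps)
  qed simp
  then show "1 + c * real k \<le> a k powr - \<alpha>" "a k powr - \<alpha> \<le> 1 + 2 powr \<alpha> * \<alpha> * real k" by auto
qed

lemma a_eq_powr: "a k = (a k powr - \<alpha>) powr - (1 / \<alpha>)"
  using a_pos[of k] alpha_pos by (simp add: powr_powr)

lemma a_upper: "\<exists>C>0. \<forall>k. a k \<le> C * real (Suc k) powr - (1 / \<alpha>)"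
proof -
  define c where "c = min 1 (2 powr \<alpha> * (\<alpha> / (2 * (1 + \<alpha>))))"
  have c: "0 < c" using alpha_pos by (simp add: c_def)
  have "a k \<le> c powr - (1 / \<alpha>) * real (Suc k) powr - (1 / \<alpha>)" for k
  proof -
    have "c * real (Suc k) = c + c * real k" by (simp add: algebra_simps)
    also have "\<dots> \<le> 1 + 2 powr \<alpha> * (\<alpha> / (2 * (1 + \<alpha>))) * real k"
      by (intro add_mono mult_right_mono) (auto simp: c_def)
    also have "\<dots> \<le> a k powr - \<alpha>" by (rule a_powr_bounds(1))
    finally have "(a k powr - \<alpha>) powr - (1 / \<alpha>) \<le> (c * real (Suc k)) powr - (1 / \<alpha>)"
      using c alpha_pos by (intro powr_mono2') auto
    then show ?thesis using c by (subst a_eq_powr) (simp add: powr_mult)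
  qed
  then show ?thesis using c by (intro exI[of _ "c powr - (1 / \<alpha>)"]) auto
qed

lemma a_lower: "\<exists>C>0. \<forall>k. C * real (Suc k) powr - (1 / \<alpha>) \<le> a k"
proof -
  define c where "c = 1 + 2 powr \<alpha> * \<alpha>"
  have c: "0 < c" using alpha_pos by (simp add: c_def add_pos_nonneg)
  have "c powr - (1 / \<alpha>) * real (Suc k) powr - (1 / \<alpha>) \<le> a k" for k
  proof -
    have "a k powr - \<alpha> \<le> 1 + 2 powr \<alpha> * \<alpha> * real k" by (rule a_powr_bounds(2))
    also have "\<dots> \<le> c * real (Suc k)" using alpha_pos by (simp add: c_def algebra_simps)
    finally have "(c * real (Suc k)) powr - (1 / \<alpha>) \<le> (a k powr - \<alpha>) powr - (1 / \<alpha>)"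
      using c alpha_pos a_pos[of k] by (intro powr_mono2') auto
    then show ?thesis using c by (subst a_eq_powr) (simp add: powr_mult)
  qed
  then show ?thesis using c by (intro exI[of _ "c powr - (1 / \<alpha>)"]) auto
qed

lemma a_diff: "a k - a (Suc k) = 2 powr \<alpha> * a (Suc k) powr (1 + \<alpha>)"
  using a_step[of k] a_pos[of "Suc k"] by (simp add: powr_add algebra_simps)

text \<open>Two-sided bounds on \<open>a\<close> would not bound its differences; the equation of
  the branch does, since it expresses the difference exactly through
  \<open>a (Suc k) powr (1 + \<alpha>)\<close>. This supplies \<open>b_upper\<close>.\<close>

lemma a_diff_upper: "\<exists>C>0. \<forall>k. a k - a (Suc k) \<le> C * real (Suc k) powr (- 1 - 1 / \<alpha>)"
proof -
  obtain C where C: "0 < C" "\<And>k. a k \<le> C * real (Suc k) powr - (1 / \<alpha>)"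
    using a_upper by blast
  have "a k - a (Suc k) \<le> (2 powr \<alpha> * C powr (1 + \<alpha>)) * real (Suc k) powr (- 1 - 1 / \<alpha>)" for k
  proof -
    have "a (Suc k) \<le> C * real (Suc k) powr - (1 / \<alpha>)"
      using C(2)[of k] a_antimono[of k "Suc k"] by simp
    then have "a (Suc k) powr (1 + \<alpha>) \<le> (C * real (Suc k) powr - (1 / \<alpha>)) powr (1 + \<alpha>)"
      using a_pos[of "Suc k"] alpha_pos by (intro powr_mono2) auto
    also have "\<dots> = C powr (1 + \<alpha>) * real (Suc k) powr (- (1 / \<alpha>) * (1 + \<alpha>))"
      using C by (simp add: powr_mult powr_powr)
    also have "- (1 / \<alpha>) * (1 + \<alpha>) = - 1 - 1 / \<alpha>" using alpha_pos by (simp add: field_simps)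
    finally show ?thesis unfolding a_diff by (simp add: mult.assoc)
  qed
  then show ?thesis using C by (intro exI[of _ "2 powr \<alpha> * C powr (1 + \<alpha>)"]) auto
qed

lemma measure_unit:
  "A \<in> sets borel \<Longrightarrow> A \<subseteq> {0..1} \<Longrightarrow> measure unit_measure (A \<inter> {0..1}) = measure lborel A"
  by (subst measure_restrict_space) (auto simp: Int_absorb2)

text \<open>The right branch sees \<open>f\<close> only on \<open>[1/2, 1]\<close>, where the cone
  makes it comparable to \<open>f 1\<close>. Thus each passage through this branch is an approximate
  renewal.\<close>

lemma PR_bounds:
  assumes "cone f" "x \<in> {0..1}"
  shows "f 1 / 2 \<le> PR f x" "PR f x \<le> 2 powr \<alpha> * f 1"
proof -
  show "f 1 / 2 \<le> PR f x"
    using coneD(2)[OF assms(1), of "(x + 1) / 2" 1] assms(2) by (simp add: PR_def)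
  have "f ((x + 1) / 2) \<le> 2 powr (1 + \<alpha>) * f 1"
    using assms by (intro cone_upper_half) auto
  then show "PR f x \<le> 2 powr \<alpha> * f 1" by (simp add: PR_def powr_add)
qed

lemma integral_PR_bounds:
  assumes f: "cone f" and \<theta>: "bounded_borel \<theta>" "\<And>x. x \<in> {0..1} \<Longrightarrow> 0 \<le> \<theta> x"
  shows "f 1 / 2 * integral\<^sup>L unit_measure \<theta> \<le> (\<integral>x. PR f x * \<theta> x \<partial>unit_measure)"
    "(\<integral>x. PR f x * \<theta> x \<partial>unit_measure) \<le> 2 powr \<alpha> * f 1 * integral\<^sup>L unit_measure \<theta>"
  unfolding Bochner_Integration.integral_mult_right_zero[symmetric]
  using PR_bounds[OF f] \<theta>(2)
  by (intro integral_unit_mono bounded_borel_mult \<theta>(1) cone_bounded_borel cone_PR f bounded_borel_const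
      mult_right_mono; simp)+

lemma integral_cone_0:
  assumes "cone f"
  shows "(\<integral>x. f x * indicator {0..<a 0} x \<partial>unit_measure) = integral\<^sup>L unit_measure f"
proof -
  have "AE x in lborel. x \<in> {0..1} \<longrightarrow> f x * indicator {0..<a 0} x = f x"
    by (rule eventually_mono[OF AE_lborel_singleton[of "1 :: real"]]) auto
  then have "AE x in unit_measure. f x * indicator {0..<a 0} x = f x"
    by (subst AE_restrict_space_iff) auto
  moreover have "bounded_borel (\<lambda>x. f x * indicator {0..<a 0} x)"
    by (intro bounded_borel_mult cone_bounded_borel[OF assms] bounded_borel_indicator) auto
  ultimately show ?thesis using cone_bounded_borel[OF assms]
    by (intro integral_cong_AE) (auto simp: bounded_borel_def)
qed

lemma integral_PL_initial:
  assumes "cone f"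
  shows "(\<integral>x. PL f x * indicator {0..<a k} x \<partial>unit_measure) = (\<integral>x. f x * indicator {0..<a (Suc k)} x \<partial>unit_measure)"
proof -
  have "indicator {..<1/2} x * indicator {0..<a k} (T x) = (indicator {0..<a (Suc k)} x :: real)"
    if x: "x \<in> {0..1}" for x
  proof (cases "x < 1/2")
    case True
    then have "x < a (Suc k) \<longleftrightarrow> T x < a k"
      unfolding a_Suc using x a_range[of k] by (simp add: less_L_iff T_left)
    then show ?thesis using True x T_range[OF x] by (auto simp: indicator_def)
  next
    case False
    then show ?thesis using a_le_half[of k] by (auto simp: indicator_def)
  qed
  then show ?thesis
    by (subst integral_PL[OF assms]) (auto intro!: Bochner_Integration.integral_cong bounded_borel_indicator)
qed

lemma integral_PL_iter:
  assumes "cone f"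
  shows "integral\<^sup>L unit_measure ((PL ^^ n) f) = (\<integral>x. f x * indicator {0..<a n} x \<partial>unit_measure)"
proof -
  have "(\<integral>x. (PL ^^ n) f x * indicator {0..<a k} x \<partial>unit_measure) =
      (\<integral>x. f x * indicator {0..<a (n + k)} x \<partial>unit_measure)" for k
  proof (induction n arbitrary: k)
    case (Suc n)
    then show ?case using integral_PL_initial[OF cone_PL_iter[OF assms], of n k] by simp
  qed simp
  from this[of 0] show ?thesis using integral_cone_0[OF cone_PL_iter[OF assms], of n] by simp
qed

lemma measure_initial: "measure unit_measure ({0..<a k} \<inter> {0..1}) = a k"
  using a_range[of k] by (subst measure_unit) auto

definition J :: "nat \<Rightarrow> real set" where "J k = {a (Suc k)..<a k}"

lemma J_borel [simp]: "J k \<in> sets borel" by (simp add: J_def)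

lemma indicator_J: "x \<in> {0..1} \<Longrightarrow> indicator (J k) x = indicator {0..<a k} x - (indicator {0..<a (Suc k)} x :: real)"
  using a_antimono[of k "Suc k"] by (auto simp: J_def indicator_def)

lemma integral_J:
  assumes "cone f"
  shows "(\<integral>x. f x * indicator (J k) x \<partial>unit_measure) =
    (\<integral>x. f x * indicator {0..<a k} x \<partial>unit_measure) - (\<integral>x. f x * indicator {0..<a (Suc k)} x \<partial>unit_measure)"
proof -
  have "(\<integral>x. f x * indicator (J k) x \<partial>unit_measure) =
    (\<integral>x. f x * indicator {0..<a k} x - f x * indicator {0..<a (Suc k)} x \<partial>unit_measure)"
    by (intro Bochner_Integration.integral_cong) (auto simp: indicator_J right_diff_distrib)
  also have "\<dots> = (\<integral>x. f x * indicator {0..<a k} x \<partial>unit_measure) - (\<integral>x. f x * indicator {0..<a (Suc k)} x \<partial>unit_measure)"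
    by (intro Bochner_Integration.integral_diff bounded_borel_integrable bounded_borel_mult
        cone_bounded_borel[OF assms] bounded_borel_indicator) auto
  finally show ?thesis .
qed

lemma integral_PL_J:
  assumes "cone f"
  shows "(\<integral>x. PL f x * indicator (J k) x \<partial>unit_measure) = (\<integral>x. f x * indicator (J (Suc k)) x \<partial>unit_measure)"
  using assms by (simp add: integral_J integral_PL_initial cone_PL)

lemma measure_J: "measure lborel (J k) = a k - a (Suc k)"
  using a_antimono[of k "Suc k"] by (simp add: J_def)

lemma J_subset: "J k \<subseteq> {0..1}"
  using a_range[of k] a_range[of "Suc k"] by (auto simp: J_def)

lemma integral_J_0_lower:
  assumes "cone f"
  shows "f 1 \<le> 2 * (\<integral>x. f x * indicator (J 0) x \<partial>unit_measure)"
proof -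
  have "f 1 * (1 / 2) = (\<integral>x. f 1 * indicator (J 0) x \<partial>unit_measure)"
    using measure_J[of 0] J_subset[of 0] by (simp add: measure_unit a_1)
  also have "\<dots> \<le> (\<integral>x. f x * indicator (J 0) x \<partial>unit_measure)"
    using coneD(2)[OF assms, of _ 1]
    by (intro integral_unit_mono bounded_borel_mult cone_bounded_borel[OF assms] bounded_borel_indicator
        mult_right_mono) auto
  finally show ?thesis by simp
qed

section \<open>Densities of the iterates and their renewal inequalities\<close>

definition dens :: "nat \<Rightarrow> real \<Rightarrow> real" where "dens n = (P ^^ n) (\<lambda>_. 1)"

definition u :: "nat \<Rightarrow> real" where "u n = dens n 1"

lemma cone_dens: "cone (dens n)"
  unfolding dens_def by (intro cone_P_iter) auto

lemma dens_0: "dens 0 = (\<lambda>_. 1)" and dens_Suc: "dens (Suc n) = P (dens n)"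
  by (simp_all add: dens_def)

lemma u_nonneg: "0 \<le> u n"
  using coneD(1)[OF cone_dens, of 1 n] by (simp add: u_def)

lemma u_0 [simp]: "u 0 = 1"
  by (simp add: u_def dens_0)

text \<open>The point 1 is fixed by the right branch, which has slope 2, so half of the density
  there survives a step.\<close>

lemma u_le_double: "u n \<le> 2 * u (Suc n)"
  using coneD(1)[OF cone_PL[OF cone_dens], of 1 n] by (simp add: u_def dens_Suc P_def PR_def)

lemma integral_dens:
  "bounded_borel \<theta> \<Longrightarrow> (\<integral>x. dens n x * \<theta> x \<partial>unit_measure) = (\<integral>x. \<theta> ((T ^^ n) x) \<partial>unit_measure)"
  unfolding dens_def by (subst integral_P_iter) auto

lemma integral_dens_1: "integral\<^sup>L unit_measure (dens n) = 1"
  using integral_dens[of "\<lambda>_. 1" n] integral_unit_const[of 1] by simp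

text \<open>The renewal inequalities are the case \<open>k = 0\<close>, where this mass is 1;
  general \<open>k\<close> makes the induction on \<open>t\<close> possible, since an excursion step
  lowers \<open>k\<close> by one.\<close>

definition \<psi> :: "nat \<Rightarrow> nat \<Rightarrow> real" where
  "\<psi> t k = (\<integral>x. dens t x * indicator {0..<a k} x \<partial>unit_measure)"

lemma psi_0: "\<psi> 0 k = a k"
  by (simp add: \<psi>_def dens_0 measure_initial)

lemma psi_t_0: "\<psi> t 0 = 1"
  unfolding \<psi>_def integral_cone_0[OF cone_dens] by (rule integral_dens_1)

lemma integral_P_split:
  assumes "cone f" "bounded_borel \<theta>"
  shows "(\<integral>x. P f x * \<theta> x \<partial>unit_measure) =
    (\<integral>x. PL f x * \<theta> x \<partial>unit_measure) + (\<integral>x. PR f x * \<theta> x \<partial>unit_measure)"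
  unfolding P_def distrib_right
  by (intro Bochner_Integration.integral_add bounded_borel_integrable bounded_borel_mult
      cone_bounded_borel cone_PL cone_PR assms)

lemma psi_Suc: "\<psi> (Suc t) k = \<psi> t (Suc k) + (\<integral>x. PR (dens t) x * indicator {0..<a k} x \<partial>unit_measure)"
  unfolding \<psi>_def dens_Suc
  by (subst integral_P_split) (auto simp: integral_PL_initial cone_dens intro!: bounded_borel_indicator)

lemma psi_Suc_bounds:
  "\<psi> t (Suc k) + u t / 2 * a k \<le> \<psi> (Suc t) k" "\<psi> (Suc t) k \<le> \<psi> t (Suc k) + 2 powr \<alpha> * u t * a k"
proof -
  have "integral\<^sup>L unit_measure (indicator {0..<a k}) = a k"
    by (simp add: measure_initial)
  then show "\<psi> t (Suc k) + u t / 2 * a k \<le> \<psi> (Suc t) k" "\<psi> (Suc t) k \<le> \<psi> t (Suc k) + 2 powr \<alpha> * u t * a k"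
    using integral_PR_bounds[OF cone_dens[of t], of "indicator {0..<a k}"]
    by (auto simp: psi_Suc u_def bounded_borel_indicator)
qed

lemma psi_lower: "a (t + k) + (\<Sum>i<t. u i * a (t - 1 - i + k)) / 2 \<le> \<psi> t k"
proof (induction t arbitrary: k)
  case 0
  then show ?case by (simp add: psi_0)
next
  case (Suc t)
  have "(\<Sum>i<t. u i * a (Suc t - 1 - i + k)) = (\<Sum>i<t. u i * a (t - 1 - i + Suc k))"
    by (intro sum.cong refl) (auto simp: Suc_diff_Suc)
  then show ?case using Suc[of "Suc k"] psi_Suc_bounds(1)[of t k] by (simp add: add_divide_distrib)
qed

lemma psi_upper: "\<psi> t k \<le> a (t + k) + 2 powr \<alpha> * (\<Sum>i<t. u i * a (t - 1 - i + k))"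
proof (induction t arbitrary: k)
  case 0
  then show ?case by (simp add: psi_0)
next
  case (Suc t)
  have "(\<Sum>i<t. u i * a (Suc t - 1 - i + k)) = (\<Sum>i<t. u i * a (t - 1 - i + Suc k))"
    by (intro sum.cong refl) (auto simp: Suc_diff_Suc)
  then show ?case using Suc[of "Suc k"] psi_Suc_bounds(2)[of t k] by (simp add: distrib_left mult.assoc)
qed

lemma renewal_upper: "(\<Sum>i<t. u i * a (t - 1 - i)) \<le> 2"
  using psi_lower[of t 0] a_pos[of t] by (simp add: psi_t_0)

lemma renewal_lower:
  assumes "1 \<le> t"
  shows "2 powr (- 1 - \<alpha>) \<le> (\<Sum>i<t. u i * a (t - 1 - i))"
proof -
  \<comment> \<open>At least half of Lebesgue measure has visited \<open>[1/2, 1]\<close> before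
    time \<open>t\<close>. This fails at \<open>t = 0\<close>, where the convolution is
    empty.\<close>
  have "a t \<le> 1/2" using assms a_antimono[of 1 t] a_1 by simp
  then have "1 / 2 \<le> 2 powr \<alpha> * (\<Sum>i<t. u i * a (t - 1 - i))"
    using psi_upper[of t 0] by (simp add: psi_t_0)
  then show ?thesis by (simp add: powr_diff powr_minus field_simps)
qed

theorem not_summable_u:
  assumes "1 \<le> m" "1 - 1 / real m \<le> 1 / \<alpha>"
  shows "\<not> summable (\<lambda>n. u n ^ m)"
proof -
  obtain C where C: "0 < C" "\<And>k. a k \<le> C * real (Suc k) powr - (1 / \<alpha>)"
    using a_upper by blast
  show ?thesis
    by (rule not_summable_power_renewal[of "1 / \<alpha>" "2 powr (- 1 - \<alpha>)" C m u a])
      (use C assms alpha_pos u_nonneg renewal_lower a_pos[THEN less_imp_le] in auto)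
qed

lemma P_iter_add: "(P ^^ n) (\<lambda>x. f x + g x) = (\<lambda>x. (P ^^ n) f x + (P ^^ n) g x)"
proof (induction n)
  case (Suc n)
  then show ?case by (auto simp: fun_eq_iff P_def PL_def PR_def add_divide_distrib)
qed simp

lemma P_iter_mono:
  assumes "\<And>x. x \<in> {0..1} \<Longrightarrow> f x \<le> g x" "x \<in> {0..1}"
  shows "(P ^^ n) f x \<le> (P ^^ n) g x"
  using assms(2)
proof (induction n arbitrary: x)
  case (Suc n)
  have "L x \<in> {0..1}" "(x + 1) / 2 \<in> {0..1}" using L_range[of x] Suc.prems by auto
  with Suc.IH show ?case using left'_ge_1[of "L x"]
    by (auto simp: P_def PL_def PR_def intro!: add_mono divide_right_mono)
qed (use assms in auto)

lemma P_iter_const: "(P ^^ n) (\<lambda>_. c) x = c * dens n x"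
proof (induction n arbitrary: x)
  case (Suc n)
  then have "(P ^^ n) (\<lambda>_. c) = (\<lambda>x. c * dens n x)" by auto
  then have "(P ^^ Suc n) (\<lambda>_. c) x = P (\<lambda>x. c * dens n x) x" by simp
  also have "\<dots> = c * dens (Suc n) x" by (simp add: dens_Suc P_def PL_def PR_def distrib_left)
  finally show ?case .
qed (simp add: dens_0)

text \<open>Follow the mass until it first passes the right branch. One step of the left branch
  turns \<open>J (Suc k)\<close> into \<open>J k\<close>. What passes the right branch is at most
  the constant \<open>2 powr \<alpha> * g 1\<close>, and constants evolve into multiples of
  \<open>u\<close>. Two factors 2, from \<open>integral_J_0_lower\<close> and
  \<open>u_le_double\<close>, restore the term \<open>k = 0\<close>, whence
  \<open>2 powr (\<alpha> + 2)\<close>.\<close>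

lemma P_iter_split:
  assumes "cone g"
  shows "(P ^^ n) g 1 \<le> 2 powr (\<alpha> + 2) * (\<Sum>k\<le>n. (\<integral>x. g x * indicator (J k) x \<partial>unit_measure) * u (n - k))"
  using assms
proof (induction n arbitrary: g)
  case 0
  have "2 powr (\<alpha> + 2) * (\<integral>x. g x * indicator (J 0) x \<partial>unit_measure) \<ge> 2 powr 1 * (\<integral>x. g x * indicator (J 0) x \<partial>unit_measure)"
    using alpha_pos coneD(1)[OF "0.prems"]
    by (intro mult_right_mono powr_mono Bochner_Integration.integral_nonneg) (auto simp: indicator_def)
  then show ?case using integral_J_0_lower[OF "0.prems"] by simp
next
  case (Suc n)
  define m where "m k = (\<integral>x. g x * indicator (J k) x \<partial>unit_measure)" for k
  have "(P ^^ Suc n) g 1 = (P ^^ n) (\<lambda>x. PL g x + PR g x) 1"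
    unfolding funpow_Suc_right P_def[abs_def] by simp
  also have "\<dots> = (P ^^ n) (PL g) 1 + (P ^^ n) (PR g) 1" by (simp add: P_iter_add)
  also have "(P ^^ n) (PL g) 1 \<le> 2 powr (\<alpha> + 2) * (\<Sum>k\<le>n. m (Suc k) * u (n - k))"
    using Suc.IH[OF cone_PL[OF Suc.prems]] by (simp add: integral_PL_J Suc.prems m_def)
  also have "(P ^^ n) (PR g) 1 \<le> (P ^^ n) (\<lambda>_. 2 powr \<alpha> * g 1) 1"
    using PR_bounds(2)[OF Suc.prems] by (intro P_iter_mono) auto
  also have "\<dots> = 2 powr \<alpha> * g 1 * u n" by (simp add: P_iter_const u_def)
  also have "\<dots> \<le> 2 powr \<alpha> * (2 * m 0) * (2 * u (Suc n))"
    using integral_J_0_lower[OF Suc.prems] coneD(1)[OF Suc.prems, of 1]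
    by (intro mult_mono mult_left_mono u_le_double u_nonneg) (auto simp: m_def)
  also have "\<dots> = 2 powr (\<alpha> + 2) * (m 0 * u (Suc n))" by (simp add: powr_add)
  finally have "(P ^^ Suc n) g 1 \<le> 2 powr (\<alpha> + 2) * (\<Sum>k\<le>n. m (Suc k) * u (n - k)) + 2 powr (\<alpha> + 2) * (m 0 * u (Suc n))"
    by simp
  also have "\<dots> = 2 powr (\<alpha> + 2) * (\<Sum>k\<le>Suc n. m k * u (Suc n - k))"
    by (subst sum.atMost_Suc_shift) (simp add: distrib_left)
  finally show ?case by (simp add: m_def)
qed

definition \<phi> :: "nat \<Rightarrow> nat \<Rightarrow> real" where
  "\<phi> t k = (\<integral>x. dens t x * indicator (J k) x \<partial>unit_measure)"

theorem u_upper: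
  assumes "1 < \<alpha>"
  shows "\<exists>M>0. \<forall>n. u n \<le> M * real (Suc n) powr (1 / \<alpha> - 1)"
proof -
  obtain C1 where C1: "0 < C1" "\<And>k. a k \<le> C1 * real (Suc k) powr - (1 / \<alpha>)"
    using a_upper by blast
  obtain c1 where c1: "0 < c1" "\<And>k. c1 * real (Suc k) powr - (1 / \<alpha>) \<le> a k"
    using a_lower by blast
  obtain C2 where C2: "0 < C2" "\<And>k. a k - a (Suc k) \<le> C2 * real (Suc k) powr (- 1 - 1 / \<alpha>)"
    using a_diff_upper by blast
  have "renewal_bound (1 / \<alpha>) 2 C1 C2 (2 powr \<alpha>) (2 powr (\<alpha> + 2)) c1 u a \<phi>"
  proof
    show "\<phi> 0 k \<le> a k - a (Suc k)" for k
      using J_subset[of k] by (simp add: \<phi>_def dens_0 measure_unit measure_J)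
    show "0 \<le> \<phi> t k" for t k
      unfolding \<phi>_def using coneD(1)[OF cone_dens]
      by (intro Bochner_Integration.integral_nonneg) (auto simp: indicator_def)
    show "\<phi> (Suc t) k \<le> \<phi> t (Suc k) + 2 powr \<alpha> * u t * (a k - a (Suc k))" for t k
    proof -
      have "\<phi> (Suc t) k = \<phi> t (Suc k) + (\<integral>x. PR (dens t) x * indicator (J k) x \<partial>unit_measure)"
        unfolding \<phi>_def dens_Suc
        by (subst integral_P_split) (auto simp: integral_PL_J cone_dens intro!: bounded_borel_indicator)
      also have "(\<integral>x. PR (dens t) x * indicator (J k) x \<partial>unit_measure) \<le> 2 powr \<alpha> * dens t 1 * integral\<^sup>L unit_measure (indicator (J k))"
        by (intro integral_PR_bounds cone_dens bounded_borel_indicator) auto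
      finally show ?thesis using J_subset[of k] by (simp add: u_def measure_unit measure_J)
    qed
    show "u n \<le> 2 powr (\<alpha> + 2) * (\<Sum>k\<le>n - t. \<phi> t k * u (n - t - k))" if "t \<le> n" for n t
    proof -
      have "dens n = (P ^^ (n - t)) (dens t)"
        using that by (simp add: dens_def funpow_add[symmetric] flip: funpow_add[unfolded comp_def, THEN fun_cong])
      then show ?thesis using P_iter_split[OF cone_dens, of "n - t" t] by (simp add: u_def \<phi>_def)
    qed
  qed (use assms C1 c1 C2 u_nonneg renewal_upper a_antimono in auto)
  then show ?thesis by (rule renewal_bound.u_upper)
qed

end


section \<open>Probabilities of visits at prescribed times\<close>

context manneville_pomeau
begin

lemma cone_upper_eps:
  assumes "cone f" "0 < \<epsilon>" "\<epsilon> \<le> x" "x \<le> 1"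
  shows "f x \<le> \<epsilon> powr (- 1 - \<alpha>) * f 1"
proof -
  have "f x \<le> x powr (- 1 - \<alpha>) * f 1" using assms by (intro cone_upper) auto
  also have "\<dots> \<le> \<epsilon> powr (- 1 - \<alpha>) * f 1"
    using assms alpha_pos coneD(1)[OF assms(1), of 1] by (intro mult_right_mono powr_mono2') auto
  finally show ?thesis .
qed

lemma visit_upper:
  assumes "A \<in> sets borel" "A \<subseteq> {\<epsilon>..1}" "0 < \<epsilon>"
  shows "(\<integral>x. indicator A ((T ^^ n) x) \<partial>unit_measure) \<le> \<epsilon> powr (- 1 - \<alpha>) * u n"
proof -
  have "(\<integral>x. indicator A ((T ^^ n) x) \<partial>unit_measure) = (\<integral>x. dens n x * indicator A x \<partial>unit_measure)"
    by (rule integral_dens[symmetric]) (use assms in auto)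
  also have "\<dots> \<le> (\<integral>x. \<epsilon> powr (- 1 - \<alpha>) * u n \<partial>unit_measure)"
    using assms cone_upper_eps[OF cone_dens[of n] assms(3)] u_nonneg[of n]
    by (intro integral_unit_mono bounded_borel_mult bounded_borel_indicator cone_bounded_borel cone_dens bounded_borel_const)
      (auto simp: indicator_def u_def)
  finally show ?thesis by simp
qed

lemma visit_lower:
  assumes "A \<in> sets borel" "A \<subseteq> {0..1}"
  shows "u n * measure lborel A \<le> (\<integral>x. indicator A ((T ^^ n) x) \<partial>unit_measure)"
proof -
  have "u n * measure lborel A = (\<integral>x. u n * indicator A x \<partial>unit_measure)"
    using assms by (simp add: measure_unit)
  also have "\<dots> \<le> (\<integral>x. dens n x * indicator A x \<partial>unit_measure)"
    using assms coneD(2)[OF cone_dens[of n], of _ 1]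
    by (intro integral_unit_mono bounded_borel_mult bounded_borel_indicator cone_bounded_borel cone_dens
        bounded_borel_const mult_right_mono) (auto simp: u_def)
  also have "\<dots> = (\<integral>x. indicator A ((T ^^ n) x) \<partial>unit_measure)"
    by (rule integral_dens) (use assms in auto)
  finally show ?thesis .
qed

text \<open>A substitute for the Markov property: restricted to \<open>[1/2, 1]\<close>, the density
  at time \<open>n\<close> is at most a multiple of \<open>u n\<close>, so the remaining
  \<open>k - n\<close> steps start from at most that multiple of Lebesgue measure.\<close>

lemma visit_twice_upper:
  assumes "A \<in> sets borel" "A \<subseteq> {1/2..1}" "n \<le> k"
  shows "(\<integral>x. indicator A ((T ^^ n) x) * indicator A ((T ^^ k) x) \<partial>unit_measure)
    \<le> (2 powr (1 + \<alpha>))\<^sup>2 * (u n * u (k - n))"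
proof -
  have bA: "bounded_borel (indicator A)" using assms by auto
  have bAk: "bounded_borel (\<lambda>x. indicator A ((T ^^ (k - n)) x))"
    by (rule bounded_borel_T_iter[OF bA])
  have "(T ^^ k) x = (T ^^ (k - n)) ((T ^^ n) x)" for x
    using assms(3) by (metis comp_apply funpow_add le_add_diff_inverse2)
  then have "(\<integral>x. indicator A ((T ^^ n) x) * indicator A ((T ^^ k) x) \<partial>unit_measure) =
    (\<integral>x. (\<lambda>y. indicator A y * indicator A ((T ^^ (k - n)) y)) ((T ^^ n) x) \<partial>unit_measure)" by simp
  also have "\<dots> = (\<integral>x. dens n x * (indicator A x * indicator A ((T ^^ (k - n)) x)) \<partial>unit_measure)"
    by (rule integral_dens[symmetric]) (intro bounded_borel_mult bA bAk)
  also have "\<dots> \<le> (\<integral>x. (2 powr (1 + \<alpha>) * u n) * indicator A ((T ^^ (k - n)) x) \<partial>unit_measure)"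
    using assms cone_upper_half[OF cone_dens[of n]] u_nonneg[of n]
    by (intro integral_unit_mono bounded_borel_mult bA bAk cone_bounded_borel cone_dens bounded_borel_const)
      (auto simp: indicator_def u_def)
  also have "\<dots> = (2 powr (1 + \<alpha>) * u n) * (\<integral>x. indicator A ((T ^^ (k - n)) x) \<partial>unit_measure)"
    by simp
  also have "\<dots> \<le> (2 powr (1 + \<alpha>) * u n) * (2 powr (1 + \<alpha>) * u (k - n))"
    using visit_upper[of A "1/2" "k - n"] assms u_nonneg half_powr by (intro mult_left_mono) auto
  finally show ?thesis by (simp add: power2_eq_square mult_ac)
qed

text \<open>Chebyshev's association inequality: the function
  \<open>indicator {0..\<eta>} x - \<eta>\<close> has mean zero and changes sign at \<eta>, and the
  decreasing density puts more weight on its positive part.\<close>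

lemma visit_zero_lower:
  assumes "0 \<le> \<eta>" "\<eta> \<le> 1"
  shows "\<eta> \<le> (\<integral>x. indicator {0..\<eta>} ((T ^^ n) x) \<partial>unit_measure)"
proof -
  define f where "f = dens n"
  have f: "cone f" by (simp add: f_def cone_dens)
  have m: "integral\<^sup>L unit_measure (indicator {0..\<eta>}) = \<eta>"
    using assms measure_unit[of "{0..\<eta>}"] by simp
  have "0 = (\<integral>x. f \<eta> * (indicator {0..\<eta>} x - \<eta>) \<partial>unit_measure)"
    unfolding integral_mult_right_zero
    by (subst Bochner_Integration.integral_diff)
      (auto intro!: bounded_borel_integrable bounded_borel_indicator simp del: Bochner_Integration.integral_indicator simp: m)
  also have "\<dots> \<le> (\<integral>x. f x * (indicator {0..\<eta>} x - \<eta>) \<partial>unit_measure)"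
  proof (intro integral_unit_mono bounded_borel_mult bounded_borel_diff bounded_borel_indicator
      cone_bounded_borel[OF f] bounded_borel_const)
    fix x :: real assume "x \<in> {0..1}"
    then show "f \<eta> * (indicator {0..\<eta>} x - \<eta>) \<le> f x * (indicator {0..\<eta>} x - \<eta>)"
      using coneD(2)[OF f, of x \<eta>] coneD(2)[OF f, of \<eta> x] assms
      by (cases "x \<le> \<eta>") (auto simp: mult_right_mono mult_right_mono_neg)
  qed auto
  also have "\<dots> = (\<integral>x. f x * indicator {0..\<eta>} x - \<eta> * f x \<partial>unit_measure)"
    by (simp add: algebra_simps)
  also have "\<dots> = (\<integral>x. f x * indicator {0..\<eta>} x \<partial>unit_measure) - \<eta> * integral\<^sup>L unit_measure f"
    by (subst Bochner_Integration.integral_diff)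
      (auto intro!: bounded_borel_integrable bounded_borel_mult cone_bounded_borel[OF f] bounded_borel_indicator)
  finally show ?thesis using integral_dens[of "indicator {0..\<eta>}" n]
    by (simp add: f_def integral_dens_1 bounded_borel_indicator)
qed

section \<open>Exactness\<close>

text \<open>The right branch halves the bound \<open>1 + \<alpha>\<close> on the logarithmic slope, and subtracting at most
  half of the minimum at most doubles it again. So a fixed proportion of the mass that visits
  \<open>[1/2, 1]\<close> can be replaced by Lebesgue measure.\<close>

lemma cone_PR_minus_const:
  assumes f: "cone f"
  shows "cone (\<lambda>x. PR f x - 2 powr (- 2 - \<alpha>) * integral\<^sup>L unit_measure (PR f))"
proof -
  \<comment> \<open>The mean of \<open>PR f\<close> is at most \<open>2 powr \<alpha> * f 1\<close>,
    and \<open>PR f 1 = f 1 / 2\<close>; with the factor \<open>2 powr (- 2 - \<alpha>)\<close> the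
    subtracted constant is at most half of the minimum \<open>PR f 1\<close>.\<close>
  define \<delta> where "\<delta> = 2 powr (- 2 - \<alpha>) * integral\<^sup>L unit_measure (PR f)"
  have PR: "cone (PR f)" by (rule cone_PR[OF f])
  have "integral\<^sup>L unit_measure (PR f) \<le> (\<integral>x. 2 powr \<alpha> * f 1 \<partial>unit_measure)"
    using PR_bounds(2)[OF f]
    by (intro integral_unit_mono cone_bounded_borel[OF PR] bounded_borel_const) auto
  then have "\<delta> \<le> 2 powr (- 2 - \<alpha>) * (2 powr \<alpha> * f 1)" unfolding \<delta>_def by (intro mult_left_mono) auto
  also have "\<dots> = PR f 1 / 2"
    by (simp add: PR_def mult.assoc[symmetric] powr_add[symmetric] powr_minus)
  finally have \<delta>1: "\<delta> \<le> PR f 1 / 2" .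
  have \<delta>: "\<delta> \<le> PR f x / 2" if "0 \<le> x" "x \<le> 1" for x
    using \<delta>1 coneD(2)[OF PR that(1), of 1] that by simp
  have "cone (\<lambda>x. PR f x - \<delta>)"
  proof (rule coneI)
    fix x :: real assume x: "0 \<le> x" "x \<le> 1"
    show "0 \<le> PR f x - \<delta>" using \<delta>[OF x] coneD(1)[OF PR x] by simp
  next
    fix x y :: real assume "0 \<le> x" "x \<le> y" "y \<le> 1"
    then show "PR f y - \<delta> \<le> PR f x - \<delta>" using coneD(2)[OF PR] by simp
  next
    fix x y :: real assume xy: "0 < x" "x \<le> y" "y \<le> 1"
    define r where "r = ((y + 1) / (x + 1)) powr (1 + \<alpha>)"
    define q where "q = (y / x) powr (1 + \<alpha>)"
    have r1: "1 \<le> r" unfolding r_def using xy alpha_pos by (intro ge_one_powr_ge_zero) auto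
    \<comment> \<open>The halved logarithmic slope in integrated form. It rests on
      \<open>(y - x) * (1 - x * y) \<ge> 0\<close>; afterwards the subtracted constant is paid for
      by \<open>r\<^sup>2 - 2 * r + 1 \<ge> 0\<close>.\<close>
    have qr: "r\<^sup>2 \<le> q"
    proof -
      have "0 \<le> (y - x) * (1 - x * y)" using xy by (intro mult_nonneg_nonneg) (auto simp: mult_le_one)
      then have "x * (y + 1)\<^sup>2 \<le> y * (x + 1)\<^sup>2" by (simp add: power2_eq_square algebra_simps)
      then have "((y + 1) / (x + 1))\<^sup>2 \<le> y / x"
        using xy by (simp add: power_divide pos_le_divide_eq pos_divide_le_eq mult.commute)
      then have "(((y + 1) / (x + 1))\<^sup>2) powr (1 + \<alpha>) \<le> q" unfolding q_def
        using xy alpha_pos by (intro powr_mono2) auto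
      moreover have "(z\<^sup>2) powr (1 + \<alpha>) = (z powr (1 + \<alpha>))\<^sup>2" for z :: real
        by (simp add: power2_eq_square powr_mult)
      ultimately show ?thesis by (simp only: r_def)
    qed
    have "((x + 1) / 2) powr (1 + \<alpha>) * f ((x + 1) / 2) \<le> ((y + 1) / 2) powr (1 + \<alpha>) * f ((y + 1) / 2)"
      using xy by (intro coneD(3)[OF f]) auto
    then have PRr: "PR f x \<le> r * PR f y"
      using xy by (simp add: PR_def r_def powr_divide field_simps)
    define v where "v = PR f y"
    have v: "0 \<le> v" "\<delta> \<le> v / 2" using xy coneD(1)[OF PR] \<delta> by (auto simp: v_def)
    have q1: "1 \<le> q" using qr r1 by (meson one_le_power order_trans)
    have "PR f x - \<delta> \<le> r * v - \<delta>" using PRr by (simp add: v_def)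
    also have "\<dots> \<le> q * (v - \<delta>)"
    proof -
      have "(q - 1) * \<delta> \<le> (q - 1) * (v / 2)" using q1 v by (intro mult_left_mono) auto
      moreover have "0 \<le> v * (q - 2 * r + 1)"
      proof (rule mult_nonneg_nonneg[OF v(1)])
        have "0 \<le> (r - 1)\<^sup>2" by simp
        then show "0 \<le> q - 2 * r + 1" using qr by (simp add: power2_eq_square algebra_simps)
      qed
      ultimately show ?thesis by (simp add: algebra_simps)
    qed
    finally have "x powr (1 + \<alpha>) * (PR f x - \<delta>) \<le> x powr (1 + \<alpha>) * (q * (v - \<delta>))"
      by (intro mult_left_mono) auto
    also have "\<dots> = y powr (1 + \<alpha>) * (PR f y - \<delta>)"
      using xy by (simp add: q_def v_def powr_divide)
    finally show "x powr (1 + \<alpha>) * (PR f x - \<delta>) \<le> y powr (1 + \<alpha>) * (PR f y - \<delta>)" .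
  qed
  then show ?thesis by (simp add: \<delta>_def)
qed

lemma integral_cone_nonneg: "cone f \<Longrightarrow> 0 \<le> integral\<^sup>L unit_measure f"
  using coneD(1)[of f] by (intro Bochner_Integration.integral_nonneg) auto

lemma integral_cone_split:
  "cone f \<Longrightarrow> integral\<^sup>L unit_measure f = integral\<^sup>L unit_measure (PL f) + integral\<^sup>L unit_measure (PR f)"
  using integral_P_split[of f "\<lambda>_. 1"] integral_P[of f "\<lambda>_. 1"] by simp

text \<open>Mass that has used only the left branch for \<open>n\<close> steps started in
  \<open>[0, a n)\<close>.\<close>

lemma integral_PL_iter_tendsto:
  assumes "cone f"
  shows "(\<lambda>n. integral\<^sup>L unit_measure ((PL ^^ n) f)) \<longlonglongrightarrow> 0"
proof -
  obtain C where C: "0 < C" "\<And>k. a k \<le> C * real (Suc k) powr - (1 / \<alpha>)"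
    using a_upper by blast
  show ?thesis
  proof (rule tendsto_sandwich[of "\<lambda>_. 0"])
  show "\<forall>\<^sub>F n in sequentially. integral\<^sup>L unit_measure ((PL ^^ n) f) \<le> f 0 * (C * real (Suc n) powr - (1 / \<alpha>))"
  proof (rule always_eventually, rule allI)
    fix n
    have "integral\<^sup>L unit_measure ((PL ^^ n) f) = (\<integral>x. f x * indicator {0..<a n} x \<partial>unit_measure)"
      by (rule integral_PL_iter[OF assms])
    also have "\<dots> \<le> (\<integral>x. f 0 * indicator {0..<a n} x \<partial>unit_measure)"
      using coneD(2)[OF assms, of 0]
      by (intro integral_unit_mono bounded_borel_mult cone_bounded_borel[OF assms] bounded_borel_indicator
          bounded_borel_const mult_right_mono) auto
    also have "\<dots> = f 0 * a n" by (simp add: measure_initial)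
    also have "\<dots> \<le> f 0 * (C * real (Suc n) powr - (1 / \<alpha>))"
      using C(2) coneD(1)[OF assms, of 0] by (intro mult_left_mono) auto
    finally show "integral\<^sup>L unit_measure ((PL ^^ n) f) \<le> f 0 * (C * real (Suc n) powr - (1 / \<alpha>))" .
  qed
  have "(\<lambda>n. real (Suc n) powr - (1 / \<alpha>)) \<longlonglongrightarrow> 0"
    using alpha_pos by real_asymp
  then have "(\<lambda>n. f 0 * (C * real (Suc n) powr - (1 / \<alpha>))) \<longlonglongrightarrow> f 0 * (C * 0)"
    by (intro tendsto_mult tendsto_const)
  then show "(\<lambda>n. f 0 * (C * real (Suc n) powr - (1 / \<alpha>))) \<longlonglongrightarrow> 0" by simp
  qed (auto intro!: always_eventually integral_cone_nonneg cone_PL_iter assms)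
qed

text \<open>Split \<open>PR g\<close> into the constant \<open>c * m\<close>, on which the bound
  \<open>s\<close> for Lebesgue measure applies, and a rest of mass \<open>(1 - c) * m\<close>,
  which is still in the cone and obeys the bound \<open>D\<close>.\<close>

lemma integral_PR_renew:
  assumes g: "cone g" and \<rho>: "bounded_borel \<rho>" and s: "integral\<^sup>L unit_measure \<rho> \<le> s"
    and D: "\<And>g. cone g \<Longrightarrow> (\<integral>x. g x * \<rho> x \<partial>unit_measure) \<le> D * integral\<^sup>L unit_measure g"
  defines "c \<equiv> 2 powr (- 2 - \<alpha>)" and "m \<equiv> integral\<^sup>L unit_measure (PR g)"
  shows "(\<integral>x. PR g x * \<rho> x \<partial>unit_measure) \<le> (c * s + (1 - c) * D) * m"
proof -
  have bPR: "bounded_borel (PR g)" by (intro cone_bounded_borel cone_PR g)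
  have c0: "0 \<le> c" by (simp add: c_def)
  have m0: "0 \<le> m" unfolding m_def by (intro integral_cone_nonneg cone_PR g)
  have int: "integrable unit_measure (\<lambda>x. PR g x * \<rho> x)" "integrable unit_measure (\<lambda>x. c * m * \<rho> x)"
    "integrable unit_measure (PR g)"
    by (intro bounded_borel_integrable bounded_borel_mult bPR \<rho> bounded_borel_const)+
  have "(\<integral>x. PR g x * \<rho> x \<partial>unit_measure) - c * m * integral\<^sup>L unit_measure \<rho>
    = (\<integral>x. (PR g x - c * m) * \<rho> x \<partial>unit_measure)"
    using int by (simp add: left_diff_distrib)
  also have "\<dots> \<le> D * integral\<^sup>L unit_measure (\<lambda>x. PR g x - c * m)"
    unfolding c_def m_def by (rule D[OF cone_PR_minus_const[OF g]])
  also have "integral\<^sup>L unit_measure (\<lambda>x. PR g x - c * m) = m - c * m"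
    using int by (subst Bochner_Integration.integral_diff)
      (auto intro!: bounded_borel_integrable simp: m_def)
  finally have "(\<integral>x. PR g x * \<rho> x \<partial>unit_measure) \<le> D * (m - c * m) + c * m * integral\<^sup>L unit_measure \<rho>"
    by simp
  also have "c * m * integral\<^sup>L unit_measure \<rho> \<le> c * m * s"
    using s c0 m0 by (intro mult_left_mono) auto
  finally show ?thesis by (simp add: algebra_simps)
qed

text \<open>The condition \<open>step\<close> says that \<open>\<rho> 0\<close> is a tail function
  with \<open>\<rho> N\<close> its form after \<open>N\<close> steps; as each step raises
  \<open>N\<close>, the bounds must be uniform in \<open>N\<close>. Every portion of the mass gains
  the improved constant when it passes the right branch, and the portion that has not done so within
  \<open>n\<close> steps tends to 0.\<close>

lemma cone_functional_improve:
  assumes \<rho>: "\<And>N. bounded_borel (\<rho> N)"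
    and step: "\<And>N x. x \<in> {0..1} \<Longrightarrow> \<rho> N x = \<rho> (Suc N) (T x)"
    and s: "\<And>N. integral\<^sup>L unit_measure (\<rho> N) \<le> s"
    and D: "\<And>N g. cone g \<Longrightarrow> (\<integral>x. g x * \<rho> N x \<partial>unit_measure) \<le> D * integral\<^sup>L unit_measure g"
    and g: "cone g"
  defines "c \<equiv> 2 powr (- 2 - \<alpha>)"
  shows "(\<integral>x. g x * \<rho> N x \<partial>unit_measure) \<le> (c * s + (1 - c) * D) * integral\<^sup>L unit_measure g"
proof -
  define E where "E = c * s + (1 - c) * D"
  define m where "m g = integral\<^sup>L unit_measure g" for g :: "real \<Rightarrow> real"
  have "(\<integral>x. g x * \<rho> N x \<partial>unit_measure) \<le> E * (m g - m ((PL ^^ n) g)) + D * m ((PL ^^ n) g)" for n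
    using g
  proof (induction n arbitrary: g N)
    case 0
    then show ?case using D[of g N] by (simp add: m_def)
  next
    case (Suc n)
    have "(\<integral>x. g x * \<rho> N x \<partial>unit_measure) = (\<integral>x. g x * \<rho> (Suc N) (T x) \<partial>unit_measure)"
      by (intro Bochner_Integration.integral_cong) (auto simp: step)
    also have "\<dots> = (\<integral>x. P g x * \<rho> (Suc N) x \<partial>unit_measure)"
      by (rule integral_P[symmetric]) (intro Suc.prems \<rho>)+
    also have "\<dots> = (\<integral>x. PL g x * \<rho> (Suc N) x \<partial>unit_measure) + (\<integral>x. PR g x * \<rho> (Suc N) x \<partial>unit_measure)"
      by (intro integral_P_split Suc.prems \<rho>)
    also have "\<dots> \<le> (E * (m (PL g) - m ((PL ^^ n) (PL g))) + D * m ((PL ^^ n) (PL g))) + E * m (PR g)"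
      unfolding E_def c_def m_def
      by (intro add_mono Suc.IH[unfolded E_def c_def m_def] cone_PL integral_PR_renew Suc.prems \<rho> s D)
    also have "\<dots> = E * (m g - m ((PL ^^ Suc n) g)) + D * m ((PL ^^ Suc n) g)"
      using integral_cone_split[OF Suc.prems] by (simp add: m_def funpow_swap1 algebra_simps)
    finally show ?case .
  qed
  moreover have "(\<lambda>n. E * (m g - m ((PL ^^ n) g)) + D * m ((PL ^^ n) g)) \<longlonglongrightarrow> E * (m g - 0) + D * 0"
    unfolding m_def by (intro tendsto_intros integral_PL_iter_tendsto g)
  ultimately have "(\<integral>x. g x * \<rho> N x \<partial>unit_measure) \<le> E * (m g - 0) + D * 0"
    by (intro LIMSEQ_le_const) auto
  then show ?thesis by (simp add: E_def m_def)
qed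

text \<open>Each improvement applies the affine contraction
  \<open>D \<mapsto> c * s + (1 - c) * D\<close>, whose fixed point is \<open>s\<close>; the
  iteration starts at the pointwise bound \<open>B\<close>. So Lebesgue measure alone controls all
  densities of the cone.\<close>

lemma cone_functional_le:
  assumes \<rho>: "\<And>N. bounded_borel (\<rho> N)"
    and step: "\<And>N x. x \<in> {0..1} \<Longrightarrow> \<rho> N x = \<rho> (Suc N) (T x)"
    and s: "\<And>N. integral\<^sup>L unit_measure (\<rho> N) \<le> s"
    and B: "\<And>N x. x \<in> {0..1} \<Longrightarrow> \<rho> N x \<le> B"
    and g: "cone g"
  shows "(\<integral>x. g x * \<rho> N x \<partial>unit_measure) \<le> s * integral\<^sup>L unit_measure g"
proof -
  define c where "c = (2 :: real) powr (- 2 - \<alpha>)"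
  have "(2 :: real) powr (- 2 - \<alpha>) \<le> 2 powr 0" using alpha_pos by (intro powr_mono) auto
  then have c: "0 < c" "c \<le> 1" by (auto simp: c_def)
  have "(\<integral>x. g x * \<rho> N x \<partial>unit_measure) \<le> (s + (1 - c) ^ j * (B - s)) * integral\<^sup>L unit_measure g" for j
    using g
  proof (induction j arbitrary: g N)
    case 0
    have "(\<integral>x. g x * \<rho> N x \<partial>unit_measure) \<le> (\<integral>x. B * g x \<partial>unit_measure)"
    proof (intro integral_unit_mono bounded_borel_mult cone_bounded_borel[OF "0.prems"] \<rho> bounded_borel_const)
      fix x :: real assume x: "x \<in> {0..1}"
      then show "g x * \<rho> N x \<le> B * g x"
        using mult_left_mono[OF B[OF x, of N], of "g x"] coneD(1)[OF "0.prems"] by (simp add: mult.commute)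
    qed
    then show ?case by simp
  next
    case (Suc j)
    have "(\<integral>x. g x * \<rho> N x \<partial>unit_measure) \<le>
      (c * s + (1 - c) * (s + (1 - c) ^ j * (B - s))) * integral\<^sup>L unit_measure g"
      unfolding c_def by (rule cone_functional_improve[of \<rho>, OF \<rho> step s Suc.IH[unfolded c_def] Suc.prems])
    also have "c * s + (1 - c) * (s + (1 - c) ^ j * (B - s)) = s + (1 - c) ^ Suc j * (B - s)"
      by (simp add: algebra_simps)
    finally show ?case .
  qed
  moreover have "(\<lambda>j. (s + (1 - c) ^ j * (B - s)) * integral\<^sup>L unit_measure g) \<longlonglongrightarrow>
      (s + 0 * (B - s)) * integral\<^sup>L unit_measure g"
    using c by (intro tendsto_intros LIMSEQ_power_zero) auto
  ultimately have "(\<integral>x. g x * \<rho> N x \<partial>unit_measure) \<le> (s + 0 * (B - s)) * integral\<^sup>L unit_measure g"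
    by (intro LIMSEQ_le_const) auto
  then show ?thesis by simp
qed

text \<open>The increments \<open>d N\<close> of the integrals satisfy \<open>d N \<le> (d (N + 1) + s) / 2\<close>, where \<open>s\<close> is
  their supremum: the right branch maps Lebesgue measure to Lebesgue measure. So an increment
  close to a positive supremum is followed by arbitrarily many such increments.\<close>

lemma tail_integral_antimono:
  assumes \<theta>: "\<And>N. bounded_borel (\<theta> N)"
    and step: "\<And>N x. x \<in> {0..1} \<Longrightarrow> \<theta> N x = \<theta> (Suc N) (T x)"
    and B: "\<And>N x. x \<in> {0..1} \<Longrightarrow> \<bar>\<theta> N x\<bar> \<le> B"
  shows "integral\<^sup>L unit_measure (\<theta> (Suc N)) \<le> integral\<^sup>L unit_measure (\<theta> N)"
proof -
  define b where "b N = integral\<^sup>L unit_measure (\<theta> N)" for N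
  define d where "d N = b (Suc N) - b N" for N
  define s where "s = (SUP N. d N)"
  have bB: "\<bar>b N\<bar> \<le> B" for N
  proof -
    have "b N \<le> (\<integral>x. B \<partial>unit_measure)" "(\<integral>x. - B \<partial>unit_measure) \<le> b N"
      unfolding b_def using B[of _ N] by (intro integral_unit_mono \<theta> bounded_borel_const; force simp: abs_le_iff)+
    then show ?thesis by (simp add: abs_le_iff)
  qed
  have "d N \<le> 2 * B" for N using bB[of N] bB[of "Suc N"] by (simp add: d_def abs_le_iff)
  then have bdd: "bdd_above (range d)" by (intro bdd_aboveI2)
  have ds: "d N \<le> s" for N unfolding s_def by (intro cSUP_upper bdd) auto
  define \<rho> where "\<rho> N x = \<theta> (Suc N) x - \<theta> N x" for N x
  have \<rho>: "bounded_borel (\<rho> N)" for N unfolding \<rho>_def by (intro bounded_borel_diff \<theta>)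
  have \<rho>step: "\<rho> N x = \<rho> (Suc N) (T x)" if "x \<in> {0..1}" for N x
    unfolding \<rho>_def using step[OF that] by simp
  have int_\<rho>: "integral\<^sup>L unit_measure (\<rho> N) = d N" for N
    unfolding \<rho>_def d_def b_def by (intro Bochner_Integration.integral_diff bounded_borel_integrable \<theta>)
  have one: "cone (\<lambda>_. 1)" by auto
  have double: "2 * d N - s \<le> d (Suc N)" for N
  proof -
    have "d N = (\<integral>x. 1 * \<rho> (Suc N) (T x) \<partial>unit_measure)"
      unfolding int_\<rho>[symmetric] by (intro Bochner_Integration.integral_cong) (auto simp: \<rho>step)
    also have "\<dots> = (\<integral>x. P (\<lambda>_. 1) x * \<rho> (Suc N) x \<partial>unit_measure)"
      by (rule integral_P[OF one \<rho>, symmetric])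
    also have "\<dots> = (\<integral>x. PL (\<lambda>_. 1) x * \<rho> (Suc N) x \<partial>unit_measure) + (\<integral>x. PR (\<lambda>_. 1) x * \<rho> (Suc N) x \<partial>unit_measure)"
      by (intro integral_P_split one \<rho>)
    also have "(\<integral>x. PR (\<lambda>_. 1) x * \<rho> (Suc N) x \<partial>unit_measure) = d (Suc N) / 2"
      by (simp add: PR_def int_\<rho>)
    also have "(\<integral>x. PL (\<lambda>_. 1) x * \<rho> (Suc N) x \<partial>unit_measure) \<le> s * integral\<^sup>L unit_measure (PL (\<lambda>_. 1))"
    proof (rule cone_functional_le[where B = "2 * B"])
      show "\<rho> N x \<le> 2 * B" if "x \<in> {0..1}" for N x
        using B[OF that, of N] B[OF that, of "Suc N"] by (simp add: \<rho>_def abs_le_iff)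
    qed (use \<rho> \<rho>step int_\<rho> ds cone_PL[OF one] in auto)
    also have "integral\<^sup>L unit_measure (PL (\<lambda>_. 1)) = 1 / 2"
      using integral_cone_split[OF one] by (simp add: PR_def[abs_def])
    finally show ?thesis by simp
  qed
  have "s \<le> 0"
  proof (rule ccontr)
    assume "\<not> s \<le> 0"
    then have s0: "0 < s" by simp
    \<comment> \<open>A run of \<open>M\<close> increments of at least \<open>s / 2\<close> would
      exceed \<open>2 * B\<close>, the greatest possible change of \<open>b\<close>. By
      \<open>double\<close> the distance to \<open>s\<close> at most doubles in each step, so the
      run has to begin within \<open>s / 2 ^ Suc M\<close> of \<open>s\<close>.\<close>
    obtain M :: nat where M: "4 * B < real M * s"
      using reals_Archimedean3[OF s0] by blast
    have "s - s / 2 ^ Suc M < s" using s0 by simp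
    then obtain N where N: "s - s / 2 ^ Suc M < d N"
      unfolding s_def by (subst (asm) less_cSUP_iff) (use bdd in auto)
    have dj: "s - 2 ^ j * (s / 2 ^ Suc M) \<le> d (N + j)" for j
    proof (induction j)
      case (Suc j)
      then show ?case using double[of "N + j"] by simp
    qed (use N in simp)
    have "s / 2 \<le> d (N + j)" if "j < M" for j
    proof -
      have "(2::real) ^ j \<le> 2 ^ M" using that by (intro power_increasing) auto
      then have "2 ^ j * (s / 2 ^ Suc M) \<le> 2 ^ M * (s / 2 ^ Suc M)" using s0 by (intro mult_right_mono) auto
      also have "\<dots> = s / 2" by simp
      finally show ?thesis using dj[of j] by simp
    qed
    then have "real M * (s / 2) \<le> (\<Sum>j<M. d (N + j))"
      using sum_mono[of "{..<M}" "\<lambda>_. s / 2" "\<lambda>j. d (N + j)"] by simp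
    also have "\<dots> = b (N + M) - b N" unfolding d_def
      by (induction M) auto
    also have "\<dots> \<le> 2 * B" using bB[of "N + M"] bB[of N] by (simp add: abs_le_iff)
    finally show False using M by simp
  qed
  then have "d N \<le> 0" using ds[of N] by simp
  then show ?thesis by (simp add: d_def b_def)
qed

text \<open>Monotonicity applied to \<theta> and to its negative makes the Lebesgue integral of
  \<open>\<theta> N\<close> independent of \<open>N\<close>. After subtracting this common mean
  \<open>b\<close>, \<open>cone_functional_le\<close> holds with \<open>s = 0\<close> in both
  directions.\<close>

lemma exact_cone:
  assumes \<theta>: "\<And>N. bounded_borel (\<theta> N)"
    and step: "\<And>N x. x \<in> {0..1} \<Longrightarrow> \<theta> N x = \<theta> (Suc N) (T x)"
    and B: "\<And>N x. x \<in> {0..1} \<Longrightarrow> \<bar>\<theta> N x\<bar> \<le> B"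
    and g: "cone g"
  shows "(\<integral>x. g x * \<theta> 0 x \<partial>unit_measure) = integral\<^sup>L unit_measure g * integral\<^sup>L unit_measure (\<theta> 0)"
proof -
  have neg: "bounded_borel (\<lambda>x. - \<theta> N x)" for N
    using bounded_borel_diff[OF bounded_borel_const[of 0] \<theta>] by simp
  have "integral\<^sup>L unit_measure (\<theta> (Suc N)) = integral\<^sup>L unit_measure (\<theta> N)" for N
    using tail_integral_antimono[of \<theta> B N, OF \<theta> step B]
      tail_integral_antimono[of "\<lambda>N x. - \<theta> N x" B N, OF neg] step B by simp
  then have const: "integral\<^sup>L unit_measure (\<theta> N) = integral\<^sup>L unit_measure (\<theta> 0)" for N
    by (induction N) auto
  define b where "b = integral\<^sup>L unit_measure (\<theta> 0)"
  have int: "integrable unit_measure (\<theta> N)" "integrable unit_measure (\<lambda>_. b)"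
      "integrable unit_measure (\<lambda>x. g x * \<theta> N x)" "integrable unit_measure (\<lambda>x. g x * b)" for N
    by (intro bounded_borel_integrable bounded_borel_mult \<theta> cone_bounded_borel g bounded_borel_const)+
  have "(\<integral>x. g x * (\<theta> 0 x - b) \<partial>unit_measure) \<le> 0 * integral\<^sup>L unit_measure g"
  proof (rule cone_functional_le[where B = "B - b" and \<rho> = "\<lambda>N x. \<theta> N x - b"])
    show "integral\<^sup>L unit_measure (\<lambda>x. \<theta> N x - b) \<le> 0" for N
      by (subst Bochner_Integration.integral_diff[OF int(1,2)]) (simp only: const[of N] integral_unit_const b_def)
    show "\<theta> N x - b = \<theta> (Suc N) (T x) - b" if "x \<in> {0..1}" for N x using step[OF that, of N] by simp
    show "\<theta> N x - b \<le> B - b" if "x \<in> {0..1}" for N x using B[OF that, of N] by (simp add: abs_le_iff)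
  qed (intro bounded_borel_diff \<theta> bounded_borel_const g)+
  moreover have "(\<integral>x. g x * (b - \<theta> 0 x) \<partial>unit_measure) \<le> 0 * integral\<^sup>L unit_measure g"
  proof (rule cone_functional_le[where B = "B + b" and \<rho> = "\<lambda>N x. b - \<theta> N x"])
    show "integral\<^sup>L unit_measure (\<lambda>x. b - \<theta> N x) \<le> 0" for N
      by (subst Bochner_Integration.integral_diff[OF int(2,1)]) (simp only: const[of N] integral_unit_const b_def)
    show "b - \<theta> N x \<le> B + b" if "x \<in> {0..1}" for N x using B[OF that, of N] by (simp add: abs_le_iff)
    show "b - \<theta> N x = b - \<theta> (Suc N) (T x)" if "x \<in> {0..1}" for N x using step[OF that, of N] by simp
  qed (intro bounded_borel_diff \<theta> bounded_borel_const g)+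
  ultimately have "(\<integral>x. g x * \<theta> 0 x \<partial>unit_measure) = (\<integral>x. g x * b \<partial>unit_measure)"
    using int by (simp add: right_diff_distrib)
  then show ?thesis by (simp add: b_def)
qed

text \<open>A steep ramp alone violates the growth condition. Adding its Lipschitz constant
  \<open>K\<close> repairs this: a \<open>K\<close>-Lipschitz function that is at least
  \<open>K\<close> on \<open>[0, 1]\<close> even has \<open>x * f x\<close> increasing. By linearity
  the constant is removed again in \<open>exact_interval\<close>.\<close>

lemma cone_ramp:
  assumes "0 \<le> K"
  shows "cone (\<lambda>x. min 1 (max 0 (K * (t - x))) + K)"
proof (rule coneI)
  define h where "h x = min 1 (max 0 (K * (t - x)))" for x
  have h: "0 \<le> h x" "x \<le> y \<Longrightarrow> h y \<le> h x" for x y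
    using mult_left_mono[of "t - y" "t - x" K] assms by (auto simp: h_def min_def max_def)
  fix x y :: real
  show "0 \<le> min 1 (max 0 (K * (t - x))) + K" using assms by simp
  show "min 1 (max 0 (K * (t - y))) + K \<le> min 1 (max 0 (K * (t - x))) + K" if "x \<le> y"
    using h(2)[OF that] by (simp add: h_def)
  assume xy: "0 < x" "x \<le> y" "y \<le> 1"
  define f where "f x = h x + K" for x
  have lip: "f x \<le> f y + K * (y - x)"
  proof -
    have "0 \<le> K * (y - x)" using assms xy by simp
    moreover have "K * (t - x) = K * (t - y) + K * (y - x)" by (simp add: algebra_simps)
    ultimately show ?thesis by (auto simp: f_def h_def min_def max_def)
  qed
  have fy: "K \<le> f y" using h(1) by (simp add: f_def)
  have "x * f x \<le> x * f y + x * (K * (y - x))"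
    using mult_left_mono[OF lip, of x] xy by (simp add: distrib_left)
  also have "x * (K * (y - x)) \<le> 1 * (f y * (y - x))"
    using xy fy assms by (intro mult_mono mult_right_mono) auto
  finally have le: "x * f x \<le> y * f y" by (simp add: algebra_simps)
  have "x powr (1 + \<alpha>) * f x = x powr \<alpha> * (x * f x)" using xy by (simp add: powr_add)
  also have "\<dots> \<le> y powr \<alpha> * (y * f y)"
    using xy alpha_pos assms h(1)[of x] by (intro mult_mono[OF _ le] powr_mono2) (auto simp: f_def)
  also have "\<dots> = y powr (1 + \<alpha>) * f y" using xy by (simp add: powr_add)
  finally show "x powr (1 + \<alpha>) * (min 1 (max 0 (K * (t - x))) + K) \<le> y powr (1 + \<alpha>) * (min 1 (max 0 (K * (t - y))) + K)"
    by (simp add: f_def h_def)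
qed

lemma ramp_tendsto: "(\<lambda>k. min 1 (max 0 (real k * (t - x)))) \<longlonglongrightarrow> indicator {..<t} x"
proof (cases "x < t")
  case True
  obtain K :: nat where K: "1 < real K * (t - x)"
    using reals_Archimedean3[of "t - x"] True by auto
  have "\<forall>\<^sub>F k in sequentially. min 1 (max 0 (real k * (t - x))) = 1"
    using eventually_ge_at_top[of K]
  proof eventually_elim
    case (elim k)
    then have "real K * (t - x) \<le> real k * (t - x)" using True by (intro mult_right_mono) auto
    then show ?case using K by simp
  qed
  then show ?thesis using True by (simp add: tendsto_eventually)
next
  case False
  then have "min 1 (max 0 (real k * (t - x))) = 0" for k
    by (simp add: mult_nonneg_nonpos)
  then show ?thesis using False by simp
qed

theorem exact_interval:
  assumes \<theta>: "\<And>N. bounded_borel (\<theta> N)"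
    and step: "\<And>N x. x \<in> {0..1} \<Longrightarrow> \<theta> N x = \<theta> (Suc N) (T x)"
    and B: "\<And>N x. x \<in> {0..1} \<Longrightarrow> \<bar>\<theta> N x\<bar> \<le> B"
  shows "(\<integral>x. indicator {..<t} x * \<theta> 0 x \<partial>unit_measure) =
    integral\<^sup>L unit_measure (indicator {..<t}) * integral\<^sup>L unit_measure (\<theta> 0)"
proof -
  define h where "h k x = min 1 (max 0 (real k * (t - x)))" for k and x :: real
  have bh: "bounded_borel (h k)" for k
    using bounded_borel_diff[OF cone_bounded_borel[OF cone_ramp[of "real k" t]] bounded_borel_const[of "real k"]]
    by (simp add: h_def[abs_def])
  have h_range: "0 \<le> h k x" "h k x \<le> 1" for k x by (auto simp: h_def)
  have eq: "(\<integral>x. h k x * \<theta> 0 x \<partial>unit_measure) = integral\<^sup>L unit_measure (h k) * integral\<^sup>L unit_measure (\<theta> 0)" for k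
  proof -
    have int: "integrable unit_measure (h k)" "integrable unit_measure (\<lambda>_. real k)"
      "integrable unit_measure (\<lambda>x. h k x * \<theta> 0 x)" "integrable unit_measure (\<lambda>x. real k * \<theta> 0 x)"
      by (intro bounded_borel_integrable bounded_borel_mult \<theta> bh bounded_borel_const)+
    have "(\<integral>x. (h k x + real k) * \<theta> 0 x \<partial>unit_measure)
      = integral\<^sup>L unit_measure (\<lambda>x. h k x + real k) * integral\<^sup>L unit_measure (\<theta> 0)"
      unfolding h_def by (rule exact_cone[of \<theta> B]) (rule \<theta> step B cone_ramp; simp)+
    also have "integral\<^sup>L unit_measure (\<lambda>x. h k x + real k) = integral\<^sup>L unit_measure (h k) + real k"
      by (subst Bochner_Integration.integral_add[OF int(1,2)]) (simp only: integral_unit_const)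
    also have "(\<integral>x. (h k x + real k) * \<theta> 0 x \<partial>unit_measure) =
        (\<integral>x. h k x * \<theta> 0 x \<partial>unit_measure) + real k * integral\<^sup>L unit_measure (\<theta> 0)"
      unfolding distrib_right by (subst Bochner_Integration.integral_add[OF int(3,4)]) simp
    finally show ?thesis by (simp add: algebra_simps)
  qed
  interpret prob_space unit_measure by (rule prob_space_unit_measure)
  have lim1: "(\<lambda>k. integral\<^sup>L unit_measure (h k)) \<longlonglongrightarrow> integral\<^sup>L unit_measure (indicator {..<t})"
    by (rule integral_dominated_convergence[where w = "\<lambda>_. 1"])
      (use bh bounded_borel_indicator[of "{..<t}"] ramp_tendsto h_range
        in \<open>auto simp: bounded_borel_def h_def\<close>)
  have lim2: "(\<lambda>k. (\<integral>x. h k x * \<theta> 0 x \<partial>unit_measure)) \<longlonglongrightarrow> (\<integral>x. indicator {..<t} x * \<theta> 0 x \<partial>unit_measure)"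
  proof (rule integral_dominated_convergence[where w = "\<lambda>_. B"])
    show "AE x in unit_measure. norm (h k x * \<theta> 0 x) \<le> B" for k
    proof (rule AE_I2)
      fix x assume "x \<in> space unit_measure"
      then have "\<bar>h k x\<bar> * \<bar>\<theta> 0 x\<bar> \<le> 1 * B" using h_range[of k x] B[of x 0]
        by (intro mult_mono) auto
      then show "norm (h k x * \<theta> 0 x) \<le> B" by (simp add: abs_mult)
    qed
    show "AE x in unit_measure. (\<lambda>k. h k x * \<theta> 0 x) \<longlonglongrightarrow> indicator {..<t} x * \<theta> 0 x"
      unfolding h_def by (intro AE_I2 tendsto_mult ramp_tendsto tendsto_const)
    show "(\<lambda>x. h k x * \<theta> 0 x) \<in> borel_measurable unit_measure" for k
      using bounded_borel_mult[OF bh \<theta>] by (simp add: bounded_borel_def)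
    show "(\<lambda>x. indicator {..<t} x * \<theta> 0 x) \<in> borel_measurable unit_measure"
      using bounded_borel_mult[OF bounded_borel_indicator \<theta>, of "{..<t}" 0] by (simp add: bounded_borel_def)
  qed simp
  have "(\<lambda>k. (\<integral>x. h k x * \<theta> 0 x \<partial>unit_measure)) \<longlonglongrightarrow>
      integral\<^sup>L unit_measure (indicator {..<t}) * integral\<^sup>L unit_measure (\<theta> 0)"
    unfolding eq by (intro tendsto_mult lim1 tendsto_const)
  with lim2 show ?thesis by (rule LIMSEQ_unique)
qed

end


section \<open>Recurrence in product spaces\<close>

context prob_space
begin

lemma frequently_measurable [measurable]:
  assumes [measurable]: "\<And>n :: nat. B n \<in> events"
  shows "{x \<in> space M. \<exists>\<^sub>F n in sequentially. x \<in> B n} \<in> events"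
  unfolding frequently_sequentially by measurable

text \<open>The reverse Fatou lemma for events, by continuity from above of the tail unions.\<close>

lemma prob_frequently_ge:
  assumes B [measurable]: "\<And>n :: nat. B n \<in> events" and q: "\<And>n. q \<le> prob (B n)"
  shows "q \<le> prob {x \<in> space M. \<exists>\<^sub>F n in sequentially. x \<in> B n}"
proof -
  define Z where "Z K = (\<Union>n\<in>{K..}. B n)" for K
  have Z [measurable]: "Z K \<in> events" for K unfolding Z_def by measurable
  have "(\<lambda>K. prob (Z K)) \<longlonglongrightarrow> prob (\<Inter>K. Z K)"
  proof (rule finite_Lim_measure_decseq)
    show "decseq Z" unfolding decseq_def Z_def by (intro allI impI UN_mono) auto
  qed auto
  moreover have "q \<le> prob (Z K)" for K
    by (rule order_trans[OF q[of K] finite_measure_mono]) (auto simp: Z_def)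
  ultimately have "q \<le> prob (\<Inter>K. Z K)"
    by (intro LIMSEQ_le_const) auto
  also have "(\<Inter>K. Z K) = {x \<in> space M. \<exists>\<^sub>F n in sequentially. x \<in> B n}"
    using sets.sets_into_space[OF B] by (fastforce simp: Z_def frequently_sequentially)
  finally show ?thesis .
qed

text \<open>The second Borel-Cantelli lemma of Kochen and Stone: the Paley-Zygmund inequality is applied to
  the number of events that occur before time \<open>N\<close>.\<close>

lemma prob_frequently_pos:
  fixes w :: "nat \<Rightarrow> real"
  assumes B [measurable]: "\<And>n. B n \<in> events"
    and w: "\<And>n. 0 \<le> w n" "\<not> summable w" and c: "0 < c" and C: "0 < C"
    and lower: "\<And>n. c * w n \<le> prob (B n)"
    and upper: "\<And>n k. n \<le> k \<Longrightarrow> prob (B n \<inter> B k) \<le> C * (w n * w (k - n))"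
  shows "0 < prob {x \<in> space M. \<exists>\<^sub>F n in sequentially. x \<in> B n}"
proof -
  define X where "X N x = (\<Sum>n<N. indicator (B n) x :: real)" for N x
  define V where "V N = (\<Sum>n<N. w n)" for N
  define q where "q = c\<^sup>2 / (8 * C)"
  have X [measurable]: "X N \<in> borel_measurable M" for N unfolding X_def by measurable
  have X0: "0 \<le> X N x" for N x unfolding X_def by (intro sum_nonneg) auto
  have XN: "X N x \<le> real N" for N x
    using sum_mono[of "{..<N}" "\<lambda>n. indicator (B n) x :: real" "\<lambda>_. 1"] by (simp add: X_def indicator_def)
  have int1: "integrable M (X N)" for N
    using X0 XN by (intro integrable_const_bound[of _ "real N"]) auto
  have int2: "integrable M (\<lambda>x. (X N x)\<^sup>2)" for N
    using X0 XN by (intro integrable_const_bound[of _ "(real N)\<^sup>2"]) (auto intro!: power_mono)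
  have EX: "c * V N \<le> expectation (X N)" for N
  proof -
    have "expectation (X N) = (\<Sum>n<N. prob (B n))"
      unfolding X_def by (subst Bochner_Integration.integral_sum) (auto intro!: integrable_real_indicator simp: less_top[symmetric])
    then show ?thesis unfolding V_def sum_distrib_left by (auto intro!: sum_mono lower)
  qed
  have EX2: "expectation (\<lambda>x. (X N x)\<^sup>2) \<le> 2 * C * (V N)\<^sup>2" for N
  proof -
    define g where "g n k = (if n \<le> k then w n * w (k - n) else 0)" for n k
    have g0: "0 \<le> g n k" for n k using w by (simp add: g_def)
    have "(X N x)\<^sup>2 = (\<Sum>n<N. \<Sum>k<N. indicator (B n \<inter> B k) x)" for x
      unfolding X_def power2_eq_square sum_product by (simp add: indicator_inter_arith)
    then have "expectation (\<lambda>x. (X N x)\<^sup>2) = expectation (\<lambda>x. \<Sum>n<N. \<Sum>k<N. indicator (B n \<inter> B k) x)" by simp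
    also have "\<dots> = (\<Sum>n<N. \<Sum>k<N. prob (B n \<inter> B k))"
      by (subst Bochner_Integration.integral_sum; (subst Bochner_Integration.integral_sum)?)
        (auto intro!: integrable_real_indicator Bochner_Integration.integrable_sum simp: less_top[symmetric])
    also have "\<dots> \<le> (\<Sum>n<N. \<Sum>k<N. C * g n k + C * g k n)"
    proof (intro sum_mono)
      fix n k
      show "prob (B n \<inter> B k) \<le> C * g n k + C * g k n"
      proof (cases "n \<le> k")
        case True
        then show ?thesis using upper[of n k] g0[of k n] C by (simp add: g_def add_increasing2)
      next
        case False
        then show ?thesis using upper[of k n] by (simp add: g_def Int_commute)
      qed
    qed
    also have "\<dots> = C * (\<Sum>n<N. \<Sum>k<N. g n k) + C * (\<Sum>n<N. \<Sum>k<N. g k n)"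
      by (simp add: sum.distrib sum_distrib_left)
    also have "(\<Sum>n<N. \<Sum>k<N. g k n) = (\<Sum>n<N. \<Sum>k<N. g n k)" by (rule sum.swap)
    also have "(\<Sum>n<N. \<Sum>k<N. g n k) \<le> (\<Sum>n<N. w n * V N)"
    proof (rule sum_mono)
      fix n assume n: "n \<in> {..<N}"
      have "(\<Sum>k<N. g n k) = (\<Sum>k\<in>{n..<N}. w n * w (k - n))"
        unfolding g_def by (intro sum.mono_neutral_cong_right) auto
      also have "\<dots> = w n * (\<Sum>k\<in>{n..<N}. w (k - n))" by (rule sum_distrib_left[symmetric])
      also have "(\<Sum>k\<in>{n..<N}. w (k - n)) = (\<Sum>j\<in>(\<lambda>k. k - n) ` {n..<N}. w j)"
        by (subst sum.reindex) (auto simp: inj_on_def)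
      also have "\<dots> \<le> V N" unfolding V_def using w by (intro sum_mono2) auto
      finally show "(\<Sum>k<N. g n k) \<le> w n * V N" using w by (simp add: mult_left_mono)
    qed
    also have "(\<Sum>n<N. w n * V N) = (V N)\<^sup>2" by (simp add: V_def power2_eq_square sum_distrib_right)
    finally show ?thesis using C by (simp add: mult_left_mono)
  qed
  have PZ: "q \<le> prob {x \<in> space M. c * V N / 2 \<le> X N x}" if V: "0 < V N" for N
  proof -
    define H where "H = {x \<in> space M. c * V N / 2 \<le> X N x}"
    have [measurable]: "H \<in> events" unfolding H_def by measurable
    \<comment> \<open>Replaces the Cauchy-Schwarz inequality: on \<open>H\<close>, the variable is
      at most \<open>\<epsilon>\<close> times its square plus \<open>1 / (4 * \<epsilon>)\<close>.
      This choice lets the second moment consume a quarter of \<open>c * V N\<close>, which leaves a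
      quarter for \<open>prob H\<close>.\<close>
    define \<epsilon> where "\<epsilon> = c / (8 * C * V N)"
    have \<epsilon>: "0 < \<epsilon>" using c C V by (simp add: \<epsilon>_def)
    have pt: "X N x \<le> c * V N / 2 + (\<epsilon> * (X N x)\<^sup>2 + indicator H x / (4 * \<epsilon>))" if "x \<in> space M" for x
    proof (cases "x \<in> H")
      case True
      have "0 \<le> (2 * \<epsilon> * X N x - 1)\<^sup>2 / (4 * \<epsilon>)" using \<epsilon> by simp
      also have "\<dots> = \<epsilon> * (X N x)\<^sup>2 + 1 / (4 * \<epsilon>) - X N x"
        using \<epsilon> by (simp add: power2_eq_square field_simps)
      finally show ?thesis using True mult_pos_pos[OF c V] by simp
    next
      case False
      then show ?thesis using that \<epsilon> by (simp add: H_def add_increasing2)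
    qed
    have "c * V N \<le> expectation (X N)" by (rule EX)
    also have "\<dots> \<le> expectation (\<lambda>x. c * V N / 2 + (\<epsilon> * (X N x)\<^sup>2 + indicator H x / (4 * \<epsilon>)))"
      by (intro integral_mono pt int1)
        (auto intro!: Bochner_Integration.integrable_add int2 integrable_real_indicator simp: less_top[symmetric])
    also have "\<dots> = c * V N / 2 + (\<epsilon> * expectation (\<lambda>x. (X N x)\<^sup>2) + prob H / (4 * \<epsilon>))"
      by (simp add: int2 integrable_real_indicator less_top[symmetric] prob_space)
    also have "\<epsilon> * expectation (\<lambda>x. (X N x)\<^sup>2) \<le> \<epsilon> * (2 * C * (V N)\<^sup>2)"
      using EX2 \<epsilon> by (intro mult_left_mono) auto
    also have "\<epsilon> * (2 * C * (V N)\<^sup>2) = c * V N / 4"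
      using C V by (simp add: \<epsilon>_def power2_eq_square)
    also have "prob H / (4 * \<epsilon>) = prob H * (2 * C * V N / c)"
      using c C V by (simp add: \<epsilon>_def)
    finally have "c * V N / 4 \<le> prob H * (2 * C * V N / c)" by simp
    then have "(c / 4) * V N \<le> (prob H * (2 * C / c)) * V N" by (simp add: mult_ac)
    then have "c / 4 \<le> prob H * (2 * C / c)" using V by (rule mult_right_le_imp_le)
    then show ?thesis using c C by (simp add: q_def H_def field_simps power2_eq_square)
  qed
  \<comment> \<open>More than \<open>K\<close> events occur in total; the bound \<open>q\<close>
    does not depend on \<open>K\<close>, so it survives the intersection.\<close>
  define Z where "Z K = {x \<in> space M. \<exists>N. real K < X N x}" for K
  have Z [measurable]: "Z K \<in> events" for K unfolding Z_def by measurable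
  have "q \<le> prob (Z K)" for K
  proof -
    have "\<exists>N. 2 * real (Suc K) / c < V N"
    proof (rule ccontr)
      assume "\<not> ?thesis"
      then have "(\<Sum>n<N. w n) \<le> 2 * real (Suc K) / c" for N by (auto simp: V_def not_less)
      then have "summable w" by (intro summableI_nonneg_bounded w(1)) auto
      with w(2) show False by simp
    qed
    then obtain N where N: "2 * real (Suc K) / c < V N" by blast
    have "0 < 2 * real (Suc K) / c" using c by simp
    with N have "0 < V N" by linarith
    then have "q \<le> prob {x \<in> space M. c * V N / 2 \<le> X N x}" by (rule PZ)
    also have "\<dots> \<le> prob (Z K)"
    proof (rule finite_measure_mono)
      have "real K < c * V N / 2" using N c by (simp add: field_simps)
      then show "{x \<in> space M. c * V N / 2 \<le> X N x} \<subseteq> Z K" by (auto simp: Z_def intro!: exI[of _ N])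
    qed simp
    finally show ?thesis .
  qed
  moreover have "(\<lambda>K. prob (Z K)) \<longlonglongrightarrow> prob (\<Inter>K. Z K)"
  proof (rule finite_Lim_measure_decseq)
    show "decseq Z"
    proof (intro decseq_SucI subsetI)
      fix K x assume "x \<in> Z (Suc K)"
      then obtain N where N: "x \<in> space M" "real (Suc K) < X N x" by (auto simp: Z_def)
      then have "real K < X N x" by simp
      with N(1) show "x \<in> Z K" by (auto simp: Z_def)
    qed
  qed auto
  ultimately have "q \<le> prob (\<Inter>K. Z K)" by (intro LIMSEQ_le_const) auto
  moreover have "prob (\<Inter>K. Z K) \<le> prob {x \<in> space M. \<exists>\<^sub>F n in sequentially. x \<in> B n}"
  proof (rule finite_measure_mono)
    show "(\<Inter>K. Z K) \<subseteq> {x \<in> space M. \<exists>\<^sub>F n in sequentially. x \<in> B n}"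
    proof
      fix x assume x: "x \<in> (\<Inter>K. Z K)"
      then have xM: "x \<in> space M" by (auto simp: Z_def)
      have "\<exists>\<^sub>F n in sequentially. x \<in> B n"
      proof (rule ccontr)
        assume "\<not> ?thesis"
        then obtain K where K: "\<And>n. K \<le> n \<Longrightarrow> x \<notin> B n" by (auto simp: frequently_sequentially)
        from x obtain N where "real K < X N x" by (auto simp: Z_def)
        moreover have "X N x \<le> (\<Sum>n<N. if n < K then 1 else 0)"
          unfolding X_def using K by (intro sum_mono) (auto simp: indicator_def not_less)
        moreover have "(\<Sum>n<N. if n < K then 1 else (0::real)) = real (card ({..<N} \<inter> {..<K}))"
          by (subst sum.If_cases) (auto simp: lessThan_def)
        moreover have "card ({..<N} \<inter> {..<K}) \<le> K"
          using card_mono[of "{..<K}" "{..<N} \<inter> {..<K}"] by simp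
        ultimately show False by linarith
      qed
      with xM show "x \<in> {x \<in> space M. \<exists>\<^sub>F n in sequentially. x \<in> B n}" by simp
    qed
  qed simp
  moreover have "0 < q" using c C by (simp add: q_def)
  ultimately show ?thesis by linarith
qed

end

lemma prob_space_lambda_d: "prob_space (lambda_d d)"
  unfolding lambda_d_def by (intro prob_space_PiM prob_space_unit_measure)

lemma finite_product_prob_space_unit: "finite_product_prob_space (\<lambda>_. unit_measure) {..<d :: nat}"
proof -
  interpret prob_space unit_measure by (rule prob_space_unit_measure)
  show ?thesis by unfold_locales auto
qed

lemma space_lambda_d: "space (lambda_d d) = {..<d} \<rightarrow>\<^sub>E {0..1}"
  by (simp add: lambda_d_def space_PiM)

lemma sets_unit_iff: "A \<in> sets unit_measure \<longleftrightarrow> A \<in> sets borel \<and> A \<subseteq> {0..1}"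
  by (subst sets_restrict_space_iff) auto

section \<open>The zero-one law for products of the map\<close>

context manneville_pomeau
begin

lemma emeasure_density_unit:
  assumes f: "bounded_borel f" "\<And>x. x \<in> {0..1} \<Longrightarrow> 0 \<le> f x" and A: "A \<in> sets borel"
  shows "emeasure (distr (density unit_measure (\<lambda>x. ennreal (f x))) borel (\<lambda>x. x)) A =
    ennreal (\<integral>x. indicator A x * f x \<partial>unit_measure)"
proof -
  have [measurable]: "f \<in> borel_measurable unit_measure" using f by (simp add: bounded_borel_def)
  have id: "(\<lambda>x. x) \<in> measurable (density unit_measure (\<lambda>x. ennreal (f x))) borel"
    by (simp add: measurable_restrict_space1)
  have A': "A \<inter> {0..1} \<in> sets unit_measure" using A by (auto simp: sets_unit_iff)
  have "emeasure (distr (density unit_measure (\<lambda>x. ennreal (f x))) borel (\<lambda>x. x)) A =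
    emeasure (density unit_measure (\<lambda>x. ennreal (f x))) (A \<inter> {0..1})"
    using A by (subst emeasure_distr[OF id]) auto
  also have "\<dots> = (\<integral>\<^sup>+x. ennreal (f x) * indicator (A \<inter> {0..1}) x \<partial>unit_measure)"
    using A' by (subst emeasure_density) auto
  also have "\<dots> = (\<integral>\<^sup>+x. ennreal (indicator A x * f x) \<partial>unit_measure)"
    by (intro nn_integral_cong) (auto simp: indicator_def)
  also have "\<dots> = ennreal (\<integral>x. indicator A x * f x \<partial>unit_measure)"
    using f by (intro nn_integral_eq_integral bounded_borel_integrable bounded_borel_mult
        bounded_borel_indicator A AE_I2) auto
  finally show ?thesis .
qed

text \<open>A nonnegative \<theta> is the density of a finite measure, so independence of half-lines
  extends to Borel sets by uniqueness of measures on a generator stable under intersection.\<close>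

theorem exact_borel:
  assumes \<theta>: "\<And>N. bounded_borel (\<theta> N)"
    and step: "\<And>N x. x \<in> {0..1} \<Longrightarrow> \<theta> N x = \<theta> (Suc N) (T x)"
    and B: "\<And>N x. x \<in> {0..1} \<Longrightarrow> 0 \<le> \<theta> N x" "\<And>N x. x \<in> {0..1} \<Longrightarrow> \<theta> N x \<le> B"
    and A: "A \<in> sets borel"
  shows "(\<integral>x. indicator A x * \<theta> 0 x \<partial>unit_measure) =
    measure unit_measure (A \<inter> {0..1}) * integral\<^sup>L unit_measure (\<theta> 0)"
proof -
  define b where "b = integral\<^sup>L unit_measure (\<theta> 0)"
  have b: "0 \<le> b" unfolding b_def using B by (intro Bochner_Integration.integral_nonneg) auto
  define M1 where "M1 = distr (density unit_measure (\<lambda>x. ennreal (\<theta> 0 x))) borel (\<lambda>x. x)"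
  define M2 where "M2 = distr (density unit_measure (\<lambda>x. ennreal b)) borel (\<lambda>x. x)"
  have M1: "emeasure M1 X = ennreal (\<integral>x. indicator X x * \<theta> 0 x \<partial>unit_measure)" if "X \<in> sets borel" for X
    unfolding M1_def by (intro emeasure_density_unit \<theta> B that)
  have M2: "emeasure M2 X = ennreal (\<integral>x. indicator X x * b \<partial>unit_measure)" if "X \<in> sets borel" for X
    unfolding M2_def by (intro emeasure_density_unit that b) auto
  have "M1 = M2"
  proof (rule measure_eqI_generator_eq[where E = "range lessThan" and \<Omega> = UNIV and A = "\<lambda>n. {..<real n}"])
    have "{..<x} \<inter> {..<y} = {..<min x y}" for x y :: real by auto
    then show "Int_stable (range (lessThan :: real \<Rightarrow> real set))"
      unfolding Int_stable_def by auto
    show "emeasure M1 X = emeasure M2 X" if "X \<in> range lessThan" for X :: "real set"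
    proof -
      from that obtain t where X: "X = {..<t}" by auto
      have "(\<integral>x. indicator {..<t} x * \<theta> 0 x \<partial>unit_measure) =
        integral\<^sup>L unit_measure (indicator {..<t}) * b"
        unfolding b_def by (rule exact_interval[of \<theta> B]) (use \<theta> step B in \<open>simp_all\<close>)
      then show ?thesis unfolding X by (subst M1, simp, subst M2, simp) simp
    qed
    show "sets M1 = sigma_sets UNIV (range lessThan)" "sets M2 = sigma_sets UNIV (range lessThan)"
      by (simp_all add: M1_def M2_def borel_Iio)
    show "(\<Union>i. {..<real i}) = UNIV" by (auto intro: reals_Archimedean2)
    show "emeasure M1 {..<real i} \<noteq> \<infinity>" for i by (subst M1) auto
  qed auto
  then have "ennreal (\<integral>x. indicator A x * \<theta> 0 x \<partial>unit_measure) = ennreal (\<integral>x. indicator A x * b \<partial>unit_measure)"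
    using M1[OF A] M2[OF A] by simp
  then have "(\<integral>x. indicator A x * \<theta> 0 x \<partial>unit_measure) = (\<integral>x. indicator A x * b \<partial>unit_measure)"
    using B b by (subst (asm) ennreal_inj) (auto intro!: Bochner_Integration.integral_nonneg simp: indicator_def)
  then show ?thesis by (simp add: b_def)
qed

text \<open>The measure of the section of \<open>E\<close> over a value \<open>s\<close> of one coordinate, the other coordinates
  being distributed according to Lebesgue measure moved by \<open>T ^^ N\<close>, is a tail function of \<open>s\<close>.\<close>

lemma product_zero_one:
  assumes E: "E \<in> sets (lambda_d d)"
    and inv: "\<And>x. x \<in> space (lambda_d d) \<Longrightarrow> (\<lambda>i\<in>{..<d}. T (x i)) \<in> E \<longleftrightarrow> x \<in> E"
  shows "measure (lambda_d d) E = 0 \<or> measure (lambda_d d) E = 1"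
proof -
  define M where "M = lambda_d d"
  interpret M: prob_space M unfolding M_def by (rule prob_space_lambda_d)
  interpret PP: finite_product_prob_space "\<lambda>_. unit_measure" "{..<d}" by (rule finite_product_prob_space_unit)
  have M_PiM: "M = PiM {..<d} (\<lambda>_. unit_measure)" by (simp add: M_def lambda_d_def)
  have space_M: "space M = {..<d} \<rightarrow>\<^sub>E {0..1}" by (simp add: M_def space_lambda_d)
  have E_M [measurable]: "E \<in> sets M" using E by (simp add: M_def)
  \<comment> \<open>Coordinates are restricted one at a time, and for each of them exactness splits
    off a factor. Hence \<open>E\<close> is independent of all boxes, then of all events, and
    finally of itself.\<close>
  have box: "measure M (E \<inter> {x \<in> space M. \<forall>j\<in>S. x j \<in> A j}) = measure M E * (\<Prod>j\<in>S. measure unit_measure (A j))"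
    if A: "\<And>j. j < d \<Longrightarrow> A j \<in> sets unit_measure" and S: "S \<subseteq> {..<d}" for A S
    using finite_subset[OF S finite_lessThan] S
  proof (induction S rule: finite_induct)
    case empty
    then show ?case by (simp add: Int_absorb2 sets.sets_into_space[OF E_M])
  next
    case (insert i S)
    then have i: "i < d" and S: "S \<subseteq> {..<d}" by auto
    define G where "G = {x \<in> space M. \<forall>j\<in>S. x j \<in> A j}"
    have finS: "finite S" by fact
    have comp [measurable]: "(\<lambda>x. x j) \<in> measurable M unit_measure" if "j < d" for j
      unfolding M_PiM using that by (intro measurable_component_singleton) auto
    have G [measurable]: "G \<in> sets M"
    proof -
      have "{x \<in> space M. x j \<in> A j} \<in> sets M" if "j \<in> S" for j
        using that S A[of j] measurable_sets[OF comp[of j], of "A j"]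
        by (auto simp: vimage_def Int_def conj_commute)
      then show ?thesis unfolding G_def using finS by (intro sets.sets_Collect_finite_All) auto
    qed
    define U where "U N s x = (\<lambda>j\<in>{..<d}. if j = i then s else (T ^^ N) (x j))" for N and s :: real and x :: "nat \<Rightarrow> real"
    have U_meas: "(\<lambda>p. U N (fst p) (snd p)) \<in> measurable (unit_measure \<Otimes>\<^sub>M M) M" for N
      unfolding U_def M_PiM
    proof (rule measurable_restrict)
      fix j assume "j \<in> {..<d}"
      then have j: "j < d" by simp
      have "(\<lambda>p. (T ^^ N) (snd p j)) \<in> measurable (unit_measure \<Otimes>\<^sub>M M) unit_measure"
        by (rule measurable_compose[OF measurable_compose[OF measurable_snd comp[OF j]] T_iter_measurable_unit])
      then show "(\<lambda>p. if j = i then fst p else (T ^^ N) (snd p j)) \<in>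
        measurable (unit_measure \<Otimes>\<^sub>M PiM {..<d} (\<lambda>_. unit_measure)) unit_measure"
        by (cases "j = i") (auto simp: M_PiM)
    qed
    \<comment> \<open>The restriction \<open>G\<close> to the coordinates already treated stays on
      the unmoved point \<open>x\<close>. Only the point tested for \<open>E\<close> moves with
      \<open>N\<close>, so invariance of \<open>E\<close> gives
      \<open>\<theta> N s = \<theta> (Suc N) (T s)\<close>.\<close>
    define Q where "Q N = {p \<in> space (unit_measure \<Otimes>\<^sub>M M). U N (fst p) (snd p) \<in> E \<and> snd p \<in> G}" for N
    have Q: "Q N \<in> sets (unit_measure \<Otimes>\<^sub>M M)" for N
    proof -
      have "Q N = (\<lambda>p. U N (fst p) (snd p)) -` E \<inter> space (unit_measure \<Otimes>\<^sub>M M) \<inter> (snd -` G \<inter> space (unit_measure \<Otimes>\<^sub>M M))"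
        by (auto simp: Q_def)
      also have "\<dots> \<in> sets (unit_measure \<Otimes>\<^sub>M M)"
        by (intro sets.Int measurable_sets[OF U_meas E_M] measurable_sets[OF measurable_snd G])
      finally show ?thesis .
    qed
    define \<theta> where "\<theta> N s = measure M (Pair s -` Q N)" for N s
    have \<theta>: "bounded_borel (\<theta> N)" for N
    proof (rule bounded_borelI[of _ 1])
      have "(\<lambda>s. enn2real (emeasure M (Pair s -` Q N))) \<in> borel_measurable unit_measure"
        using M.measurable_emeasure_Pair[OF Q] by measurable
      then show "\<theta> N \<in> borel_measurable unit_measure" by (simp add: \<theta>_def[abs_def] measure_def)
    qed (simp add: \<theta>_def)
    have U_space: "U N s x \<in> space M" if "s \<in> {0..1}" "x \<in> space M" for N s x
      using that T_iter_range by (auto simp: U_def space_M PiE_iff)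
    have U_step: "(\<lambda>j\<in>{..<d}. T (U N s x j)) = U (Suc N) (T s) x" for N s x
      by (auto simp: U_def)
    have step: "\<theta> N s = \<theta> (Suc N) (T s)" if s: "s \<in> {0..1}" for N s
    proof -
      have "U (Suc N) (T s) x \<in> E \<longleftrightarrow> U N s x \<in> E" if "x \<in> space M" for x
        using inv[of "U N s x"] U_space[OF s that] by (simp add: U_step M_def)
      then have "Pair s -` Q N = Pair (T s) -` Q (Suc N)"
        using s T_range[OF s] by (auto simp: Q_def space_pair_measure)
      then show ?thesis by (simp add: \<theta>_def)
    qed
    have upd: "U 0 s x = x(i := s)" if "x \<in> space M" for s x
      using that i by (auto simp: U_def space_M PiE_iff extensional_def fun_eq_iff)
    have fubini: "measure M (E \<inter> G \<inter> {x \<in> space M. x i \<in> X}) = (\<integral>s. indicator X s * \<theta> 0 s \<partial>unit_measure)"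
      if X: "X \<in> sets unit_measure" for X
    proof -
      have X_borel: "X \<in> sets borel" using X by (simp add: sets_unit_iff)
      have "{x \<in> space M. x i \<in> X} = (\<lambda>x. x i) -` X \<inter> space M" by auto
      also have "\<dots> \<in> sets M" by (rule measurable_sets[OF comp[OF i] X])
      finally have EGX: "E \<inter> G \<inter> {x \<in> space M. x i \<in> X} \<in> sets M" by measurable
      \<comment> \<open>As \<open>i\<close> already belongs to the index set, inserting it means
        overwriting the coordinate \<open>i\<close> by an independent sample, which preserves
        \<open>M\<close>. Thus Fubini is used without splitting the product.\<close>
      have "distr (unit_measure \<Otimes>\<^sub>M PiM {..<d} (\<lambda>_. unit_measure)) (PiM (insert i {..<d}) (\<lambda>_. unit_measure))
          (\<lambda>(x, X). X(i := x)) = PiM (insert i {..<d}) (\<lambda>_. unit_measure)"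
        by (rule distr_pair_PiM_eq_PiM) (rule prob_space_unit_measure)+
      then have distr: "distr (unit_measure \<Otimes>\<^sub>M M) M (\<lambda>(s, x). x(i := s)) = M"
        using i by (simp add: M_PiM insert_absorb)
      have upd_meas: "(\<lambda>(s, x). x(i := s)) \<in> measurable (unit_measure \<Otimes>\<^sub>M M) M"
        using U_meas[of 0]
        by (subst measurable_cong[of _ _ "\<lambda>p. U 0 (fst p) (snd p)"]) (auto simp: upd space_pair_measure)
      have "emeasure M (E \<inter> G \<inter> {x \<in> space M. x i \<in> X}) =
        emeasure (unit_measure \<Otimes>\<^sub>M M) ((\<lambda>(s, x). x(i := s)) -` (E \<inter> G \<inter> {x \<in> space M. x i \<in> X}) \<inter> space (unit_measure \<Otimes>\<^sub>M M))"
        by (subst distr[symmetric], rule emeasure_distr[OF upd_meas EGX])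
      also have "(\<lambda>(s, x). x(i := s)) -` (E \<inter> G \<inter> {x \<in> space M. x i \<in> X}) \<inter> space (unit_measure \<Otimes>\<^sub>M M)
        = Q 0 \<inter> (fst -` X \<inter> space (unit_measure \<Otimes>\<^sub>M M))"
      proof -
        have "x(i := s) \<in> G \<longleftrightarrow> x \<in> G" if "x \<in> space M" "s \<in> {0..1}" for x s
          using insert.hyps that U_space[OF that(2,1), of 0] upd[OF that(1), of s]
          by (auto simp: G_def)
        moreover have "x(i := s) \<in> space M" if "x \<in> space M" "s \<in> {0..1}" for x s
          using U_space[OF that(2,1), of 0] upd[OF that(1), of s] by simp
        ultimately show ?thesis by (auto simp: Q_def space_pair_measure upd)
      qed
      also have "emeasure (unit_measure \<Otimes>\<^sub>M M) \<dots> =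
        (\<integral>\<^sup>+s. emeasure M (Pair s -` (Q 0 \<inter> (fst -` X \<inter> space (unit_measure \<Otimes>\<^sub>M M)))) \<partial>unit_measure)"
        by (intro M.emeasure_pair_measure_alt sets.Int Q measurable_sets[OF measurable_fst X])
      also have "\<dots> = (\<integral>\<^sup>+s. ennreal (indicator X s * \<theta> 0 s) \<partial>unit_measure)"
      proof (rule nn_integral_cong)
        fix s :: real
        have "Pair s -` (Q 0 \<inter> (fst -` X \<inter> space (unit_measure \<Otimes>\<^sub>M M))) = (if s \<in> X then Pair s -` Q 0 else {})"
          by (auto simp: Q_def)
        then show "emeasure M (Pair s -` (Q 0 \<inter> (fst -` X \<inter> space (unit_measure \<Otimes>\<^sub>M M)))) = ennreal (indicator X s * \<theta> 0 s)"
          by (simp add: \<theta>_def M.emeasure_eq_measure)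
      qed
      also have "\<dots> = ennreal (\<integral>s. indicator X s * \<theta> 0 s \<partial>unit_measure)"
        by (intro nn_integral_eq_integral bounded_borel_integrable bounded_borel_mult bounded_borel_indicator X_borel \<theta>)
          (auto simp: \<theta>_def)
      finally show ?thesis unfolding M.emeasure_eq_measure
        by (subst (asm) ennreal_inj) (auto intro!: Bochner_Integration.integral_nonneg simp: \<theta>_def)
    qed
    have "{x \<in> space M. \<forall>j\<in>insert i S. x j \<in> A j} = G \<inter> {x \<in> space M. x i \<in> A i}" by (auto simp: G_def)
    then have "measure M (E \<inter> {x \<in> space M. \<forall>j\<in>insert i S. x j \<in> A j}) = (\<integral>s. indicator (A i) s * \<theta> 0 s \<partial>unit_measure)"
      using fubini[OF A[OF i]] by (simp add: Int_assoc)
    also have "\<dots> = measure unit_measure (A i \<inter> {0..1}) * integral\<^sup>L unit_measure (\<theta> 0)"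
      by (rule exact_borel[of \<theta> 1]) (use \<theta> step A[OF i] in \<open>auto simp: sets_unit_iff \<theta>_def\<close>)
    \<comment> \<open>Reading Fubini backwards with no restriction on the coordinate
      \<open>i\<close> returns the case of the induction hypothesis.\<close>
    also have "integral\<^sup>L unit_measure (\<theta> 0) = (\<integral>s. indicator {0..1} s * \<theta> 0 s \<partial>unit_measure)"
      by (intro Bochner_Integration.integral_cong) auto
    also have "\<dots> = measure M (E \<inter> G \<inter> {x \<in> space M. x i \<in> {0..1}})"
      by (rule fubini[symmetric]) (simp add: sets_unit_iff)
    also have "E \<inter> G \<inter> {x \<in> space M. x i \<in> {0..1}} = E \<inter> {x \<in> space M. \<forall>j\<in>S. x j \<in> A j}"
      using i by (auto simp: G_def space_M PiE_iff)
    also have "measure M \<dots> = measure M E * (\<Prod>j\<in>S. measure unit_measure (A j))" by (rule insert.IH[OF S])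
    finally show ?case using insert.hyps A[OF i] by (simp add: sets_unit_iff Int_absorb2 mult_ac)
  qed
  define M1 where "M1 = density M (indicator E)"
  define M2 where "M2 = density M (\<lambda>_. ennreal (measure M E))"
  have M1: "emeasure M1 X = ennreal (measure M (E \<inter> X))" if "X \<in> sets M" for X
    unfolding M1_def using that by (subst emeasure_density)
      (auto simp: indicator_inter_arith[symmetric] M.emeasure_eq_measure)
  have M2: "emeasure M2 X = ennreal (measure M E * measure M X)" if "X \<in> sets M" for X
    unfolding M2_def using that by (subst emeasure_density)
      (auto simp: nn_integral_cmult_indicator M.emeasure_eq_measure ennreal_mult)
  have "M1 = M2"
  proof (rule measure_eqI_PiM_finite[of "{..<d}" _ "\<lambda>_. unit_measure" _ "\<lambda>_. space M"])
    show "sets M1 = sets (PiM {..<d} (\<lambda>_. unit_measure))" "sets M2 = sets (PiM {..<d} (\<lambda>_. unit_measure))"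
      by (simp_all add: M1_def M2_def M_PiM)
    show "emeasure M1 (Pi\<^sub>E {..<d} A) = emeasure M2 (Pi\<^sub>E {..<d} A)"
      if A: "\<And>i. i \<in> {..<d} \<Longrightarrow> A i \<in> sets unit_measure" for A
    proof -
      have PA: "Pi\<^sub>E {..<d} A \<in> sets M" unfolding M_PiM using A by (intro sets_PiM_I_finite) auto
      have "Pi\<^sub>E {..<d} A \<subseteq> space M"
        unfolding space_M using A by (intro PiE_mono) (simp add: sets_unit_iff)
      then have "Pi\<^sub>E {..<d} A = {x \<in> space M. \<forall>j\<in>{..<d}. x j \<in> A j}"
        by (intro set_eqI) (auto simp only: subset_iff space_M PiE_iff mem_Collect_eq)
      then have "measure M (E \<inter> Pi\<^sub>E {..<d} A) = measure M E * (\<Prod>j\<in>{..<d}. measure unit_measure (A j))"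
        using box[of A "{..<d}"] A by simp
      also have "(\<Prod>j\<in>{..<d}. measure unit_measure (A j)) = measure M (Pi\<^sub>E {..<d} A)"
        unfolding M_PiM using A by (intro PP.prob_times[symmetric]) auto
      finally show ?thesis using PA by (simp add: M1 M2)
    qed
    show "range (\<lambda>_. space M) \<subseteq> prod_algebra {..<d} (\<lambda>_. unit_measure)"
      unfolding M_PiM space_PiM by (auto intro!: prod_algebraI_finite simp: sets_unit_iff)
    show "(\<Union>i. space M) = space (PiM {..<d} (\<lambda>_. unit_measure))" by (simp add: M_PiM)
    show "emeasure M1 (space M) \<noteq> \<infinity>" by (simp add: M1)
  qed simp
  then have "ennreal (measure M (E \<inter> E)) = ennreal (measure M E * measure M E)"
    using M1[OF E_M] M2[OF E_M] by simp
  then have "measure M E = measure M E * measure M E"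
    by (subst (asm) ennreal_inj) auto
  then show ?thesis by (simp add: M_def)
qed

section \<open>Joint visits of the points of a tuple\<close>

definition visit :: "nat \<Rightarrow> real set \<Rightarrow> real set" where
  "visit n A = {x \<in> {0..1}. (T ^^ n) x \<in> A}"

lemma visit_sets: "A \<in> sets borel \<Longrightarrow> visit n A \<in> sets unit_measure"
proof -
  assume "A \<in> sets borel"
  then have "A \<inter> {0..1} \<in> sets unit_measure" by (simp add: sets_unit_iff)
  then have "(T ^^ n) -` (A \<inter> {0..1}) \<inter> space unit_measure \<in> sets unit_measure"
    by (rule measurable_sets[OF T_iter_measurable_unit])
  also have "(T ^^ n) -` (A \<inter> {0..1}) \<inter> space unit_measure = visit n A"
    using T_iter_range by (auto simp: visit_def)
  finally show ?thesis .
qed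

lemma measure_visit: "A \<in> sets borel \<Longrightarrow> measure unit_measure (visit n A) = (\<integral>x. indicator A ((T ^^ n) x) \<partial>unit_measure)"
proof -
  assume A: "A \<in> sets borel"
  have "(\<integral>x. indicator A ((T ^^ n) x) \<partial>unit_measure) = (\<integral>x. indicat_real (visit n A) x \<partial>unit_measure)"
    by (intro Bochner_Integration.integral_cong) (auto simp: visit_def indicator_def)
  then show ?thesis using sets.sets_into_space[OF visit_sets[OF A, of n]] by (simp add: Int_absorb2)
qed

lemma measure_visit_twice:
  assumes A: "A \<in> sets borel"
  shows "measure unit_measure (visit n A \<inter> visit k A) =
    (\<integral>x. indicator A ((T ^^ n) x) * indicator A ((T ^^ k) x) \<partial>unit_measure)"
proof -
  have "(\<integral>x. indicator A ((T ^^ n) x) * indicator A ((T ^^ k) x) \<partial>unit_measure) =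
    (\<integral>x. indicat_real (visit n A \<inter> visit k A) x \<partial>unit_measure)"
    by (intro Bochner_Integration.integral_cong) (auto simp: visit_def indicator_def)
  moreover have "visit n A \<inter> visit k A \<subseteq> {0..1}" by (auto simp: visit_def)
  ultimately show ?thesis by (simp add: Int_absorb2)
qed

lemma measure_box:
  assumes "\<And>i. i < d \<Longrightarrow> X i \<in> sets unit_measure"
  shows "Pi\<^sub>E {..<d} X \<in> sets (lambda_d d)"
    "measure (lambda_d d) (Pi\<^sub>E {..<d} X) = (\<Prod>i<d. measure unit_measure (X i))"
proof -
  interpret PP: finite_product_prob_space "\<lambda>_. unit_measure" "{..<d}" by (rule finite_product_prob_space_unit)
  show "Pi\<^sub>E {..<d} X \<in> sets (lambda_d d)"
    unfolding lambda_d_def using assms by (intro sets_PiM_I_finite) auto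
  show "measure (lambda_d d) (Pi\<^sub>E {..<d} X) = (\<Prod>i<d. measure unit_measure (X i))"
    unfolding lambda_d_def using assms by (intro PP.prob_times) auto
qed

definition joint_visit :: "nat \<Rightarrow> (nat \<Rightarrow> real set) \<Rightarrow> nat \<Rightarrow> (nat \<Rightarrow> real) set" where
  "joint_visit d A n = Pi\<^sub>E {..<d} (\<lambda>i. visit n (A i))"

lemma joint_visit_sets: "(\<And>i. i < d \<Longrightarrow> A i \<in> sets borel) \<Longrightarrow> joint_visit d A n \<in> sets (lambda_d d)"
  unfolding joint_visit_def by (intro measure_box visit_sets) auto

lemma mem_joint_visit: "x \<in> space (lambda_d d) \<Longrightarrow> x \<in> joint_visit d A n \<longleftrightarrow> (\<forall>i<d. (T ^^ n) (x i) \<in> A i)"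
  by (auto simp: joint_visit_def visit_def space_lambda_d PiE_iff)

text \<open>Infinite recurrence does not change when time is shifted by one, so the event is
  invariant under the product map and the zero-one law applies.\<close>

lemma AE_joint_visit:
  assumes A: "\<And>i. i < d \<Longrightarrow> A i \<in> sets borel"
    and pos: "0 < measure (lambda_d d) {x \<in> space (lambda_d d). \<exists>\<^sub>F n in sequentially. x \<in> joint_visit d A n}"
  shows "AE x in lambda_d d. \<exists>\<^sub>F n in sequentially. \<forall>i<d. (T ^^ n) (x i) \<in> A i"
proof -
  interpret prob_space "lambda_d d" by (rule prob_space_lambda_d)
  define E where "E = {x \<in> space (lambda_d d). \<exists>\<^sub>F n in sequentially. x \<in> joint_visit d A n}"
  have E_sets: "E \<in> sets (lambda_d d)"
    unfolding E_def by (intro frequently_measurable joint_visit_sets A)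
  have E_iff: "x \<in> E \<longleftrightarrow> (\<exists>\<^sub>F n in sequentially. \<forall>i<d. (T ^^ n) (x i) \<in> A i)" if "x \<in> space (lambda_d d)" for x
    using that by (simp add: E_def mem_joint_visit)
  have "(\<lambda>i\<in>{..<d}. T (x i)) \<in> E \<longleftrightarrow> x \<in> E" if x: "x \<in> space (lambda_d d)" for x
  proof -
    have Tx: "(\<lambda>i\<in>{..<d}. T (x i)) \<in> space (lambda_d d)"
      using x T_range by (auto simp: space_lambda_d PiE_iff)
    have "(\<lambda>i\<in>{..<d}. T (x i)) \<in> E \<longleftrightarrow> (\<exists>\<^sub>F n in sequentially. \<forall>i<d. (T ^^ Suc n) (x i) \<in> A i)"
      unfolding E_iff[OF Tx] by (simp add: funpow_swap1)
    also have "\<dots> \<longleftrightarrow> (\<exists>\<^sub>F n in sequentially. \<forall>i<d. (T ^^ n) (x i) \<in> A i)"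
      using eventually_sequentially_Suc[of "\<lambda>n. \<not> (\<forall>i<d. (T ^^ n) (x i) \<in> A i)"] by (simp add: frequently_def)
    finally show ?thesis unfolding E_iff[OF x] .
  qed
  then have "prob E = 1" using product_zero_one[OF E_sets] pos by (auto simp: E_def)
  then have "AE x in lambda_d d. x \<in> E" using E_sets by (simp add: prob_eq_1)
  then show ?thesis using AE_space by eventually_elim (simp add: E_iff)
qed

theorem AE_all_near_zero:
  assumes "0 < \<eta>" "\<eta> \<le> 1"
  shows "AE x in lambda_d d. \<exists>\<^sub>F n in sequentially. \<forall>i<d. (T ^^ n) (x i) \<in> {0..\<eta>}"
proof (rule AE_joint_visit)
  interpret prob_space "lambda_d d" by (rule prob_space_lambda_d)
  have "\<eta> ^ d \<le> prob (joint_visit d (\<lambda>_. {0..\<eta>}) n)" for n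
  proof -
    have "(\<Prod>i<d. \<eta>) \<le> (\<Prod>i<d. measure unit_measure (visit n {0..\<eta>}))"
      using visit_zero_lower[of \<eta> n] assms by (intro prod_mono) (auto simp: measure_visit)
    then show ?thesis by (simp add: joint_visit_def measure_box visit_sets)
  qed
  then have "\<eta> ^ d \<le> prob {x \<in> space (lambda_d d). \<exists>\<^sub>F n in sequentially. x \<in> joint_visit d (\<lambda>_. {0..\<eta>}) n}"
    by (intro prob_frequently_ge joint_visit_sets) auto
  moreover have "0 < \<eta> ^ d" using assms by simp
  ultimately show "0 < prob {x \<in> space (lambda_d d). \<exists>\<^sub>F n in sequentially. x \<in> joint_visit d (\<lambda>_. {0..\<eta>}) n}"
    by linarith
qed auto

text \<open>Kochen-Stone with weights \<open>u n ^ m\<close>. The coordinate \<open>m\<close> near 0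
  affects only constants: its factor is at least \<eta> at any time and at most 1 for pairs of
  times. So the exponent is \<open>m\<close>, one less than the number of points.\<close>

theorem AE_spread:
  assumes m: "1 \<le> m" "1 - 1 / real m \<le> 1 / \<alpha>"
    and A: "\<And>i. i < m \<Longrightarrow> A i \<in> sets borel" "\<And>i. i < m \<Longrightarrow> A i \<subseteq> {1/2..1}" "\<And>i. i < m \<Longrightarrow> \<kappa> \<le> measure lborel (A i)"
    and \<kappa>: "0 < \<kappa>" and \<eta>: "0 < \<eta>" "\<eta> \<le> 1" "A m = {0..\<eta>}"
  shows "AE x in lambda_d (Suc m). \<exists>\<^sub>F n in sequentially. \<forall>i<Suc m. (T ^^ n) (x i) \<in> A i"
proof (rule AE_joint_visit)
  interpret prob_space "lambda_d (Suc m)" by (rule prob_space_lambda_d)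
  show A_sets: "A i \<in> sets borel" if "i < Suc m" for i using that A(1) \<eta>(3) by (cases "i = m") auto
  define C where "C = (2 powr (1 + \<alpha>))\<^sup>2"
  show "0 < prob {x \<in> space (lambda_d (Suc m)). \<exists>\<^sub>F n in sequentially. x \<in> joint_visit (Suc m) A n}"
  proof (rule prob_frequently_pos[where w = "\<lambda>n. u n ^ m" and c = "\<kappa> ^ m * \<eta>" and C = "C ^ m"])
    show "joint_visit (Suc m) A n \<in> events" for n by (intro joint_visit_sets A_sets)
    show "\<not> summable (\<lambda>n. u n ^ m)" by (rule not_summable_u[OF m])
    show "0 \<le> u n ^ m" for n by (simp add: u_nonneg)
    show "\<kappa> ^ m * \<eta> * u n ^ m \<le> prob (joint_visit (Suc m) A n)" for n
    proof -
      have "(\<Prod>i<m. \<kappa> * u n) \<le> (\<Prod>i<m. measure unit_measure (visit n (A i)))"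
      proof (intro prod_mono conjI)
        fix i assume i: "i \<in> {..<m}"
        have 1: "\<kappa> * u n \<le> u n * measure lborel (A i)"
          using mult_right_mono[OF A(3)[of i] u_nonneg[of n]] i by (simp add: mult.commute)
        have "A i \<subseteq> {0..1}" using A(2)[of i] i by force
        then have "u n * measure lborel (A i) \<le> measure unit_measure (visit n (A i))"
          using i A(1)[of i] visit_lower[of "A i" n] by (simp add: measure_visit)
        with 1 show "\<kappa> * u n \<le> measure unit_measure (visit n (A i))" by linarith
      qed (use \<kappa> u_nonneg in simp)
      moreover have "\<eta> \<le> measure unit_measure (visit n (A m))"
        using visit_zero_lower[of \<eta> n] \<eta> by (simp add: measure_visit)
      ultimately have "(\<kappa> * u n) ^ m * \<eta> \<le> (\<Prod>i<m. measure unit_measure (visit n (A i))) * measure unit_measure (visit n (A m))"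
        using \<eta> \<kappa> u_nonneg by (intro mult_mono prod_nonneg) auto
      also have "\<dots> = prob (joint_visit (Suc m) A n)"
        unfolding joint_visit_def by (subst measure_box) (auto simp: visit_sets A_sets)
      finally show ?thesis by (simp add: power_mult_distrib mult_ac)
    qed
    show "prob (joint_visit (Suc m) A n \<inter> joint_visit (Suc m) A k) \<le> C ^ m * (u n ^ m * u (k - n) ^ m)" if "n \<le> k" for n k
    proof -
      have "prob (joint_visit (Suc m) A n \<inter> joint_visit (Suc m) A k) =
        (\<Prod>i<Suc m. measure unit_measure (visit n (A i) \<inter> visit k (A i)))"
        unfolding joint_visit_def PiE_Int by (subst measure_box) (auto intro!: sets.Int visit_sets A_sets)
      also have "\<dots> \<le> (\<Prod>i<m. measure unit_measure (visit n (A i) \<inter> visit k (A i))) * 1"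
        unfolding prod.lessThan_Suc
        by (intro mult_left_mono prod_nonneg prob_space.prob_le_1[OF prob_space_unit_measure]) auto
      also have "\<dots> \<le> (\<Prod>i<m. C * (u n * u (k - n)))"
        unfolding mult_1_right C_def using A(1,2) that
        by (intro prod_mono) (auto simp: measure_visit_twice intro!: visit_twice_upper)
      finally show ?thesis by (simp add: power_mult_distrib)
    qed
  qed (use \<kappa> \<eta> in \<open>auto simp: C_def\<close>)
qed

end


section \<open>Li-Yorke tuples\<close>

lemma pair_set_image:
  "{f i j |i j. P i j} = (\<lambda>(i, j). f i j) ` {(i, j). P i j}"
  by auto

lemma finite_pairs:
  "finite {f i j |i j. i < d \<and> j < (d :: nat)}" "finite {f i j |i j. i < d \<and> j < d \<and> i \<noteq> j}"
  unfolding pair_set_image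
  by (intro finite_imageI finite_subset[OF _ finite_cartesian_product[of "{..<d}" "{..<d}"]]; auto)+

lemma proximalI:
  assumes d: "0 < d"
    and freq: "\<And>k :: nat. \<exists>\<^sub>F n in sequentially. \<forall>i<d. (T ^^ n) (x i) \<in> {0..1 / real (Suc k)}"
  shows "proximal T d x"
proof -
  define D where "D n = Max {\<bar>(T ^^ n) (x i) - (T ^^ n) (x j)\<bar> | i j. i < d \<and> j < d}" for n
  have "0 \<le> D n" for n unfolding D_def
    by (rule order_trans[OF abs_ge_zero Max_ge[OF finite_pairs(1)]]) (use d in blast)
  then have "0 \<le> liminf (\<lambda>n. ereal (D n))" by (intro Liminf_bounded) simp
  moreover have "liminf (\<lambda>n. ereal (D n)) \<le> 0"
  proof (rule ccontr)
    assume "\<not> ?thesis"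
    then have "0 < liminf (\<lambda>n. ereal (D n))" by simp
    then obtain y where y: "0 < ereal y" "ereal y < liminf (\<lambda>n. ereal (D n))"
      using ereal_dense2 by blast
    then obtain k where k: "1 / real (Suc k) < y" using nat_approx_posE[of y] by auto
    have "\<forall>\<^sub>F n in sequentially. ereal y < ereal (D n)" using y(2) by (rule less_LiminfD)
    then obtain n where n: "ereal y < ereal (D n)" "\<forall>i<d. (T ^^ n) (x i) \<in> {0..1 / real (Suc k)}"
      using frequently_eventually_frequently[OF freq[of k], of "\<lambda>n. ereal y < ereal (D n)"]
      by (auto dest: frequently_ex)
    have "D n \<le> 1 / real (Suc k)" unfolding D_def
    proof (rule Max.boundedI[OF finite_pairs(1)])
      fix z assume "z \<in> {\<bar>(T ^^ n) (x i) - (T ^^ n) (x j)\<bar> |i j. i < d \<and> j < d}"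
      then obtain i j where "z = \<bar>(T ^^ n) (x i) - (T ^^ n) (x j)\<bar>" "i < d" "j < d" by blast
      then show "z \<le> 1 / real (Suc k)" using n(2)[rule_format, of i] n(2)[rule_format, of j] by auto
    qed (use d in auto)
    with n(1) k show False by simp
  qed
  ultimately show ?thesis by (simp add: proximal_def D_def antisym)
qed

lemma pairs_nonempty:
  fixes d :: nat
  assumes "2 \<le> d"
  shows "{f i j |i j. i < d \<and> j < d \<and> i \<noteq> j} \<noteq> {}"
proof -
  have "f 0 1 \<in> {f i j |i j. i < d \<and> j < d \<and> i \<noteq> j}" using assms by force
  then show ?thesis by blast
qed

text \<open>Infinitely many good times give only a weak inequality for the limsup; the room between
  \<delta> and \<open>\<delta>'\<close> makes it strict. The bound \<open>2 \<le> d\<close> ensures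
  that the minimum is over a nonempty set.\<close>

lemma delta_separatedI:
  assumes d: "2 \<le> d" and "\<delta> < \<delta>'"
    and freq: "\<exists>\<^sub>F n in sequentially. \<forall>i<d. \<forall>j<d. i \<noteq> j \<longrightarrow> \<delta>' \<le> \<bar>(T ^^ n) (x i) - (T ^^ n) (x j)\<bar>"
  shows "delta_separated T d \<delta> x"
proof -
  define D where "D n = Min {\<bar>(T ^^ n) (x i) - (T ^^ n) (x j)\<bar> | i j. i < d \<and> j < d \<and> i \<noteq> j}" for n
  have "ereal \<delta>' \<le> limsup (\<lambda>n. ereal (D n))"
  proof (rule ccontr)
    assume "\<not> ?thesis"
    then have "\<forall>\<^sub>F n in sequentially. ereal (D n) < ereal \<delta>'" by (intro Limsup_lessD) simp
    then obtain n where n: "D n < \<delta>'" "\<forall>i<d. \<forall>j<d. i \<noteq> j \<longrightarrow> \<delta>' \<le> \<bar>(T ^^ n) (x i) - (T ^^ n) (x j)\<bar>"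
      using frequently_eventually_frequently[OF freq, of "\<lambda>n. ereal (D n) < ereal \<delta>'"]
      by (auto dest: frequently_ex)
    have "\<delta>' \<le> D n" unfolding D_def
      using n(2) by (intro Min.boundedI[OF finite_pairs(2) pairs_nonempty[OF d]]) auto
    with n(1) show False by simp
  qed
  moreover have "ereal \<delta> < ereal \<delta>'" using assms by simp
  ultimately have "ereal \<delta> < limsup (\<lambda>n. ereal (D n))" by (rule less_le_trans[rotated])
  then show ?thesis by (simp add: delta_separated_def D_def)
qed

lemma not_delta_separatedI:
  assumes "\<forall>\<^sub>F n in sequentially. \<exists>i<d. \<exists>j<d. i \<noteq> j \<and> \<bar>(T ^^ n) (x i) - (T ^^ n) (x j)\<bar> \<le> \<delta>"
  shows "\<not> delta_separated T d \<delta> x"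
proof -
  define D where "D n = Min {\<bar>(T ^^ n) (x i) - (T ^^ n) (x j)\<bar> | i j. i < d \<and> j < d \<and> i \<noteq> j}" for n
  have "\<forall>\<^sub>F n in sequentially. ereal (D n) \<le> ereal \<delta>"
    using assms
  proof eventually_elim
    case (elim n)
    then obtain i j where ij: "i < d" "j < d" "i \<noteq> j" "\<bar>(T ^^ n) (x i) - (T ^^ n) (x j)\<bar> \<le> \<delta>" by blast
    have "D n \<le> \<bar>(T ^^ n) (x i) - (T ^^ n) (x j)\<bar>"
      unfolding D_def using ij by (intro Min_le finite_pairs) blast
    with ij show ?case by simp
  qed
  then have "limsup (\<lambda>n. ereal (D n)) \<le> ereal \<delta>" by (rule Limsup_bounded)
  then show ?thesis by (simp add: delta_separated_def D_def)
qed

lemma delta_separated_mono: "delta_separated T d \<delta> x \<Longrightarrow> \<delta>' \<le> \<delta> \<Longrightarrow> delta_separated T d \<delta>' x"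
  unfolding delta_separated_def by (rule le_less_trans[of "ereal \<delta>'" "ereal \<delta>"]) simp_all

section \<open>Almost sure behaviour of tuples\<close>

context manneville_pomeau
begin

lemma AE_proximal:
  assumes "0 < d"
  shows "AE x in lambda_d d. proximal T d x"
proof -
  have "AE x in lambda_d d. \<exists>\<^sub>F n in sequentially. \<forall>i<d. (T ^^ n) (x i) \<in> {0..1 / real (Suc k)}" for k
    by (rule AE_all_near_zero) auto
  then have "AE x in lambda_d d. \<forall>k. \<exists>\<^sub>F n in sequentially. \<forall>i<d. (T ^^ n) (x i) \<in> {0..1 / real (Suc k)}"
    by (simp add: AE_all_countable)
  then show ?thesis by eventually_elim (use assms proximalI in blast)
qed

lemma AE_delta_li_yorkeI:
  assumes m: "1 \<le> m" "1 - 1 / real m \<le> 1 / \<alpha>"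
    and A: "\<And>i. i < m \<Longrightarrow> A i \<in> sets borel" "\<And>i. i < m \<Longrightarrow> A i \<subseteq> {1/2..1}" "\<And>i. i < m \<Longrightarrow> \<kappa> \<le> measure lborel (A i)"
    and \<kappa>: "0 < \<kappa>" and \<eta>: "0 < \<eta>" "\<eta> \<le> 1" "A m = {0..\<eta>}"
    and sep: "\<delta> < \<delta>'" "\<And>i j s t. i < j \<Longrightarrow> j \<le> m \<Longrightarrow> s \<in> A i \<Longrightarrow> t \<in> A j \<Longrightarrow> \<delta>' \<le> \<bar>s - t\<bar>"
  shows "AE x in lambda_d (Suc m). delta_li_yorke T (Suc m) \<delta> x"
proof -
  have "AE x in lambda_d (Suc m). \<exists>\<^sub>F n in sequentially. \<forall>i<Suc m. (T ^^ n) (x i) \<in> A i"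
    by (rule AE_spread[where A = A and \<kappa> = \<kappa> and \<eta> = \<eta>, OF m A \<kappa> \<eta>])
  moreover have "AE x in lambda_d (Suc m). proximal T (Suc m) x" by (rule AE_proximal) simp
  ultimately show ?thesis
  proof eventually_elim
    case (elim x)
    have "\<exists>\<^sub>F n in sequentially. \<forall>i<Suc m. \<forall>j<Suc m. i \<noteq> j \<longrightarrow> \<delta>' \<le> \<bar>(T ^^ n) (x i) - (T ^^ n) (x j)\<bar>"
      using elim(1)
    proof (rule frequently_elim1)
      fix n assume n: "\<forall>i<Suc m. (T ^^ n) (x i) \<in> A i"
      show "\<forall>i<Suc m. \<forall>j<Suc m. i \<noteq> j \<longrightarrow> \<delta>' \<le> \<bar>(T ^^ n) (x i) - (T ^^ n) (x j)\<bar>"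
      proof (intro allI impI)
        fix i j assume ij: "i < Suc m" "j < Suc m" "i \<noteq> j"
        then consider "i < j" | "j < i" by linarith
        then show "\<delta>' \<le> \<bar>(T ^^ n) (x i) - (T ^^ n) (x j)\<bar>"
        proof cases
          case 1
          then show ?thesis using sep(2)[of i j] ij n by auto
        next
          case 2
          then show ?thesis using sep(2)[of j i "(T ^^ n) (x j)" "(T ^^ n) (x i)"] ij n
            by (simp add: abs_minus_commute)
        qed
      qed
    qed
    then have "delta_separated T (Suc m) \<delta> x"
      using m by (intro delta_separatedI[OF _ sep(1)]) auto
    with elim(2) show ?case by (simp add: delta_li_yorke_def)
  qed
qed

text \<open>For \<open>m = 1\<close> the divergence condition reads
  \<open>0 \<le> 1 / \<alpha>\<close>, so there is no restriction on \<alpha>: one point visits a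
  neighbourhood of 1 while the other is near 0. The gap 8/10 leaves ample room above 1/3.\<close>

lemma AE_li_yorke_pair: "AE x in lambda_d 2. delta_li_yorke T 2 (1/3) x"
proof -
  define A :: "nat \<Rightarrow> real set" where "A i = (if i = 0 then {9/10..1} else {0..1/10})" for i
  have "AE x in lambda_d (Suc 1). delta_li_yorke T (Suc 1) (1/3) x"
  proof (rule AE_delta_li_yorkeI[where A = A and \<kappa> = "1/10" and \<eta> = "1/10" and \<delta>' = "8/10"])
    show "8/10 \<le> \<bar>s - t\<bar>" if "i < j" "j \<le> 1" "s \<in> A i" "t \<in> A j" for i j s t
      using that by (auto simp: A_def split: if_splits)
  qed (use alpha_pos in \<open>auto simp: A_def\<close>)
  moreover have "Suc 1 = 2" by simp
  ultimately show ?thesis by (simp only:)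
qed

text \<open>For \<open>\<delta> < 1 / (2 * (d - 2))\<close>, one point is placed near 0 and the other \<open>d - 1\<close> points
  almost equidistantly in \<open>[1/2, 1]\<close>.\<close>

lemma AE_li_yorke_tuple:
  assumes d: "3 \<le> d" and \<alpha>: "\<alpha> \<le> (real d - 1) / (real d - 2)" and \<delta>: "\<delta> < 1 / (2 * (real d - 2))"
  shows "AE x in lambda_d d. delta_li_yorke T d \<delta> x"
proof -
  define m where "m = d - 1"
  have dm: "d = Suc m" "2 \<le> m" using d by (auto simp: m_def)
  \<comment> \<open>The \<open>m = d - 1\<close> points in an interval of length 1/2 have
    \<open>m - 1 = d - 2\<close> gaps.\<close>
  define \<Delta> where "\<Delta> = 1 / (2 * (real m - 1))"
  have \<Delta>: "0 < \<Delta>" "\<Delta> \<le> 1/2" "(real m - 1) * \<Delta> = 1/2" "\<delta> < \<Delta>"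
    using dm \<delta> by (auto simp: \<Delta>_def field_simps)
  \<comment> \<open>The target intervals have length \<eta> and spacing
    \<open>\<Delta> - \<eta>\<close>, so that the last one ends before 1 and neighbours are
    \<open>\<Delta> - 2 * \<eta>\<close> apart. This exceeds \<delta> because
    \<open>\<eta> \<le> (\<Delta> - \<delta>) / 4\<close>; since \<delta> may be negative,
    \<open>\<eta> \<le> \<Delta> / 4\<close> is required as well.\<close>
  define \<eta> where "\<eta> = min (\<Delta> / 4) ((\<Delta> - \<delta>) / 4)"
  have \<eta>: "0 < \<eta>" "\<eta> \<le> \<Delta> / 4" "\<eta> \<le> (\<Delta> - \<delta>) / 4" using \<Delta> by (auto simp: \<eta>_def min_def)
  define A :: "nat \<Rightarrow> real set" where
    "A i = (if i < m then {1/2 + real i * (\<Delta> - \<eta>)..1/2 + real i * (\<Delta> - \<eta>) + \<eta>} else {0..\<eta>})" for i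
  have "AE x in lambda_d (Suc m). delta_li_yorke T (Suc m) \<delta> x"
  proof (rule AE_delta_li_yorkeI[where A = A and \<kappa> = \<eta> and \<eta> = \<eta> and \<delta>' = "\<Delta> - 2 * \<eta>"])
    have "(real m - 1) * \<alpha> \<le> real m" using \<alpha> dm by (simp add: field_simps)
    then show "1 - 1 / real m \<le> 1 / \<alpha>" using alpha_pos dm by (simp add: field_simps)
    show "A i \<subseteq> {1/2..1}" if "i < m" for i
    proof -
      have "real i * (\<Delta> - \<eta>) \<le> (real m - 1) * (\<Delta> - \<eta>)"
        using that \<eta> \<Delta> by (intro mult_right_mono) auto
      also have "\<dots> = 1/2 - (real m - 1) * \<eta>" using \<Delta> by (simp add: right_diff_distrib)
      also have "\<dots> \<le> 1/2 - 1 * \<eta>"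
        using dm \<eta> by (intro diff_left_mono mult_right_mono) auto
      finally have "real i * (\<Delta> - \<eta>) \<le> 1/2 - \<eta>" by simp
      moreover have "0 \<le> real i * (\<Delta> - \<eta>)" using \<eta> \<Delta> by simp
      ultimately show ?thesis using that by (auto simp: A_def)
    qed
    show "\<Delta> - 2 * \<eta> \<le> \<bar>s - t\<bar>" if ij: "i < j" "j \<le> m" and st: "s \<in> A i" "t \<in> A j" for i j s t
    proof (cases "j < m")
      case True
      have "(real i + 1) * (\<Delta> - \<eta>) \<le> real j * (\<Delta> - \<eta>)"
        using ij \<eta> \<Delta> by (intro mult_right_mono) auto
      then show ?thesis using st True ij by (auto simp: A_def algebra_simps)
    next
      case False
      have "0 \<le> real i * (\<Delta> - \<eta>)" using \<eta> \<Delta> by simp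
      moreover have "1/2 + real i * (\<Delta> - \<eta>) \<le> s" "t \<le> \<eta>"
        using st False ij by (auto simp: A_def)
      ultimately show ?thesis using \<Delta> \<eta> by linarith
    qed
  qed (use \<eta> \<Delta> dm in \<open>auto simp: A_def\<close>)
  then show ?thesis by (simp only: dm(1))
qed

lemma AE_not_delta_separated:
  assumes d: "3 \<le> d" and \<alpha>: "(real d - 1) / (real d - 2) < \<alpha>" and \<epsilon>: "0 < \<epsilon>"
  shows "AE x in lambda_d d. \<not> delta_separated T d \<epsilon> x"
proof -
  interpret prob_space "lambda_d d" by (rule prob_space_lambda_d)
  have \<alpha>1: "1 < \<alpha>"
  proof -
    have "1 \<le> (real d - 1) / (real d - 2)" using d by (simp add: field_simps)
    then show ?thesis using \<alpha> by simp
  qed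
  obtain M where M: "0 < M" "\<And>n. u n \<le> M * real (Suc n) powr (1 / \<alpha> - 1)"
    using u_upper[OF \<alpha>1] by blast
  define K where "K = \<epsilon> powr (- 1 - \<alpha>) * M"
  \<comment> \<open>The index \<open>i\<close> is the one coordinate allowed near 0. Outside the
    union \<open>S n\<close> over \<open>i\<close>, two points are closer to 0 than
    \<epsilon>.\<close>
  define A where "A i j = (if j = i then {0..1} else {\<epsilon>..1})" for i j :: nat
  define S where "S n = (\<Union>i<d. joint_visit d (A i) n)" for n
  have A_sets: "A i j \<in> sets borel" for i j by (simp add: A_def)
  have S_sets: "S n \<in> events" for n unfolding S_def by (intro sets.finite_UN joint_visit_sets A_sets) auto
  \<comment> \<open>The exponent of \<open>u n ^ (d - 1)\<close> under the bound
    \<open>u_upper\<close>; \<open>p < -1\<close> is the hypothesis on \<alpha> rewritten.\<close>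
  define p where "p = (1 / \<alpha> - 1) * real (d - 1)"
  have p: "p < -1"
  proof -
    have "real d - 1 < \<alpha> * (real d - 2)" using \<alpha> d by (simp add: field_simps)
    then have "(real d - 1) / \<alpha> < real d - 2" using alpha_pos by (simp add: field_simps)
    then show ?thesis using d by (simp add: p_def of_nat_diff left_diff_distrib)
  qed
  have prob_S: "prob (S n) \<le> real d * K ^ (d - 1) * real (Suc n) powr p" for n
  proof -
    have one: "prob (joint_visit d (A i) n) \<le> K ^ (d - 1) * real (Suc n) powr p" if i: "i < d" for i
    proof -
      have "prob (joint_visit d (A i) n) = (\<Prod>j<d. measure unit_measure (visit n (A i j)))"
        unfolding joint_visit_def by (intro measure_box visit_sets A_sets)
      also have "\<dots> = measure unit_measure (visit n (A i i)) * (\<Prod>j\<in>{..<d} - {i}. measure unit_measure (visit n (A i j)))"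
        using i by (intro prod.remove) auto
      also have "\<dots> \<le> 1 * (\<Prod>j\<in>{..<d} - {i}. K * real (Suc n) powr (1 / \<alpha> - 1))"
      proof (intro mult_mono prod_mono conjI prod_nonneg prob_space.prob_le_1[OF prob_space_unit_measure])
        fix j assume j: "j \<in> {..<d} - {i}"
        have "measure unit_measure (visit n (A i j)) \<le> \<epsilon> powr (- 1 - \<alpha>) * u n"
          using j \<epsilon> visit_upper[of "{\<epsilon>..1}" \<epsilon> n] by (subst measure_visit) (auto simp: A_def)
        also have "\<dots> \<le> \<epsilon> powr (- 1 - \<alpha>) * (M * real (Suc n) powr (1 / \<alpha> - 1))"
          by (intro mult_left_mono M) auto
        finally show "measure unit_measure (visit n (A i j)) \<le> K * real (Suc n) powr (1 / \<alpha> - 1)"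
          by (simp add: K_def)
      qed auto
      also have "\<dots> = K ^ (d - 1) * (real (Suc n) powr (1 / \<alpha> - 1)) ^ (d - 1)"
        using i by (simp add: power_mult_distrib)
      also have "(real (Suc n) powr (1 / \<alpha> - 1)) ^ (d - 1) = real (Suc n) powr p"
        by (simp add: p_def powr_powr[symmetric] powr_realpow)
      finally show ?thesis .
    qed
    have "prob (S n) \<le> (\<Sum>i<d. prob (joint_visit d (A i) n))"
      unfolding S_def by (intro finite_measure_subadditive_finite) (auto intro!: joint_visit_sets A_sets)
    also have "\<dots> \<le> (\<Sum>i<d. K ^ (d - 1) * real (Suc n) powr p)" by (intro sum_mono one) auto
    finally show ?thesis by (simp add: mult.assoc)
  qed
  have "summable (\<lambda>n. real (Suc n) powr p)"
    using p summable_real_powr_iff[of p] by (subst summable_Suc_iff) auto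
  then have "summable (\<lambda>n. real d * K ^ (d - 1) * real (Suc n) powr p)" by (rule summable_mult)
  then have "summable (\<lambda>n. prob (S n))"
    by (rule summable_comparison_test'[where N = 0]) (use prob_S in auto)
  then have "AE x in lambda_d d. \<forall>\<^sub>F n in sequentially. x \<in> space (lambda_d d) - S n"
    by (intro borel_cantelli_AE1 S_sets) (auto simp: less_top[symmetric])
  then show ?thesis
  proof eventually_elim
    case (elim x)
    show ?case
    proof (rule not_delta_separatedI)
      show "\<forall>\<^sub>F n in sequentially. \<exists>i<d. \<exists>j<d. i \<noteq> j \<and> \<bar>(T ^^ n) (x i) - (T ^^ n) (x j)\<bar> \<le> \<epsilon>"
        using elim
      proof eventually_elim
        case (elim n)
        then have x: "x \<in> space (lambda_d d)" and nS: "\<And>i. i < d \<Longrightarrow> \<exists>j<d. (T ^^ n) (x j) \<notin> A i j"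
          by (auto simp: S_def mem_joint_visit)
        have range: "(T ^^ n) (x j) \<in> {0..1}" if "j < d" for j
          using x that T_iter_range by (auto simp: space_lambda_d PiE_iff)
        have ex: "\<exists>j<d. j \<noteq> i \<and> (T ^^ n) (x j) < \<epsilon>" if i: "i < d" for i
        proof -
          obtain j where j: "j < d" "(T ^^ n) (x j) \<notin> A i j" using nS[OF i] by blast
          then have "j \<noteq> i \<and> (T ^^ n) (x j) < \<epsilon>"
            using range[OF j(1)] by (auto simp: A_def split: if_splits)
          with j show ?thesis by blast
        qed
        \<comment> \<open>Exempting the arbitrary coordinate 0 yields one point below \<epsilon>;
          exempting that point yields a second, different one.\<close>
        obtain j where j: "j < d" "(T ^^ n) (x j) < \<epsilon>" using ex[of 0] d by auto
        obtain k where k: "k < d" "k \<noteq> j" "(T ^^ n) (x k) < \<epsilon>" using ex[OF j(1)] by blast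
        have "\<bar>(T ^^ n) (x j) - (T ^^ n) (x k)\<bar> \<le> \<epsilon>"
          using range[OF j(1)] range[OF k(1)] j k by auto
        then show ?case using j k by blast
      qed
    qed
  qed
qed

lemma AE_not_li_yorke:
  assumes "3 \<le> d" "(real d - 1) / (real d - 2) < \<alpha>"
  shows "AE x in lambda_d d. \<not> li_yorke T d x"
proof -
  have "AE x in lambda_d d. \<forall>k :: nat. \<not> delta_separated T d (1 / real (Suc k)) x"
    unfolding AE_all_countable by (intro allI AE_not_delta_separated assms) simp
  then show ?thesis
  proof eventually_elim
    case (elim x)
    show ?case
    proof
      assume "li_yorke T d x"
      then obtain \<delta> where \<delta>: "0 < \<delta>" "delta_separated T d \<delta> x" by (auto simp: li_yorke_def separated_def)
      obtain k where "1 / real (Suc k) < \<delta>" using nat_approx_posE[OF \<delta>(1)] by auto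
      then have "delta_separated T d (1 / real (Suc k)) x"
        by (intro delta_separated_mono[OF \<delta>(2)]) simp
      with elim show False by blast
    qed
  qed
qed

end

theorem theoremB:
  fixes \<alpha> :: real
  assumes "\<alpha> > 0"
  shows "(AE x in lambda_d 2. delta_li_yorke (MP \<alpha>) 2 (1/3) x) \<and>
    (\<forall>d::nat. d \<ge> 3 \<longrightarrow>
      ((\<alpha> \<le> (real d - 1) / (real d - 2) \<longrightarrow>
          (\<forall>\<delta>::real. \<delta> < 1 / (2 * (real d - 2)) \<longrightarrow>
             (AE x in lambda_d d. delta_li_yorke (MP \<alpha>) d \<delta> x))) \<and>
       (\<alpha> > (real d - 1) / (real d - 2) \<longrightarrow>
          (\<forall>\<epsilon>::real. \<epsilon> > 0 \<longrightarrow>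
             (AE x in lambda_d d. \<not> delta_separated (MP \<alpha>) d \<epsilon> x)) \<and>
          (AE x in lambda_d d. \<not> li_yorke (MP \<alpha>) d x))))"
proof -
  interpret manneville_pomeau \<alpha> by unfold_locales (rule assms)
  show ?thesis
    by (intro conjI allI impI AE_li_yorke_pair AE_li_yorke_tuple AE_not_delta_separated AE_not_li_yorke)
qed

end
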